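(* Let $p$ be an odd prime, let $k\geq 1$, and let $*$ be $S$ or $Z$. The mod-$p$ Johnson map $\tau_k^*:\mathcal{I}_{g,1}^*(k)\to\mathrm{Hom}(H_1(\Sigma_{g,1};\mathbf{F}_p),\mathcal{L}_{k+1}^* )$, $\tau_k^*(f)([x])=f(x)x^{-1}\bmod\Gamma_{k+2}^*$, is a group homomorphism.
   Context: $\Sigma_{g,1}$ is a compact connected orientable surface of genus $g$ with one boundary component. $Mod_{g,1}$ is its mapping class group: orientation-preserving homeomorphisms of $\Sigma_{g,1}$ fixing the boundary pointwise, modulo isotopy relative to the boundary. $\Gamma=\pi_1(\Sigma_{g,1})$ with basepoint on the boundary; it is free of rank $2g$ and $Mod_{g,1}$ acts on it. For a group $G$, $G^m$ is the subgroup generated by $m$-th powers. The lower central series is $\Gamma_1=\Gamma$, $\Gamma_k=[\Gamma,\Gamma_{k-1}]$. The Zassenhaus mod-$p$ central series is $\Gamma_k^Z=\prod_{ip^j\geq k}(\Gamma_i)^{p^j}$ (over $i\ge 1$, $j\ge 0$); the Stallings mod-$p$ central series is $\Gamma_1^S=\Gamma$, $\Gamma_k^S=[\Gamma,\Gamma_{k-1}^S](\Gamma_{k-1}^S)^p$. For $*=S$ or $Z$: $\mathcal{L}_k^*=\Gamma_k^*/\Gamma_{k+1}^*$, an $\mathbf{F}_p$-vector space, and $\mathcal{I}_{g,1}^*(k)=\{f\in Mod_{g,1}\mid f(x)x^{-1}\in\Gamma_{k+1}^*\text{ for all }x\in\Gamma\}$. For fixed $f\in\mathcal{I}_{g,1}^*(k)$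 the map $\Gamma\to\mathcal{L}_{k+1}^*$, $x\mapsto f(x)x^{-1}\bmod\Gamma_{k+2}^*$, is a homomorphism to an $\mathbf{F}_p$-vector space, hence factors through $H_1(\Sigma_{g,1};\mathbf{F}_p)$; the induced map is $\tau_k^*(f)$. Here $[x]$ is the class of $x\in\Gamma$ in $H_1(\Sigma_{g,1};\mathbf{F}_p)$. *)

theory Defs
  imports
    "HOL-Homology.Homology"
    "HOL-Algebra.Bij"
    "HOL-Algebra.Generated_Groups"
    "HOL-Computational_Algebra.Primes"
begin

section \<open>Surfaces\<close>

text \<open>
  Second countability is not demanded here: only compact surfaces are used below, and for them
  it follows from the local charts.
\<close>

definition surface_with_boundary :: "'a::topological_space set \<Rightarrow> bool" where
  "surface_with_boundary S \<longleftrightarrow>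
     Hausdorff_space (top_of_set S) \<and>
     (\<forall>x\<in>S. \<exists>U V. openin (top_of_set S) U \<and> x \<in> U \<and>
        openin (top_of_set {z::complex. 0 \<le> Im z}) V \<and> U homeomorphic V)"

definition surface_interior :: "'a::topological_space set \<Rightarrow> 'a set" where
  "surface_interior S =
     {x \<in> S. \<exists>U V. openin (top_of_set S) U \<and> x \<in> U \<and> open (V :: complex set) \<and> U homeomorphic V}"

definition surface_boundary :: "'a::topological_space set \<Rightarrow> 'a set" where
  "surface_boundary S = S - surface_interior S"

text \<open>
  An orientation is a choice of a generator of the local homology group
  \<open>H\<^sub>2(S, S - {x}; \<int>)\<close> at every interior point, locally induced by a single class of
  \<open>H\<^sub>2(S, S - U; \<int>)\<close>.
\<close>

abbreviation local_homology :: "'a::topological_space set \<Rightarrow> 'a \<Rightarrow> 'a chain set monoid" where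
  "local_homology S x \<equiv> relative_homology_group 2 (top_of_set S) (S - {x})"

definition surface_orientation :: "'a::topological_space set \<Rightarrow> ('a \<Rightarrow> 'a chain set) \<Rightarrow> bool" where
  "surface_orientation S \<mu> \<longleftrightarrow>
     (\<forall>x\<in>surface_interior S. \<mu> x \<in> carrier (local_homology S x) \<and>
        generate (local_homology S x) {\<mu> x} = carrier (local_homology S x)) \<and>
     (\<forall>x\<in>surface_interior S. \<exists>U \<alpha>.
        openin (top_of_set S) U \<and> x \<in> U \<and> U \<subseteq> surface_interior S \<and>
        \<alpha> \<in> carrier (relative_homology_group 2 (top_of_set S) (S - U)) \<and>
        (\<forall>y\<in>U. hom_induced 2 (top_of_set S) (S - U) (top_of_set S) (S - {y}) id \<alpha> = \<mu> y))"

definition orientable_surface :: "'a::topological_space set \<Rightarrow> bool" where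
  "orientable_surface S \<longleftrightarrow> (\<exists>\<mu>. surface_orientation S \<mu>)"

text \<open>
  The genus is the largest number of pairwise disjoint simple closed curves in the interior
  whose union does not disconnect the surface.
\<close>

definition nonseparating_curves :: "'a::topological_space set \<Rightarrow> 'a set set \<Rightarrow> bool" where
  "nonseparating_curves S C \<longleftrightarrow>
     finite C \<and> pairwise disjnt C \<and>
     (\<forall>c\<in>C. c \<subseteq> surface_interior S \<and>
        (\<exists>\<gamma>. simple_path \<gamma> \<and> pathfinish \<gamma> = pathstart \<gamma> \<and> path_image \<gamma> = c)) \<and>
     connected (S - \<Union>C)"

definition has_genus :: "'a::topological_space set \<Rightarrow> nat \<Rightarrow> bool" where
  "has_genus S g \<longleftrightarrow>
     (\<exists>C. nonseparating_curves S C \<and> card C = g) \<and>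
     (\<forall>C. nonseparating_curves S C \<longrightarrow> card C \<le> g)"

definition surface_one_boundary :: "nat \<Rightarrow> 'a::topological_space set \<Rightarrow> bool" where
  "surface_one_boundary g S \<longleftrightarrow>
     surface_with_boundary S \<and> compact S \<and> connected S \<and> S \<noteq> {} \<and>
     orientable_surface S \<and> has_genus S g \<and> card (components (surface_boundary S)) = 1"


section \<open>The mapping class group\<close>

definition boundary_homeos :: "'a::topological_space set \<Rightarrow> ('a \<Rightarrow> 'a) set" where
  "boundary_homeos S =
     {f \<in> Bij S. (\<exists>h. homeomorphism S S f h) \<and> (\<forall>x\<in>surface_boundary S. f x = x)}"

definition orientation_preserving :: "'a::topological_space set \<Rightarrow> ('a \<Rightarrow> 'a) \<Rightarrow> bool" where
  "orientation_preserving S f \<longleftrightarrow>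
     (\<forall>\<mu>. surface_orientation S \<mu> \<longrightarrow>
        (\<forall>x\<in>surface_interior S.
           hom_induced 2 (top_of_set S) (S - {x}) (top_of_set S) (S - {f x}) f (\<mu> x) = \<mu> (f x)))"

definition homeo_group :: "'a::topological_space set \<Rightarrow> ('a \<Rightarrow> 'a) monoid" where
  "homeo_group S = (BijGroup S)\<lparr>carrier := {f \<in> boundary_homeos S. orientation_preserving S f}\<rparr>"

definition isotopic_rel_boundary ::
    "'a::topological_space set \<Rightarrow> ('a \<Rightarrow> 'a) \<Rightarrow> ('a \<Rightarrow> 'a) \<Rightarrow> bool" where
  "isotopic_rel_boundary S f h \<longleftrightarrow>
     homotopic_with_canon (\<lambda>u. restrict u S \<in> boundary_homeos S) S S f h"

text \<open>
  The cosets of the subgroup of homeomorphisms isotopic to the identity are exactly the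
  isotopy classes.
\<close>

definition mapping_class_group :: "'a::topological_space set \<Rightarrow> ('a \<Rightarrow> 'a) set monoid" where
  "mapping_class_group S =
     homeo_group S Mod
       {f \<in> carrier (homeo_group S). isotopic_rel_boundary S (\<lambda>x\<in>S. x) f}"


section \<open>The fundamental group and the action of mapping classes on it\<close>

definition loop_class :: "'a::topological_space set \<Rightarrow> (real \<Rightarrow> 'a) \<Rightarrow> (real \<Rightarrow> 'a) set" where
  "loop_class S \<gamma> = {\<delta>. homotopic_paths S \<gamma> \<delta>}"

definition fundamental_group ::
    "'a::topological_space set \<Rightarrow> 'a \<Rightarrow> (real \<Rightarrow> 'a) set monoid" where
  "fundamental_group S b =
     \<lparr>carrier = loop_class S ` {\<gamma>. path \<gamma> \<and> path_image \<gamma> \<subseteq> S \<and> pathstart \<gamma> = b \<and> pathfinish \<gamma> = b},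
      monoid.mult = \<lambda>A B. \<Union>\<gamma>\<in>A. \<Union>\<delta>\<in>B. loop_class S (\<gamma> +++ \<delta>),
      one = loop_class S (\<lambda>_. b)\<rparr>"

definition mcg_action ::
    "'a::topological_space set \<Rightarrow> ('a \<Rightarrow> 'a) set \<Rightarrow> (real \<Rightarrow> 'a) set \<Rightarrow> (real \<Rightarrow> 'a) set" where
  "mcg_action S \<phi> A = (\<Union>f\<in>\<phi>. \<Union>\<gamma>\<in>A. loop_class S (f \<circ> \<gamma>))"


section \<open>First homology with coefficients in the integers mod \<open>p\<close>\<close>

text \<open>
  The chain group with coefficients mod \<open>p\<close> is \<open>C\<^sub>n / p C\<^sub>n\<close>.  Its subgroups of cycles and
  of boundaries are represented by their preimages in \<open>C\<^sub>n\<close>, both of which contain \<open>p C\<^sub>n\<close>.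
\<close>

definition modp_cycles :: "nat \<Rightarrow> nat \<Rightarrow> 'a topology \<Rightarrow> 'a chain set" where
  "modp_cycles p n T =
     {c. singular_chain n T c \<and>
         (\<exists>e. singular_chain (n - 1) T e \<and> chain_boundary n c = frag_cmul (int p) e)}"

definition modp_boundaries :: "nat \<Rightarrow> nat \<Rightarrow> 'a topology \<Rightarrow> 'a chain set" where
  "modp_boundaries p n T =
     {chain_boundary (Suc n) d + frag_cmul (int p) e |d e.
        singular_chain (Suc n) T d \<and> singular_chain n T e}"

definition modp_homology_group :: "nat \<Rightarrow> nat \<Rightarrow> 'a topology \<Rightarrow> 'a chain set monoid" where
  "modp_homology_group p n T =
     subgroup_generated (chain_group n T) (modp_cycles p n T) Mod modp_boundaries p n T"

text \<open>
  The segment \<open>[0,1]\<close> is identified with the standard 1-simplex through the coordinate \<open>x 1\<close>,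
  so that vertex 0 is the start of the path.
\<close>

definition path_simplex :: "(real \<Rightarrow> 'a) \<Rightarrow> (nat \<Rightarrow> real) \<Rightarrow> 'a" where
  "path_simplex \<gamma> = (\<lambda>x\<in>standard_simplex 1. \<gamma> (x 1))"

definition homology_class ::
    "nat \<Rightarrow> 'a::topological_space set \<Rightarrow> (real \<Rightarrow> 'a) set \<Rightarrow> 'a chain set" where
  "homology_class p S A =
     (\<Union>\<gamma>\<in>A. modp_boundaries p 1 (top_of_set S)
        #>\<^bsub>chain_group 1 (top_of_set S)\<^esub> frag_of (path_simplex \<gamma>))"


section \<open>Mod-\<open>p\<close> central series\<close>

definition commutator_subgroup :: "('g, 'b) monoid_scheme \<Rightarrow> 'g set \<Rightarrow> 'g set \<Rightarrow> 'g set" where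
  "commutator_subgroup G A B =
     generate G {x \<otimes>\<^bsub>G\<^esub> y \<otimes>\<^bsub>G\<^esub> inv\<^bsub>G\<^esub> x \<otimes>\<^bsub>G\<^esub> inv\<^bsub>G\<^esub> y |x y. x \<in> A \<and> y \<in> B}"

definition power_subgroup :: "('g, 'b) monoid_scheme \<Rightarrow> 'g set \<Rightarrow> nat \<Rightarrow> 'g set" where
  "power_subgroup G H m = generate G {x [^]\<^bsub>G\<^esub> m |x. x \<in> H}"

text \<open>All series are indexed from 1; the value at 0 is a dummy.\<close>

fun lower_central_series :: "('g, 'b) monoid_scheme \<Rightarrow> nat \<Rightarrow> 'g set" where
  "lower_central_series G 0 = carrier G"
| "lower_central_series G (Suc 0) = carrier G"
| "lower_central_series G (Suc (Suc n)) =
     commutator_subgroup G (carrier G) (lower_central_series G (Suc n))"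

fun stallings_series :: "nat \<Rightarrow> ('g, 'b) monoid_scheme \<Rightarrow> nat \<Rightarrow> 'g set" where
  "stallings_series p G 0 = carrier G"
| "stallings_series p G (Suc 0) = carrier G"
| "stallings_series p G (Suc (Suc n)) =
     commutator_subgroup G (carrier G) (stallings_series p G (Suc n))
       <#>\<^bsub>G\<^esub> power_subgroup G (stallings_series p G (Suc n)) p"

text \<open>The product of an infinite family of subgroups is the subgroup they generate.\<close>

definition zassenhaus_series :: "nat \<Rightarrow> ('g, 'b) monoid_scheme \<Rightarrow> nat \<Rightarrow> 'g set" where
  "zassenhaus_series p G k =
     generate G (\<Union>(i, j)\<in>{(i, j). 1 \<le> i \<and> k \<le> i * p ^ j}.
       power_subgroup G (lower_central_series G i) (p ^ j))"

definition graded_quotient :: "('g, 'b) monoid_scheme \<Rightarrow> (nat \<Rightarrow> 'g set) \<Rightarrow> nat \<Rightarrow> 'g set monoid" where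
  "graded_quotient G D k = G\<lparr>carrier := D k\<rparr> Mod D (Suc k)"


section \<open>The Johnson filtration and the Johnson maps\<close>

text \<open>
  Between vector spaces over the prime field with \<open>p\<close> elements, linear maps are the same as
  homomorphisms of additive groups.
\<close>

definition Hom_group ::
    "('g, 'b) monoid_scheme \<Rightarrow> ('h, 'c) monoid_scheme \<Rightarrow> ('g \<Rightarrow> 'h) monoid" where
  "Hom_group G H =
     \<lparr>carrier = hom G H \<inter> extensional (carrier G),
      monoid.mult = \<lambda>u v. \<lambda>x\<in>carrier G. u x \<otimes>\<^bsub>H\<^esub> v x,
      one = \<lambda>x\<in>carrier G. \<one>\<^bsub>H\<^esub>\<rparr>"

text \<open>The element \<open>\<phi>(x) x\<^sup>-\<^sup>1\<close> of the fundamental group.\<close>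

definition displacement ::
    "'a::topological_space set \<Rightarrow> 'a \<Rightarrow> ('a \<Rightarrow> 'a) set \<Rightarrow> (real \<Rightarrow> 'a) set \<Rightarrow> (real \<Rightarrow> 'a) set" where
  "displacement S b \<phi> x =
     mcg_action S \<phi> x \<otimes>\<^bsub>fundamental_group S b\<^esub> inv\<^bsub>fundamental_group S b\<^esub> x"

definition johnson_subgroup ::
    "'a::topological_space set \<Rightarrow> 'a \<Rightarrow> (nat \<Rightarrow> (real \<Rightarrow> 'a) set set) \<Rightarrow> nat \<Rightarrow> ('a \<Rightarrow> 'a) set set" where
  "johnson_subgroup S b D k =
     {\<phi> \<in> carrier (mapping_class_group S).
        \<forall>x\<in>carrier (fundamental_group S b). displacement S b \<phi> x \<in> D (k + 1)}"

definition johnson_map ::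
    "nat \<Rightarrow> 'a::topological_space set \<Rightarrow> 'a \<Rightarrow> (nat \<Rightarrow> (real \<Rightarrow> 'a) set set) \<Rightarrow> nat \<Rightarrow>
     ('a \<Rightarrow> 'a) set \<Rightarrow> 'a chain set \<Rightarrow> (real \<Rightarrow> 'a) set set" where
  "johnson_map p S b D k \<phi> =
     (\<lambda>c\<in>carrier (modp_homology_group p 1 (top_of_set S)).
        THE y. \<exists>x\<in>carrier (fundamental_group S b). homology_class p S x = c \<and>
          y = D (k + 2) #>\<^bsub>fundamental_group S b\<^esub> displacement S b \<phi> x)"

end

theory Submission
  imports Defs "HOL-Algebra.SndIsomorphismGrp"
begin

text \<open>
  Write \<open>\<Gamma>\<close> for the fundamental group, \<open>D\<close> for one of the two series, and
  \<open>\<delta>\<^sub>f(x) = f(x) x\<^sup>-\<^sup>1\<close> for an endomorphism \<open>f\<close> of \<open>\<Gamma>\<close>.  Two identities drive the proof: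
  \<open>\<delta>\<^sub>f(x y) = \<delta>\<^sub>f(x) \<cdot> x \<delta>\<^sub>f(y) x\<^sup>-\<^sup>1\<close> and \<open>\<delta>\<^sub>f\<^sub>g(x) = f(\<delta>\<^sub>g(x)) \<cdot> \<delta>\<^sub>f(x)\<close>.

  If \<open>\<delta>\<^sub>f\<close> takes values in \<open>D (k+1)\<close>, which is central modulo \<open>D (k+2)\<close>, the first identity makes
  \<open>\<delta>\<^sub>f\<close> a homomorphism modulo \<open>D (k+2)\<close>.  Its target is abelian of exponent \<open>p\<close>, so it factors
  through \<open>H\<^sub>1\<close> with coefficients mod \<open>p\<close>; this is the Hurewicz theorem in degree one, in the form of
  \<open>hom_eq_of_homology_class_eq\<close> and \<open>homology_class_surj\<close>.

  By the second identity, additivity in \<open>f\<close> means that \<open>f\<close> acts trivially on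
  \<open>D (k+1) / D (k+2)\<close>.  As \<open>k \<ge> 1\<close>, \<open>f\<close> acts trivially on \<open>\<Gamma> / D 2\<close>, and for both series this
  already forces a trivial action on every quotient \<open>D n / D (n+1)\<close>.  The locale
  \<open>johnson_series\<close> collects what this argument needs of a series.

  For the Stallings series these facts follow by induction on \<open>n\<close> from the three subgroups lemma.
  For the Zassenhaus series, which is given as a product of power subgroups, even
  \<open>[\<Gamma>, D n] \<subseteq> D (n+1)\<close> needs commutator collection in the style of Hall and Petrescu.  It is
  obtained from polynomial sequences in the sense of Lazard and Leibman: sequences whose iterated
  differences descend along a filtration form a group, and every such sequence is a product of
  factors \<open>n \<mapsto> c\<^sub>r\<close> raised to the power \<open>n choose r\<close>, with \<open>c\<^sub>r\<close> deep in the
  filtration (lemma \<open>taylor\<close>).  Evaluated at \<open>n = p ^ j\<close>, the power of \<open>p\<close> in the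
  binomial coefficients makes up for the depth that \<open>c\<^sub>r\<close> lacks.
\<close>

section \<open>Commutators\<close>

definition gcomm :: "('g, 'b) monoid_scheme \<Rightarrow> 'g \<Rightarrow> 'g \<Rightarrow> 'g" where
  "gcomm G x y = x \<otimes>\<^bsub>G\<^esub> y \<otimes>\<^bsub>G\<^esub> inv\<^bsub>G\<^esub> x \<otimes>\<^bsub>G\<^esub> inv\<^bsub>G\<^esub> y"

context group
begin

lemma inv_mult_cancel: "x \<in> carrier G \<Longrightarrow> y \<in> carrier G \<Longrightarrow> inv x \<otimes> (x \<otimes> y) = y"
  by (simp flip: m_assoc)

lemma mult_inv_cancel: "x \<in> carrier G \<Longrightarrow> y \<in> carrier G \<Longrightarrow> x \<otimes> (inv x \<otimes> y) = y"
  by (simp flip: m_assoc)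

lemmas free_reduce = m_assoc inv_mult_group inv_mult_cancel mult_inv_cancel

lemma gcomm_closed [simp]: "x \<in> carrier G \<Longrightarrow> y \<in> carrier G \<Longrightarrow> gcomm G x y \<in> carrier G"
  by (simp add: gcomm_def)

lemma conj_eq_gcomm_mult:
  "x \<in> carrier G \<Longrightarrow> y \<in> carrier G \<Longrightarrow> x \<otimes> y \<otimes> inv x = gcomm G x y \<otimes> y"
  by (simp add: gcomm_def free_reduce)

lemma inv_gcomm: "x \<in> carrier G \<Longrightarrow> y \<in> carrier G \<Longrightarrow> inv (gcomm G x y) = gcomm G y x"
  by (simp add: gcomm_def free_reduce)

lemma gcomm_mult_left:
  "\<lbrakk>a \<in> carrier G; b \<in> carrier G; y \<in> carrier G\<rbrakk> \<Longrightarrow>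
     gcomm G (a \<otimes> b) y = (a \<otimes> gcomm G b y \<otimes> inv a) \<otimes> gcomm G a y"
  by (simp add: gcomm_def free_reduce)

lemma gcomm_inv_left:
  "\<lbrakk>a \<in> carrier G; y \<in> carrier G\<rbrakk> \<Longrightarrow> gcomm G (inv a) y = inv a \<otimes> inv (gcomm G a y) \<otimes> a"
  by (simp add: gcomm_def free_reduce)

lemma gcomm_conj:
  "\<lbrakk>g \<in> carrier G; x \<in> carrier G; y \<in> carrier G\<rbrakk> \<Longrightarrow>
     g \<otimes> gcomm G x y \<otimes> inv g = gcomm G (g \<otimes> x \<otimes> inv g) (g \<otimes> y \<otimes> inv g)"
  by (simp add: gcomm_def free_reduce)

text \<open>
  How a commutator changes when both entries are multiplied on the left.  It gives the difference of a
  commutator of sequences, and the displacement of a commutator under an endomorphism.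
\<close>

lemma gcomm_perturb:
  assumes "a \<in> carrier G" "b \<in> carrier G" "x \<in> carrier G" "y \<in> carrier G"
  shows "gcomm G (a \<otimes> x) (b \<otimes> y) \<otimes> inv (gcomm G x y) =
    (a \<otimes> gcomm G x b \<otimes> inv a) \<otimes> gcomm G (a \<otimes> b) (gcomm G x y) \<otimes>
    (gcomm G x y \<otimes> gcomm G a (b \<otimes> y) \<otimes> inv (gcomm G x y))"
  using assms by (simp add: gcomm_def free_reduce)

text \<open>
  A double commutator is a quotient of two words that arise from each other by rotating
  \<open>x, y, z\<close>; therefore the three factors of the Hall-Witt identity telescope.
\<close>

lemma gcomm_gcomm_conj:
  assumes "x \<in> carrier G" "y \<in> carrier G" "z \<in> carrier G"
  shows "gcomm G (gcomm G x y) (y \<otimes> z \<otimes> inv y) =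
    (x \<otimes> y \<otimes> inv x \<otimes> z \<otimes> x) \<otimes> inv (y \<otimes> z \<otimes> inv y \<otimes> x \<otimes> y)"
  using assms by (simp add: gcomm_def free_reduce)

lemma hall_witt:
  assumes "x \<in> carrier G" "y \<in> carrier G" "z \<in> carrier G"
  shows "gcomm G (gcomm G x y) (y \<otimes> z \<otimes> inv y) \<otimes> gcomm G (gcomm G y z) (z \<otimes> x \<otimes> inv z) \<otimes>
     gcomm G (gcomm G z x) (x \<otimes> y \<otimes> inv x) = \<one>"
  unfolding gcomm_gcomm_conj[OF assms(1,2,3)] gcomm_gcomm_conj[OF assms(2,3,1)]
    gcomm_gcomm_conj[OF assms(3,1,2)]
  using assms by (simp add: free_reduce)

text \<open>
  Commutators are multiplicative in each entry up to conjugation, so modulo a normal subgroup they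
  can be tested on generators.
\<close>

lemma gcomm_generate:
  assumes A: "A \<subseteq> carrier G" and B: "B \<subseteq> carrier G" and N: "C \<lhd> G"
    and AB: "\<And>x y. x \<in> A \<Longrightarrow> y \<in> B \<Longrightarrow> gcomm G x y \<in> C"
    and x: "x \<in> generate G A" and y: "y \<in> generate G B"
  shows "gcomm G x y \<in> C"
proof -
  interpret N: normal C G by fact
  have left: "gcomm G u v \<in> C"
    if "u \<in> generate G U" "U \<subseteq> carrier G" "v \<in> carrier G" "\<And>u. u \<in> U \<Longrightarrow> gcomm G u v \<in> C" for u v U
    using that
  proof (induction u rule: generate.induct)
    case one
    then show ?case by (simp add: gcomm_def)
  next
    case (inv h)
    then have h: "h \<in> carrier G" "gcomm G h v \<in> C" by auto
    then have "inv h \<otimes> inv (gcomm G h v) \<otimes> inv (inv h) \<in> C"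
      by (intro N.inv_op_closed2) auto
    with h inv show ?case by (simp add: gcomm_inv_left)
  next
    case (eng h1 h2)
    then have "h1 \<in> carrier G" "h2 \<in> carrier G" using generate_in_carrier by blast+
    with eng show ?case by (simp add: gcomm_mult_left N.inv_op_closed2)
  qed
  have yc: "y \<in> carrier G" and xc: "x \<in> carrier G"
    using x y A B generate_in_carrier by blast+
  have "gcomm G u y \<in> C" if "u \<in> A" for u
  proof -
    have "gcomm G v u \<in> C" if "v \<in> B" for v
    proof -
      have "u \<in> carrier G" "v \<in> carrier G" using \<open>u \<in> A\<close> that A B by auto
      then show ?thesis using N.m_inv_closed[OF AB[OF \<open>u \<in> A\<close> that]] by (simp add: inv_gcomm)
    qed
    then have "gcomm G y u \<in> C"
      using that A by (intro left[OF y B]) auto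
    then have "inv (gcomm G y u) \<in> C" by simp
    with that A yc show ?thesis by (auto simp: inv_gcomm)
  qed
  then show ?thesis by (intro left[OF x A yc])
qed

end

section \<open>Polynomial sequences\<close>

text \<open>
  The term at index 0 is the whole group.  This makes every term normal, and it is what allows
  ordinary sequences in the group to have weight 0 below.
\<close>

locale n_series = group G for G (structure) +
  fixes H :: "nat \<Rightarrow> 'a set"
  assumes zero: "H 0 = carrier G"
    and subgroup_term: "subgroup (H n) G"
    and Suc_subset: "H (Suc n) \<subseteq> H n"
    and gcomm_mem: "x \<in> H m \<Longrightarrow> y \<in> H n \<Longrightarrow> gcomm G x y \<in> H (m + n)"
begin

lemma antimono_terms: "m \<le> n \<Longrightarrow> H n \<subseteq> H m"
  by (rule lift_Suc_antimono_le[of H]) (rule Suc_subset)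

lemma mem_mono: "x \<in> H n \<Longrightarrow> m \<le> n \<Longrightarrow> x \<in> H m"
  using antimono_terms by blast

lemma mem_carrier: "x \<in> H n \<Longrightarrow> x \<in> carrier G"
  using subgroup.mem_carrier[OF subgroup_term] .

lemma mult_mem: "x \<in> H n \<Longrightarrow> y \<in> H n \<Longrightarrow> x \<otimes> y \<in> H n"
  using subgroup.m_closed[OF subgroup_term] .

lemma inv_mem: "x \<in> H n \<Longrightarrow> inv x \<in> H n"
  using subgroup.m_inv_closed[OF subgroup_term] .

lemma one_mem: "\<one> \<in> H n"
  using subgroup.one_closed[OF subgroup_term] .

lemma pow_mem: "x \<in> H n \<Longrightarrow> x [^] (m::nat) \<in> H n"
  by (induction m) (auto intro: one_mem mult_mem)

lemma conj_mem: "g \<in> carrier G \<Longrightarrow> x \<in> H n \<Longrightarrow> g \<otimes> x \<otimes> inv g \<in> H n"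
  using gcomm_mem[of g 0 x n] mult_mem[of "gcomm G g x" n x] mem_carrier
  by (simp add: zero conj_eq_gcomm_mult)

lemma normal_term: "H n \<lhd> G"
  by (simp add: conj_mem normal_invI subgroup_term)

definition difference :: "(nat \<Rightarrow> 'a) \<Rightarrow> nat \<Rightarrow> 'a" where
  "difference f = (\<lambda>n. f (Suc n) \<otimes> inv (f n))"

text \<open>
  The parameter \<open>l\<close> is the weight gained by each difference, \<open>q\<close> the weight of the values, and
  \<open>T\<close> the number of differences that are inspected.  Bounding the number of differences turns the
  group laws into an induction that needs no nilpotency.
\<close>

primrec poly_upto :: "nat \<Rightarrow> nat \<Rightarrow> nat \<Rightarrow> (nat \<Rightarrow> 'a) \<Rightarrow> bool" where
  "poly_upto l 0 q f \<longleftrightarrow> (\<forall>n. f n \<in> H q)"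
| "poly_upto l (Suc T) q f \<longleftrightarrow> (\<forall>n. f n \<in> H q) \<and> poly_upto l T (q + l) (difference f)"

lemma poly_upto_value: "poly_upto l T q f \<Longrightarrow> f n \<in> H q"
  by (cases T) auto

lemma poly_upto_carrier: "poly_upto l T q f \<Longrightarrow> f n \<in> carrier G"
  using poly_upto_value mem_carrier by blast

lemma poly_upto_Suc: "poly_upto l (Suc T) q f \<Longrightarrow> poly_upto l T q f"
  by (induction T arbitrary: q f) auto

lemma poly_upto_weight: "poly_upto l T q f \<Longrightarrow> q' \<le> q \<Longrightarrow> poly_upto l T q' f"
proof (induction T arbitrary: q q' f)
  case (Suc T)
  then show ?case using Suc.IH[of "q + l" "difference f" "q' + l"] by (auto intro: mem_mono)
qed (auto intro: mem_mono)

lemma poly_upto_shift: "poly_upto l T q f \<Longrightarrow> poly_upto l T q (\<lambda>n. f (Suc n))"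
proof (induction T arbitrary: q f)
  case (Suc T)
  from Suc.IH[of "q + l" "difference f"] Suc.prems show ?case by (simp add: difference_def)
qed auto

lemma poly_upto_one: "poly_upto l T q (\<lambda>n. \<one>)"
  by (induction T arbitrary: q) (auto simp: difference_def one_mem)

lemma poly_upto_const: "x \<in> H q \<Longrightarrow> poly_upto l T q (\<lambda>n. x)"
  by (cases T) (auto simp: difference_def mem_carrier poly_upto_one)

lemma poly_upto_power_choose:
  "x \<in> H (q + r * l) \<Longrightarrow> poly_upto l T q (\<lambda>n. x [^] (n choose r))"
proof (induction T arbitrary: q r)
  case 0
  then show ?case using mem_mono pow_mem by fastforce
next
  case (Suc T)
  show ?case
  proof (cases r)
    case 0
    with Suc.prems show ?thesis using poly_upto_const[of x q l "Suc T"] by (simp add: mem_carrier)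
  next
    case (Suc s)
    have x: "x \<in> carrier G" using Suc.prems mem_carrier by blast
    have "difference (\<lambda>n. x [^] (n choose r)) = (\<lambda>n. x [^] (n choose s))"
      using x by (auto simp: difference_def Suc nat_pow_mult[symmetric] m_assoc)
    moreover have "poly_upto l T (q + l) (\<lambda>n. x [^] (n choose s))"
      using Suc.prems Suc by (intro Suc.IH) (simp add: algebra_simps)
    moreover have "x [^] (n choose r) \<in> H q" for n
      using Suc.prems mem_mono pow_mem by (metis le_add1)
    ultimately show ?thesis by simp
  qed
qed

lemma poly_upto_conj:
  assumes "\<And>q q' f g. poly_upto l T q f \<Longrightarrow> poly_upto l T q' g \<Longrightarrow>
              poly_upto l T (q + q') (\<lambda>n. gcomm G (f n) (g n))"
    and "\<And>q f g. poly_upto l T q f \<Longrightarrow> poly_upto l T q g \<Longrightarrow> poly_upto l T q (\<lambda>n. f n \<otimes> g n)"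
    and f: "poly_upto l T q' f" and g: "poly_upto l T q g"
  shows "poly_upto l T q (\<lambda>n. f n \<otimes> g n \<otimes> inv (f n))"
proof -
  have "poly_upto l T q (\<lambda>n. gcomm G (f n) (g n))"
    by (rule poly_upto_weight[OF assms(1)[OF f g]]) simp
  from assms(2)[OF this g] show ?thesis
    using f g by (simp add: conj_eq_gcomm_mult poly_upto_carrier)
qed

text \<open>
  The Lazard-Leibman theorem.  The difference of a product, an inverse or a commutator is a product
  of commutators and conjugates that involve at least one difference of a factor, so all three
  claims at depth \<open>T + 1\<close> reduce to the three claims at depth \<open>T\<close>.
\<close>

lemma poly_upto_group:
  shows poly_upto_mult: "poly_upto l T q f \<Longrightarrow> poly_upto l T q g \<Longrightarrow> poly_upto l T q (\<lambda>n. f n \<otimes> g n)"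
    and poly_upto_inv: "poly_upto l T q f \<Longrightarrow> poly_upto l T q (\<lambda>n. inv (f n))"
    and poly_upto_gcomm: "poly_upto l T q f \<Longrightarrow> poly_upto l T q' g \<Longrightarrow>
           poly_upto l T (q + q') (\<lambda>n. gcomm G (f n) (g n))"
proof (induction T arbitrary: q q' f g)
  case 0
  { case 1 then show ?case by (auto intro: mult_mem) }
  { case 2 then show ?case by (auto intro: inv_mem) }
  { case 3 then show ?case by (auto intro: gcomm_mem) }
next
  case (Suc T)
  have cl: "poly_upto l T q (\<lambda>n. f n \<otimes> g n \<otimes> inv (f n))"
    if "poly_upto l T q' f" "poly_upto l T q g" for q q' f g
    by (rule poly_upto_conj[OF _ _ that]) (rule Suc.IH(3) Suc.IH(1); assumption)+
  { case 1
    have c: "f n \<in> carrier G" "g n \<in> carrier G" for n using 1 poly_upto_carrier by blast+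
    have "difference (\<lambda>n. f n \<otimes> g n) =
        (\<lambda>n. (f (Suc n) \<otimes> difference g n \<otimes> inv (f (Suc n))) \<otimes> difference f n)"
      using c by (auto simp: difference_def free_reduce)
    moreover have "poly_upto l T (q + l) (\<lambda>n. f (Suc n) \<otimes> difference g n \<otimes> inv (f (Suc n)))"
      by (rule cl[OF poly_upto_shift[OF poly_upto_Suc[OF 1(1)]]]) (use 1 in auto)
    ultimately show ?case using 1 by (auto intro: mult_mem Suc.IH(1)) }
  { case 2
    have c: "f n \<in> carrier G" for n using 2 poly_upto_carrier by blast
    have "difference (\<lambda>n. inv (f n)) = (\<lambda>n. inv (f n) \<otimes> inv (difference f n) \<otimes> inv (inv (f n)))"
      using c by (auto simp: difference_def free_reduce)
    moreover have "poly_upto l T (q + l) (\<lambda>n. inv (f n) \<otimes> inv (difference f n) \<otimes> inv (inv (f n)))"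
      by (rule cl[OF Suc.IH(2)[OF poly_upto_Suc[OF 2]] Suc.IH(2)]) (use 2 in auto)
    ultimately show ?case using 2 by (auto intro: inv_mem) }
  { case 3
    have c: "f n \<in> carrier G" "g n \<in> carrier G" for n using 3 poly_upto_carrier by blast+
    define a where "a = difference f"
    define b where "b = difference g"
    define k where "k = (\<lambda>n. gcomm G (f n) (g n))"
    have ac: "a n \<in> carrier G" "b n \<in> carrier G" for n using c by (auto simp: a_def b_def difference_def)
    have S: "f (Suc n) = a n \<otimes> f n" "g (Suc n) = b n \<otimes> g n" for n
      using c by (auto simp: a_def b_def difference_def free_reduce)
    have pa: "poly_upto l T (q + l) a" and pb: "poly_upto l T (q' + l) b"
      using 3 by (auto simp: a_def b_def)
    have pf: "poly_upto l T q f" and pg: "poly_upto l T q' g"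
      using 3 poly_upto_Suc by blast+
    have pk: "poly_upto l T (q + q') k" unfolding k_def by (rule Suc.IH(3)[OF pf pg])
    have "difference k = (\<lambda>n. (a n \<otimes> gcomm G (f n) (b n) \<otimes> inv (a n)) \<otimes>
        gcomm G (a n \<otimes> b n) (k n) \<otimes> (k n \<otimes> gcomm G (a n) (g (Suc n)) \<otimes> inv (k n)))"
      using gcomm_perturb[OF ac(1) ac(2) c(1) c(2)]
      by (auto simp: difference_def k_def S)
    moreover have "poly_upto l T (q + q' + l) (\<lambda>n. a n \<otimes> gcomm G (f n) (b n) \<otimes> inv (a n))"
      using cl[OF pa Suc.IH(3)[OF pf pb]] by (simp add: add_ac)
    moreover have "poly_upto l T (q + q' + l) (\<lambda>n. gcomm G (a n \<otimes> b n) (k n))"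
    proof -
      have "poly_upto l T l (\<lambda>n. a n \<otimes> b n)"
        by (rule Suc.IH(1)) (rule poly_upto_weight[OF pa] poly_upto_weight[OF pb], simp)+
      from Suc.IH(3)[OF this pk] show ?thesis by (simp add: add_ac)
    qed
    moreover have "poly_upto l T (q + q' + l) (\<lambda>n. k n \<otimes> gcomm G (a n) (g (Suc n)) \<otimes> inv (k n))"
      using cl[OF pk Suc.IH(3)[OF pa poly_upto_shift[OF pg]]] by (simp add: add_ac)
    ultimately have "poly_upto l T (q + q' + l) (difference k)"
      by (simp add: Suc.IH(1))
    with 3 show ?case by (auto simp: k_def intro: gcomm_mem) }
qed

definition poly_seq :: "nat \<Rightarrow> nat \<Rightarrow> (nat \<Rightarrow> 'a) set" where
  "poly_seq l q = {f. \<forall>T. poly_upto l T q f}"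

lemma poly_seq_value: "f \<in> poly_seq l q \<Longrightarrow> f n \<in> H q"
  unfolding poly_seq_def using poly_upto_value by blast

lemma poly_seq_carrier: "f \<in> poly_seq l q \<Longrightarrow> f n \<in> carrier G"
  using poly_seq_value mem_carrier by blast

lemma poly_seq_difference:
  "f \<in> poly_seq l q \<longleftrightarrow> (\<forall>n. f n \<in> H q) \<and> difference f \<in> poly_seq l (q + l)"
proof
  assume "f \<in> poly_seq l q"
  then have "poly_upto l (Suc T) q f" for T unfolding poly_seq_def by blast
  then show "(\<forall>n. f n \<in> H q) \<and> difference f \<in> poly_seq l (q + l)" by (simp add: poly_seq_def)
next
  assume "(\<forall>n. f n \<in> H q) \<and> difference f \<in> poly_seq l (q + l)"
  then have "poly_upto l T q f" for T by (cases T) (auto simp: poly_seq_def)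
  then show "f \<in> poly_seq l q" by (simp add: poly_seq_def)
qed

lemma poly_seq_mult: "f \<in> poly_seq l q \<Longrightarrow> g \<in> poly_seq l q \<Longrightarrow> (\<lambda>n. f n \<otimes> g n) \<in> poly_seq l q"
  unfolding poly_seq_def using poly_upto_mult by blast

lemma poly_seq_inv: "f \<in> poly_seq l q \<Longrightarrow> (\<lambda>n. inv (f n)) \<in> poly_seq l q"
  unfolding poly_seq_def using poly_upto_inv by blast

lemma poly_seq_gcomm:
  "f \<in> poly_seq l q \<Longrightarrow> g \<in> poly_seq l q' \<Longrightarrow> (\<lambda>n. gcomm G (f n) (g n)) \<in> poly_seq l (q + q')"
  unfolding poly_seq_def using poly_upto_gcomm by blast

lemma poly_seq_weight: "f \<in> poly_seq l q \<Longrightarrow> q' \<le> q \<Longrightarrow> f \<in> poly_seq l q'"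
  unfolding poly_seq_def using poly_upto_weight by blast

lemma poly_seq_conj:
  "f \<in> poly_seq l q' \<Longrightarrow> g \<in> poly_seq l q \<Longrightarrow> (\<lambda>n. f n \<otimes> g n \<otimes> inv (f n)) \<in> poly_seq l q"
  by (simp add: poly_seq_mult poly_seq_gcomm conj_eq_gcomm_mult poly_seq_carrier
      poly_seq_weight[OF poly_seq_gcomm])

lemma poly_seq_const: "x \<in> H q \<Longrightarrow> (\<lambda>n. x) \<in> poly_seq l q"
  by (simp add: poly_seq_def poly_upto_const)

lemma poly_seq_power_choose: "x \<in> H (q + r * l) \<Longrightarrow> (\<lambda>n. x [^] (n choose r)) \<in> poly_seq l q"
  by (simp add: poly_seq_def poly_upto_power_choose)

lemma poly_seq_power: "x \<in> H (q + l) \<Longrightarrow> (\<lambda>n. x [^] (n::nat)) \<in> poly_seq l q"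
  using poly_seq_power_choose[of x q 1 l] by simp

definition poly_group :: "nat \<Rightarrow> (nat \<Rightarrow> 'a) monoid" where
  "poly_group l = \<lparr>carrier = poly_seq l 0, monoid.mult = \<lambda>f g n. f n \<otimes> g n, one = \<lambda>n. \<one>\<rparr>"

lemma poly_group_simps [simp]:
  "carrier (poly_group l) = poly_seq l 0"
  "f \<otimes>\<^bsub>poly_group l\<^esub> g = (\<lambda>n. f n \<otimes> g n)"
  "\<one>\<^bsub>poly_group l\<^esub> = (\<lambda>n. \<one>)"
  by (simp_all add: poly_group_def)

lemma group_poly_group: "group (poly_group l)"
proof (rule groupI)
  show "\<one>\<^bsub>poly_group l\<^esub> \<in> carrier (poly_group l)"
    by (simp add: poly_seq_def poly_upto_one)
  fix f assume f: "f \<in> carrier (poly_group l)"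
  have "(\<lambda>n. inv (f n)) \<in> carrier (poly_group l)"
    using f by (simp add: poly_seq_inv)
  moreover have "(\<lambda>n. inv (f n)) \<otimes>\<^bsub>poly_group l\<^esub> f = \<one>\<^bsub>poly_group l\<^esub>"
    using f poly_seq_carrier[of f l 0] by auto
  ultimately show "\<exists>g\<in>carrier (poly_group l). g \<otimes>\<^bsub>poly_group l\<^esub> f = \<one>\<^bsub>poly_group l\<^esub>" by blast
qed (auto simp: poly_seq_mult m_assoc poly_seq_carrier)

lemma inv_poly_group: "f \<in> poly_seq l 0 \<Longrightarrow> inv\<^bsub>poly_group l\<^esub> f = (\<lambda>n. inv (f n))"
  by (intro group.inv_equality[OF group_poly_group])
    (auto simp: poly_seq_inv poly_seq_carrier fun_eq_iff)

lemma gcomm_poly_group: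
  "f \<in> poly_seq l 0 \<Longrightarrow> g \<in> poly_seq l 0 \<Longrightarrow> gcomm (poly_group l) f g = (\<lambda>n. gcomm G (f n) (g n))"
  by (simp add: gcomm_def inv_poly_group)

lemma pow_poly_group: "f [^]\<^bsub>poly_group l\<^esub> (m::nat) = (\<lambda>n. f n [^] m)"
  by (induction m) (auto simp: nat_pow_def)

text \<open>
  Polynomial sequences, graded by weight, satisfy the axioms that the given filtration satisfies.
  Hence the theory applies to sequences of sequences, which replaces polynomial sequences in two
  variables.
\<close>

lemma n_series_poly_group: "n_series (poly_group l) (poly_seq l)"
proof -
  interpret P: group "poly_group l" by (rule group_poly_group)
  show ?thesis
  proof (rule n_series.intro[OF group_poly_group n_series_axioms.intro], goal_cases)
    case (2 n)
    show "subgroup (poly_seq l n) (poly_group l)"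
    proof
      show "poly_seq l n \<subseteq> carrier (poly_group l)" using poly_seq_weight by auto
      show "\<one>\<^bsub>poly_group l\<^esub> \<in> poly_seq l n" by (simp add: poly_seq_def poly_upto_one)
      fix f assume f: "f \<in> poly_seq l n"
      then have "f \<in> poly_seq l 0" using poly_seq_weight by blast
      with f show "inv\<^bsub>poly_group l\<^esub> f \<in> poly_seq l n" by (simp add: inv_poly_group poly_seq_inv)
    qed (simp add: poly_seq_mult)
  next
    case (3 n)
    show "poly_seq l (Suc n) \<subseteq> poly_seq l n" using poly_seq_weight by auto
  next
    case (4 f m g n)
    note fg = this
    then have "f \<in> poly_seq l 0" "g \<in> poly_seq l 0" using poly_seq_weight by blast+
    with fg show "gcomm (poly_group l) f g \<in> poly_seq l (m + n)"
      by (simp add: gcomm_poly_group poly_seq_gcomm)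
  qed simp
qed

text \<open>
  At the first index \<open>r\<close> where the value is nontrivial, it equals the \<open>r\<close>-th iterated
  difference at 0.
\<close>

lemma poly_seq_first_value:
  "f \<in> poly_seq l q \<Longrightarrow> (\<And>i. i < r \<Longrightarrow> f i = \<one>) \<Longrightarrow> f r \<in> H (q + r * l)"
proof (induction r arbitrary: f q)
  case 0
  then show ?case using poly_seq_value by auto
next
  case (Suc r)
  have fc: "f n \<in> carrier G" for n using Suc.prems poly_seq_carrier by blast
  have "difference f r \<in> H ((q + l) + r * l)"
    by (rule Suc.IH) (use Suc.prems in \<open>auto simp: poly_seq_difference[of f] difference_def\<close>)
  moreover have "difference f r = f (Suc r)" using Suc.prems(2) fc by (simp add: difference_def)
  ultimately show ?case by (simp add: algebra_simps)
qed

text \<open>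
  Taylor expansion, as a membership criterion.  The coefficient of order \<open>r\<close> is the first
  nontrivial value; multiplying by the inverse of \<open>n \<mapsto> c\<close> to the power \<open>n choose r\<close> moves the
  first nontrivial index past \<open>r\<close>.  Allowing the coefficient to be a product of generators
  \<open>c\<close> matters in the application to two variables, where a coefficient is itself a sequence and
  only the factors of its own expansion have controlled powers.  The subgroup \<open>L\<close> carries side
  conditions from the sequence to its coefficients.
\<close>

lemma taylor:
  assumes K: "subgroup K (poly_group l)" and L: "subgroup L G"
    and rest: "\<And>\<rho>. \<lbrakk>\<rho> \<in> poly_seq l q; \<And>n. \<rho> n \<in> L; \<And>i. i \<le> N \<Longrightarrow> \<rho> i = \<one>\<rbrakk> \<Longrightarrow> \<rho> \<in> K"
    and gens: "\<And>r. s \<le> r \<Longrightarrow> r \<le> N \<Longrightarrow> H (q + r * l) \<inter> L \<subseteq>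
       generate G {c \<in> H (q + r * l) \<inter> L. (\<lambda>n. c [^] (n choose r)) \<in> K}"
    and f: "f \<in> poly_seq l q" "\<And>n. f n \<in> L" "\<And>i. i < s \<Longrightarrow> f i = \<one>"
  shows "f \<in> K"
proof -
  interpret K: subgroup K "poly_group l" by fact
  interpret L: subgroup L G by fact
  have Kp: "f \<in> K \<Longrightarrow> f \<in> poly_seq l 0" for f using K.mem_carrier by simp
  have claim: "f \<in> K" if "f \<in> poly_seq l q" "\<And>n. f n \<in> L" "\<And>i. i < r \<Longrightarrow> f i = \<one>" "s \<le> r" for r f
    using that
  proof (induction "Suc N - r" arbitrary: r f)
    case 0
    then show ?case by (intro rest) auto
  next
    case (Suc d)
    then have r: "r \<le> N" by simp
    define B where "B = {c \<in> H (q + r * l) \<inter> L. (\<lambda>n. c [^] (n choose r)) \<in> K}"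
    have Bc: "B \<subseteq> carrier G" using mem_carrier by (auto simp: B_def)
    \<comment> \<open>a polynomial sequence in \<open>K\<close> that starts with the value \<open>c\<close> at the index \<open>r\<close>\<close>
    have ex: "\<exists>e. e \<in> K \<and> e \<in> poly_seq l q \<and> (\<forall>n. e n \<in> L) \<and> (\<forall>i<r. e i = \<one>) \<and> e r = c"
      if "c \<in> generate G B" for c
      using that
    proof (induction rule: generate.induct)
      case one
      then show ?case
        using K.one_closed L.one_closed by (intro exI[of _ "\<lambda>n. \<one>"]) (auto simp: poly_seq_def poly_upto_one)
    next
      case (incl h)
      then have h: "h \<in> H (q + r * l)" "h \<in> L" "(\<lambda>n. h [^] (n choose r)) \<in> K" by (auto simp: B_def)
      moreover have "h [^] (n::nat) \<in> L" for n using h(2) by (induction n) auto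
      ultimately show ?case
        by (intro exI[of _ "\<lambda>n. h [^] (n choose r)"]) (auto simp: poly_seq_power_choose mem_carrier binomial_eq_0)
    next
      case (inv h)
      then have h: "h \<in> H (q + r * l)" "h \<in> L" "(\<lambda>n. h [^] (n choose r)) \<in> K" by (auto simp: B_def)
      have p: "h [^] (n::nat) \<in> L" for n using h(2) by (induction n) auto
      have "(\<lambda>n. inv (h [^] (n choose r))) \<in> K"
        using K.m_inv_closed[OF h(3)] Kp[OF h(3)] by (simp add: inv_poly_group)
      with h p show ?case
        by (intro exI[of _ "\<lambda>n. inv (h [^] (n choose r))"])
          (auto simp: poly_seq_power_choose poly_seq_inv mem_carrier binomial_eq_0)
    next
      case (eng h1 h2)
      then obtain e1 e2 where
        e1: "e1 \<in> K" "e1 \<in> poly_seq l q" "\<forall>n. e1 n \<in> L" "\<forall>i<r. e1 i = \<one>" "e1 r = h1" and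
        e2: "e2 \<in> K" "e2 \<in> poly_seq l q" "\<forall>n. e2 n \<in> L" "\<forall>i<r. e2 i = \<one>" "e2 r = h2" by blast
      with K.m_closed[OF e1(1) e2(1)] show ?case
        by (intro exI[of _ "\<lambda>n. e1 n \<otimes> e2 n"]) (auto simp: poly_seq_mult)
    qed
    have "f r \<in> H (q + r * l) \<inter> L"
      using poly_seq_first_value[of f l q r] Suc.prems by auto
    then have "f r \<in> generate G B" using gens[OF Suc.prems(4) r] by (auto simp: B_def)
    from ex[OF this] obtain e where
      e: "e \<in> K" "e \<in> poly_seq l q" "\<forall>n. e n \<in> L" "\<forall>i<r. e i = \<one>" "e r = f r" by blast
    have ec: "e n \<in> carrier G" "f n \<in> carrier G" for n
      using e Suc.prems poly_seq_carrier by blast+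
    \<comment> \<open>the remainder vanishes up to the index \<open>r\<close>, so the induction hypothesis applies to it\<close>
    have "(\<lambda>n. f n \<otimes> inv (e n)) \<in> K"
    proof (rule Suc.hyps(1)[of "Suc r"])
      show "d = Suc N - Suc r" using Suc.hyps(2) by simp
      show "(\<lambda>n. f n \<otimes> inv (e n)) \<in> poly_seq l q"
        using Suc.prems e by (simp add: poly_seq_mult poly_seq_inv)
      show "f i \<otimes> inv (e i) = \<one>" if "i < Suc r" for i
        using that e Suc.prems ec by (auto simp: less_Suc_eq)
      show "s \<le> Suc r" using Suc.prems by simp
    qed (use e Suc.prems in auto)
    from K.m_closed[OF this e(1)] show ?case using ec by (simp add: m_assoc)
  qed
  show ?thesis by (rule claim[of f s]) (use f in auto)
qed

corollary taylor_value:
  assumes K: "subgroup K G"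
    and coeff: "\<And>r c. \<lbrakk>s \<le> r; r \<le> N; c \<in> H (q + r * l)\<rbrakk> \<Longrightarrow> c [^] (N choose r) \<in> K"
    and f: "f \<in> poly_seq l q" "\<And>i. i < s \<Longrightarrow> f i = \<one>"
  shows "f N \<in> K"
proof -
  interpret K: subgroup K G by fact
  have S: "subgroup {g \<in> poly_seq l 0. g N \<in> K} (poly_group l)"
  proof (rule group.subgroupI[OF group_poly_group])
    have "(\<lambda>n. \<one>) \<in> {g \<in> poly_seq l 0. g N \<in> K}"
      by (simp add: poly_seq_def poly_upto_one)
    then show "{g \<in> poly_seq l 0. g N \<in> K} \<noteq> {}" by blast
  qed (auto simp: inv_poly_group poly_seq_inv poly_seq_mult)
  have "f \<in> {g \<in> poly_seq l 0. g N \<in> K}"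
  proof (rule taylor[OF S subgroup_self, of q N s f])
    show "\<rho> \<in> {g \<in> poly_seq l 0. g N \<in> K}"
      if "\<rho> \<in> poly_seq l q" "\<And>i. i \<le> N \<Longrightarrow> \<rho> i = \<one>" for \<rho>
      using that poly_seq_weight by auto
    show "H (q + r * l) \<inter> carrier G \<subseteq> generate G {c \<in> H (q + r * l) \<inter> carrier G.
        (\<lambda>n. c [^] (n choose r)) \<in> {g \<in> poly_seq l 0. g N \<in> K}}" if "s \<le> r" "r \<le> N" for r
    proof
      fix c assume "c \<in> H (q + r * l) \<inter> carrier G"
      moreover from this have "(\<lambda>n. c [^] (n choose r)) \<in> poly_seq l 0"
        using poly_seq_weight[OF poly_seq_power_choose[of c q r l]] by simp
      ultimately show "c \<in> generate G {c \<in> H (q + r * l) \<inter> carrier G.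
        (\<lambda>n. c [^] (n choose r)) \<in> {g \<in> poly_seq l 0. g N \<in> K}}"
        using coeff[OF that, of c] by (intro generate.incl) simp
    qed
    show "f n \<in> carrier G" for n by (rule poly_seq_carrier[OF f(1)])
  qed (fact f)+
  then show ?thesis by simp
qed

end

section \<open>The lower central series\<close>

context group
begin

lemma subgroup_nat_pow_mem: "subgroup K G \<Longrightarrow> x \<in> K \<Longrightarrow> x [^] (n::nat) \<in> K"
  by (induction n) (auto intro: subgroup.one_closed subgroup.m_closed)

lemma gcomm_mem_normal_left:
  assumes "C \<lhd> G" "x \<in> C" "y \<in> carrier G"
  shows "gcomm G x y \<in> C"
proof -
  interpret C: normal C G by fact
  have "x \<otimes> (y \<otimes> inv x \<otimes> inv y) \<in> C"
    using assms by (intro C.m_closed C.inv_op_closed2) auto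
  then show ?thesis using assms C.mem_carrier by (simp add: gcomm_def m_assoc)
qed

lemma gcomm_mem_normal_right:
  assumes "C \<lhd> G" "x \<in> carrier G" "y \<in> C"
  shows "gcomm G x y \<in> C"
proof -
  interpret C: normal C G by fact
  have "inv (gcomm G y x) \<in> C" using gcomm_mem_normal_left assms by (intro C.m_inv_closed) auto
  then show ?thesis using assms C.mem_carrier by (simp add: inv_gcomm)
qed

lemma gcomm_swap_mem:
  assumes "subgroup C G" "x \<in> carrier G" "y \<in> carrier G" "gcomm G y x \<in> C"
  shows "gcomm G x y \<in> C"
  using subgroup.m_inv_closed[OF assms(1,4)] assms(2,3) by (simp add: inv_gcomm)

text \<open>
  The three subgroups lemma for single elements \<open>x\<close> and \<open>y\<close>.  The conjugates in the Hall-Witt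
  identity are absorbed by letting \<open>u\<close> range over a normal subgroup and \<open>w\<close> over the group.
\<close>

lemma three_subgroups:
  assumes C: "C \<lhd> G" and Z: "Z \<lhd> G"
    and x: "x \<in> carrier G" and y: "y \<in> carrier G" and z: "z \<in> Z"
    and 1: "\<And>u w. u \<in> Z \<Longrightarrow> w \<in> carrier G \<Longrightarrow> gcomm G (gcomm G y u) w \<in> C"
    and 2: "\<And>u. u \<in> Z \<Longrightarrow> gcomm G (gcomm G u x) (x \<otimes> y \<otimes> inv x) \<in> C"
  shows "gcomm G (gcomm G x y) z \<in> C"
proof -
  interpret C: normal C G by fact
  interpret Z: normal Z G by fact
  define u where "u = inv y \<otimes> z \<otimes> y"
  have u: "u \<in> Z" using Z.inv_op_closed1[OF y z] by (simp add: u_def)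
  then have uc: "u \<in> carrier G" and zc: "z \<in> carrier G" using z Z.mem_carrier by auto
  have z_eq: "z = y \<otimes> u \<otimes> inv y" using y zc by (simp add: u_def free_reduce)
  let ?b = "gcomm G (gcomm G y u) (u \<otimes> x \<otimes> inv u)" and ?c = "gcomm G (gcomm G u x) (x \<otimes> y \<otimes> inv x)"
  have bc: "?b \<otimes> ?c \<in> C" using 1[OF u] 2[OF u] uc x by (intro C.m_closed) auto
  have "gcomm G (gcomm G x y) z \<otimes> (?b \<otimes> ?c) = \<one>"
    using hall_witt[OF x y uc] x y uc by (simp add: z_eq m_assoc)
  then have "gcomm G (gcomm G x y) z = inv (?b \<otimes> ?c)"
    using x y zc uc by (intro inv_equality[symmetric]) auto
  with bc show ?thesis by simp
qed

text \<open>
  Here \<open>[y, z]\<close> is central modulo \<open>C\<close>, so \<open>y \<mapsto> [y, z]\<close> is multiplicative on the powers of \<open>y\<close>.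
\<close>

lemma gcomm_pow_left:
  assumes C: "C \<lhd> G" and y: "y \<in> carrier G" and z: "z \<in> carrier G"
    and central: "\<And>g. g \<in> carrier G \<Longrightarrow> gcomm G g (gcomm G y z) \<in> C"
  shows "\<exists>c\<in>C. gcomm G (y [^] (n::nat)) z = c \<otimes> gcomm G y z [^] n"
proof (induction n)
  case 0
  interpret C: normal C G by fact
  show ?case using z by (intro bexI[of _ \<one>]) (auto simp: gcomm_def)
next
  case (Suc n)
  interpret C: normal C G by fact
  define w where "w = gcomm G y z"
  have w: "w \<in> carrier G" using y z by (simp add: w_def)
  from Suc obtain c where c: "c \<in> C" "gcomm G (y [^] n) z = c \<otimes> w [^] n" by (auto simp: w_def)
  define d where "d = gcomm G (y [^] n) w"
  have d: "d \<in> C" using central[of "y [^] n"] y by (simp add: d_def w_def)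
  have carr: "c \<in> carrier G" "d \<in> carrier G" using c d C.mem_carrier by auto
  have "gcomm G (y [^] Suc n) z = d \<otimes> w \<otimes> (c \<otimes> w [^] n)"
    using y z w c(2) conj_eq_gcomm_mult[of "y [^] n" w]
    by (simp add: gcomm_mult_left w_def[symmetric] d_def)
  also have "\<dots> = (d \<otimes> (w \<otimes> c \<otimes> inv w)) \<otimes> w [^] Suc n"
    using w carr nat_pow_Suc2[OF w, of n] by (simp add: free_reduce)
  finally show ?case using c d w by (auto simp: w_def intro!: C.m_closed C.inv_op_closed2)
qed

lemma pow_mult_central:
  assumes C: "C \<lhd> G" and e: "e \<in> carrier G" and y: "y \<in> carrier G"
    and central: "\<And>g. g \<in> carrier G \<Longrightarrow> gcomm G g e \<in> C"
  shows "\<exists>c\<in>C. (e \<otimes> y) [^] (n::nat) = c \<otimes> e [^] n \<otimes> y [^] n"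
proof (induction n)
  case 0
  interpret C: normal C G by fact
  show ?case by (intro bexI[of _ \<one>]) auto
next
  case (Suc n)
  interpret C: normal C G by fact
  from Suc obtain c where c: "c \<in> C" "(e \<otimes> y) [^] n = c \<otimes> e [^] n \<otimes> y [^] n" by auto
  define d where "d = gcomm G (y [^] n) e"
  have d: "d \<in> C" using central[of "y [^] n"] y by (simp add: d_def)
  have carr: "c \<in> carrier G" "d \<in> carrier G" using c d C.mem_carrier by auto
  have "(e \<otimes> y) [^] Suc n = c \<otimes> e [^] n \<otimes> (y [^] n \<otimes> e \<otimes> inv (y [^] n)) \<otimes> y [^] Suc n"
    using c(2) e y carr by (simp add: free_reduce)
  also have "\<dots> = (c \<otimes> (e [^] n \<otimes> d \<otimes> inv (e [^] n))) \<otimes> e [^] Suc n \<otimes> y [^] Suc n"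
    using e y carr conj_eq_gcomm_mult[of "y [^] n" e] by (simp add: free_reduce d_def[symmetric])
  finally show ?case using c d e by (auto intro!: C.m_closed C.inv_op_closed2)
qed

text \<open>
  The displacement of a product is the product of the displacements up to conjugation.
\<close>

lemma displacement_generate:
  assumes f: "f \<in> hom G G" and C: "C \<lhd> G" and A: "A \<subseteq> carrier G"
    and gen: "\<And>a. a \<in> A \<Longrightarrow> f a \<otimes> inv a \<in> C" and z: "z \<in> generate G A"
  shows "f z \<otimes> inv z \<in> C"
  using z
proof (induction z rule: generate.induct)
  interpret C: normal C G by fact
  interpret f: group_hom G G f using f by unfold_locales
  {
    case one
    show ?case by simp
  next
    case (incl h)
    then show ?case by (rule gen)
  next
    case (inv h)
    then have h: "h \<in> carrier G" using A by auto
    have "inv (inv h \<otimes> (f h \<otimes> inv h) \<otimes> h) \<in> C"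
      using gen[OF inv] h by (intro C.m_inv_closed C.inv_op_closed1)
    with h show ?case by (simp add: free_reduce)
  next
    case (eng h1 h2)
    then have h: "h1 \<in> carrier G" "h2 \<in> carrier G" using A generate_in_carrier by blast+
    have "(f h1 \<otimes> inv h1) \<otimes> (h1 \<otimes> (f h2 \<otimes> inv h2) \<otimes> inv h1) \<in> C"
      by (rule C.m_closed[OF eng.IH(1) C.inv_op_closed2[OF h(1) eng.IH(2)]])
    with h show ?case by (simp add: free_reduce)
  }
qed

text \<open>
  The induction that proves \<open>[D m, D n] \<subseteq> D (m + n)\<close> for a series generated by commutators
  with the whole group and by additional elements \<open>E\<close>: the three subgroups lemma deals with the
  commutators, and the premise \<open>extra\<close> with the additional generators.  The lower central series has
  no additional generators, the Stallings series has \<open>p\<close>-th powers.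
\<close>

lemma n_series_of_generators:
  fixes D :: "nat \<Rightarrow> 'a set" and E :: "nat \<Rightarrow> 'a set"
  assumes D0: "D 0 = carrier G" and D1: "D (Suc 0) = carrier G" and N: "\<And>n. D n \<lhd> G"
    and anti: "\<And>n. D (Suc n) \<subseteq> D n"
    and step: "\<And>n x y. x \<in> carrier G \<Longrightarrow> y \<in> D (Suc n) \<Longrightarrow> gcomm G x y \<in> D (Suc (Suc n))"
    and gen: "\<And>m. D (Suc (Suc m)) \<subseteq> generate G ({gcomm G x y |x y. x \<in> carrier G \<and> y \<in> D (Suc m)} \<union> E m)"
    and E: "\<And>m. E m \<subseteq> carrier G"
    and extra: "\<And>m n e z. \<lbrakk>\<And>x. x \<in> D (Suc m) \<Longrightarrow> gcomm G x z \<in> D (Suc m + Suc n);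
       e \<in> E m; z \<in> D (Suc n)\<rbrakk> \<Longrightarrow> gcomm G e z \<in> D (Suc (Suc m) + Suc n)"
  shows "n_series G D"
proof (rule n_series.intro[OF is_group n_series_axioms.intro])
  show "D 0 = carrier G" by fact
  show "subgroup (D n) G" for n using N by (rule normal_imp_subgroup)
  show "D (Suc n) \<subseteq> D n" for n by fact
  have Dc: "D n \<subseteq> carrier G" for n using N normal_imp_subgroup subgroup.subset by blast
  have main: "gcomm G x z \<in> D (m + Suc n)" if "x \<in> D m" "z \<in> D (Suc n)" for x z m n
    using that
  proof (induction m arbitrary: x z n rule: less_induct)
    case (less m)
    consider "m = 0" | "m = Suc 0" | m' where "m = Suc (Suc m')" by (metis not0_implies_Suc)
    then show ?case
    proof cases
      case 1
      with less.prems N D0 show ?thesis by (auto intro: gcomm_mem_normal_right)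
    next
      case 2
      with less.prems step D1 show ?thesis by auto
    next
      case (3 m')
      let ?A = "{gcomm G x y |x y. x \<in> carrier G \<and> y \<in> D (Suc m')} \<union> E m'"
      have Ac: "?A \<subseteq> carrier G" using Dc E by fastforce
      have "gcomm G a z' \<in> D (m + Suc n)" if a: "a \<in> ?A" and z: "z' \<in> D (Suc n)" for a z'
      proof (cases "a \<in> E m'")
        case True
        have "gcomm G u z' \<in> D (Suc m' + Suc n)" if "u \<in> D (Suc m')" for u
          using less.IH[of "Suc m'"] that z 3 by auto
        from extra[OF this True z] show ?thesis using 3 by simp
      next
        case False
        with a obtain u v where uv: "a = gcomm G u v" "u \<in> carrier G" "v \<in> D (Suc m')" by blast
        have vc: "v \<in> carrier G" using uv Dc by blast
        have "gcomm G (gcomm G u v) z' \<in> D (m + Suc n)"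
        proof (rule three_subgroups[OF N N uv(2) vc z])
          fix t w assume t: "t \<in> D (Suc n)" and w: "w \<in> carrier G"
          have tc: "t \<in> carrier G" using t Dc by blast
          have "gcomm G v t \<in> D (Suc (m' + Suc n))" using less.IH[of "Suc m'" v t n] uv t 3 by simp
          from step[OF w this] show "gcomm G (gcomm G v t) w \<in> D (m + Suc n)"
            using w vc tc 3 by - (rule gcomm_swap_mem[OF normal_imp_subgroup[OF N]], auto)
        next
          fix t assume t: "t \<in> D (Suc n)"
          have tc: "t \<in> carrier G" using t Dc by blast
          have "gcomm G t u \<in> D (Suc (Suc n))"
            using step[OF uv(2) t] uv(2) tc by - (rule gcomm_swap_mem[OF normal_imp_subgroup[OF N]], auto)
          moreover have c: "u \<otimes> v \<otimes> inv u \<in> D (Suc m')"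
            using normal.inv_op_closed2[OF N uv(2,3)] .
          ultimately have "gcomm G (u \<otimes> v \<otimes> inv u) (gcomm G t u) \<in> D (m + Suc n)"
            using less.IH[of "Suc m'" "u \<otimes> v \<otimes> inv u" "gcomm G t u" "Suc n"] 3 by simp
          then show "gcomm G (gcomm G t u) (u \<otimes> v \<otimes> inv u) \<in> D (m + Suc n)"
            using tc uv(2) vc by - (rule gcomm_swap_mem[OF normal_imp_subgroup[OF N]], auto)
        qed
        with uv show ?thesis by simp
      qed
      moreover have "x \<in> generate G ?A" using gen[of m'] 3 less.prems by auto
      moreover have "z \<in> generate G (D (Suc n))" using less.prems by (simp add: generate.incl)
      ultimately show ?thesis by (rule gcomm_generate[OF Ac Dc N])
    qed
  qed
  show "gcomm G x y \<in> D (m + n)" if "x \<in> D m" "y \<in> D n" for x y m n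
  proof (cases n)
    case 0
    with that D0 N show ?thesis by (auto intro: gcomm_mem_normal_left)
  next
    case (Suc n')
    with that main show ?thesis by simp
  qed
qed

lemma commutator_subgroup_gcomm:
  "commutator_subgroup G A B = generate G {gcomm G x y |x y. x \<in> A \<and> y \<in> B}"
  by (simp add: commutator_subgroup_def gcomm_def)

lemma normal_commutator_subgroup:
  assumes "C \<lhd> G"
  shows "commutator_subgroup G (carrier G) C \<lhd> G"
proof -
  interpret C: normal C G by fact
  show ?thesis
    unfolding commutator_subgroup_gcomm
  proof (rule normal_generateI)
    fix h g assume "h \<in> {gcomm G x y |x y. x \<in> carrier G \<and> y \<in> C}" and g: "g \<in> carrier G"
    then obtain x y where "h = gcomm G x y" "x \<in> carrier G" "y \<in> C" by blast
    with g show "g \<otimes> h \<otimes> inv g \<in> {gcomm G x y |x y. x \<in> carrier G \<and> y \<in> C}"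
      using gcomm_conj[of g x y] C.inv_op_closed2[OF g, of y] by fastforce
  qed (auto intro: gcomm_closed)
qed

lemma conj_pow:
  "g \<in> carrier G \<Longrightarrow> x \<in> carrier G \<Longrightarrow> g \<otimes> x [^] (n::nat) \<otimes> inv g = (g \<otimes> x \<otimes> inv g) [^] n"
proof (induction n)
  case (Suc n)
  from Suc.IH[OF Suc.prems, symmetric] Suc.prems show ?case by (simp add: free_reduce)
qed simp

lemma normal_power_subgroup:
  assumes "C \<lhd> G"
  shows "power_subgroup G C n \<lhd> G"
proof -
  interpret C: normal C G by fact
  show ?thesis
    unfolding power_subgroup_def
  proof (rule normal_generateI)
    fix h g assume "h \<in> {x [^] n |x. x \<in> C}" and g: "g \<in> carrier G"
    then obtain x where x: "h = x [^] n" "x \<in> C" by blast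
    with C.inv_op_closed2[OF g, of x] conj_pow[OF g, of x n]
    show "g \<otimes> h \<otimes> inv g \<in> {x [^] n |x. x \<in> C}" by auto
  qed auto
qed

lemma normal_lower_central_series: "lower_central_series G n \<lhd> G"
proof -
  have "lower_central_series G n \<lhd> G \<and> lower_central_series G (Suc n) \<lhd> G"
    by (induction n) (auto simp: normal_commutator_subgroup normal_self)
  then show ?thesis by simp
qed

lemma lower_central_series_Suc_subset: "lower_central_series G (Suc n) \<subseteq> lower_central_series G n"
proof (cases n)
  case (Suc m)
  have "commutator_subgroup G (carrier G) (lower_central_series G n) \<subseteq> lower_central_series G n"
    unfolding commutator_subgroup_gcomm
    using gcomm_mem_normal_right[OF normal_lower_central_series]
    by (intro generate_subgroup_incl normal_imp_subgroup normal_lower_central_series) blast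
  with Suc show ?thesis by simp
qed simp

lemma n_series_lower_central: "n_series G (lower_central_series G)"
proof (rule n_series_of_generators[where E = "\<lambda>_. {}"])
  show "lower_central_series G n \<lhd> G" for n by (rule normal_lower_central_series)
  show "lower_central_series G (Suc n) \<subseteq> lower_central_series G n" for n
    by (rule lower_central_series_Suc_subset)
  show "gcomm G x y \<in> lower_central_series G (Suc (Suc n))"
    if "x \<in> carrier G" "y \<in> lower_central_series G (Suc n)" for x y n
    using that by (auto simp: commutator_subgroup_gcomm intro: generate.incl)
qed (simp_all add: commutator_subgroup_gcomm)

end

section \<open>Series with a Johnson homomorphism\<close>

text \<open>
  The facts about a series on which the Johnson homomorphism rests: besides the commutator rule,
  the graded quotients have exponent \<open>p\<close>, the terms are preserved by all endomorphisms, and an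
  endomorphism that acts trivially on \<open>G / D 2\<close> acts trivially on every graded quotient.
\<close>

locale johnson_series = n_series G D for G (structure) and D :: "nat \<Rightarrow> 'a set" and p :: nat +
  assumes Suc_0: "D (Suc 0) = carrier G"
    and pow_mem_Suc: "1 \<le> n \<Longrightarrow> x \<in> D n \<Longrightarrow> x [^] p \<in> D (Suc n)"
    and endo_mem: "f \<in> hom G G \<Longrightarrow> x \<in> D n \<Longrightarrow> f x \<in> D n"
    and displacement_mem: "\<lbrakk>f \<in> hom G G; \<And>x. x \<in> carrier G \<Longrightarrow> f x \<otimes> inv x \<in> D 2; 1 \<le> n; z \<in> D n\<rbrakk>
      \<Longrightarrow> f z \<otimes> inv z \<in> D (Suc n)"

context n_series
begin

lemma gcomm_perturb_mem:
  assumes H1: "H (Suc 0) = carrier G" and x: "x \<in> carrier G" and y: "y \<in> H n"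
    and a: "a \<in> H 2" and b: "b \<in> H (Suc n)"
  shows "gcomm G (a \<otimes> x) (b \<otimes> y) \<otimes> inv (gcomm G x y) \<in> H (Suc (Suc n))"
proof -
  have c: "a \<in> carrier G" "b \<in> carrier G" "y \<in> carrier G" using a b y mem_carrier by auto
  have x1: "x \<in> H (Suc 0)" using x H1 by simp
  have "gcomm G x b \<in> H (Suc (Suc n))" using gcomm_mem[OF x1 b] by simp
  then have 1: "a \<otimes> gcomm G x b \<otimes> inv a \<in> H (Suc (Suc n))" using c by (simp add: conj_mem)
  have ab: "a \<otimes> b \<in> H (Suc 0)" using c H1 by simp
  have "gcomm G x y \<in> H (Suc n)" using gcomm_mem[OF x1 y] by simp
  from gcomm_mem[OF ab this] have 2: "gcomm G (a \<otimes> b) (gcomm G x y) \<in> H (Suc (Suc n))" by simp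
  have "b \<otimes> y \<in> H n" using mult_mem mem_mono[OF b, of n] y by simp
  from gcomm_mem[OF a this] have "gcomm G a (b \<otimes> y) \<in> H (Suc (Suc n))" by simp
  then have 3: "gcomm G x y \<otimes> gcomm G a (b \<otimes> y) \<otimes> inv (gcomm G x y) \<in> H (Suc (Suc n))"
    using c x by (intro conj_mem) auto
  show ?thesis
    unfolding gcomm_perturb[OF c(1) c(2) x c(3)] using mult_mem[OF mult_mem[OF 1 2] 3] .
qed

text \<open>
  This propagates triviality of an action from \<open>G / H 2\<close> to the deeper quotients: the
  displacement of \<open>[x, y]\<close> is a product of conjugates of commutators that involve a displacement
  of \<open>x\<close> or \<open>y\<close>.
\<close>

lemma displacement_gcomm_mem:
  assumes H1: "H (Suc 0) = carrier G" and f: "f \<in> hom G G" and x: "x \<in> carrier G" and y: "y \<in> H n"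
    and fx: "f x \<otimes> inv x \<in> H 2" and fy: "f y \<otimes> inv y \<in> H (Suc n)"
  shows "f (gcomm G x y) \<otimes> inv (gcomm G x y) \<in> H (Suc (Suc n))"
proof -
  interpret f: group_hom G G f using f by unfold_locales
  have yc: "y \<in> carrier G" using y mem_carrier by auto
  have "f (gcomm G x y) = gcomm G (f x \<otimes> inv x \<otimes> x) (f y \<otimes> inv y \<otimes> y)"
    using x yc by (simp add: gcomm_def m_assoc)
  with gcomm_perturb_mem[OF H1 x y fx fy] show ?thesis by simp
qed

end

section \<open>The Zassenhaus series\<close>

text \<open>
  The exponent \<open>a\<close> is the multiplicity of \<open>p\<close> in \<open>r\<close>: compare both sides of
  \<open>r * (p ^ j choose r) = p ^ j * (p ^ j - 1 choose r - 1)\<close>.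
\<close>

lemma prime_power_dvd_binomial:
  fixes p :: nat
  assumes p: "prime p" and r: "1 \<le> r" "r \<le> p ^ j"
  obtains a where "a \<le> j" "p ^ a \<le> r" "p ^ (j - a) dvd (p ^ j choose r)"
proof -
  define a where "a = multiplicity p r"
  obtain s where s: "r = p ^ a * s" "\<not> p dvd s"
    unfolding a_def using p r by (metis multiplicity_decompose' not_prime_unit not_one_le_zero)
  have le: "p ^ a \<le> r" using s r by (cases s) auto
  have aj: "a \<le> j"
  proof (rule ccontr)
    assume "\<not> a \<le> j"
    then have "p ^ j < p ^ a" using prime_gt_1_nat[OF p] by (intro power_strict_increasing) auto
    with le r show False by simp
  qed
  have "r * (p ^ j choose r) = p ^ j * ((p ^ j - 1) choose (r - 1))"
    using binomial_absorption[of "r - 1" "p ^ j"] r by simp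
  then have "p ^ a * (s * (p ^ j choose r)) = p ^ a * (p ^ (j - a) * ((p ^ j - 1) choose (r - 1)))"
    using s(1) aj by (simp flip: power_add mult.assoc)
  then have "s * (p ^ j choose r) = p ^ (j - a) * ((p ^ j - 1) choose (r - 1))"
    using p by (simp add: prime_gt_0_nat)
  then have "p ^ (j - a) dvd s * (p ^ j choose r)" by simp
  moreover have "coprime (p ^ (j - a)) s"
    using s(2) p by (simp add: prime_imp_coprime)
  ultimately have "p ^ (j - a) dvd (p ^ j choose r)"
    by (simp add: coprime_dvd_mult_right_iff)
  with that aj le show ?thesis by blast
qed

lemma prime_dvd_binomial:
  fixes p :: nat
  assumes "prime p" "1 \<le> r" "r < p"
  shows "p dvd (p choose r)"
proof -
  obtain a where a: "a \<le> 1" "p ^ a \<le> r" "p ^ (1 - a) dvd (p ^ 1 choose r)"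
    using prime_power_dvd_binomial[of p r 1] assms by auto
  with assms have "a = 0" by (cases a) auto
  with a show ?thesis by simp
qed

context group
begin

lemma lower_central_series_carrier: "x \<in> lower_central_series G n \<Longrightarrow> x \<in> carrier G"
  by (rule subgroup.mem_carrier[OF normal_imp_subgroup[OF normal_lower_central_series]])

lemma zassenhaus_generators:
  "zassenhaus_series p G n =
     generate G {x [^] (p ^ j) |x i j. 1 \<le> i \<and> n \<le> i * p ^ j \<and> x \<in> lower_central_series G i}"
  (is "_ = generate G ?A")
proof
  have Ac: "?A \<subseteq> carrier G" using lower_central_series_carrier by blast
  show "zassenhaus_series p G n \<subseteq> generate G ?A"
    unfolding zassenhaus_series_def
  proof (rule generate_subgroup_incl[OF UN_least generate_is_subgroup[OF Ac]])
    fix q assume "q \<in> {(i, j). 1 \<le> i \<and> n \<le> i * p ^ j}"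
    then obtain i j where q: "q = (i, j)" "1 \<le> i" "n \<le> i * p ^ j" by blast
    then have "{x [^] (p ^ j) |x. x \<in> lower_central_series G i} \<subseteq> ?A" by blast
    with q mono_generate
    show "(case q of (i, j) \<Rightarrow> power_subgroup G (lower_central_series G i) (p ^ j)) \<subseteq> generate G ?A"
      by (simp add: power_subgroup_def)
  qed
  show "generate G ?A \<subseteq> zassenhaus_series p G n"
    unfolding zassenhaus_series_def
    by (rule mono_generate) (auto simp: power_subgroup_def intro!: generate.incl)
qed

lemma normal_zassenhaus: "zassenhaus_series p G n \<lhd> G"
  unfolding zassenhaus_generators
proof (rule normal_generateI)
  let ?A = "{x [^] (p ^ j) |x i j. 1 \<le> i \<and> n \<le> i * p ^ j \<and> x \<in> lower_central_series G i}"
  show "?A \<subseteq> carrier G" using lower_central_series_carrier by blast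
  fix h g assume "h \<in> ?A" and g: "g \<in> carrier G"
  then obtain x i j where x: "h = x [^] (p ^ j)" "1 \<le> i" "n \<le> i * p ^ j"
    "x \<in> lower_central_series G i" by blast
  have "g \<otimes> h \<otimes> inv g = (g \<otimes> x \<otimes> inv g) [^] (p ^ j)"
    using conj_pow[OF g lower_central_series_carrier[OF x(4)]] x by simp
  moreover have "g \<otimes> x \<otimes> inv g \<in> lower_central_series G i"
    using normal.inv_op_closed2[OF normal_lower_central_series g x(4)] .
  ultimately show "g \<otimes> h \<otimes> inv g \<in> ?A" using x by blast
qed

lemma subgroup_zassenhaus: "subgroup (zassenhaus_series p G n) G"
  by (rule normal_imp_subgroup[OF normal_zassenhaus])

lemma zassenhaus_antimono: "m \<le> n \<Longrightarrow> zassenhaus_series p G n \<subseteq> zassenhaus_series p G m"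
  unfolding zassenhaus_generators by (rule mono_generate) (use le_trans in blast)

lemma zassenhaus_pow_mem:
  assumes z: "z \<in> lower_central_series G w" "1 \<le> w" and le: "n \<le> w * p ^ e" and dvd: "p ^ e dvd m"
  shows "z [^] m \<in> zassenhaus_series p G n"
proof -
  have zc: "z \<in> carrier G" by (rule lower_central_series_carrier[OF z(1)])
  from dvd obtain k where "m = p ^ e * k" by (elim dvdE)
  then have "z [^] m = (z [^] (p ^ e)) [^] k" using zc by (simp add: nat_pow_pow)
  moreover have "z [^] (p ^ e) \<in> zassenhaus_series p G n"
    unfolding zassenhaus_generators using z le by (intro generate.incl) blast
  ultimately show ?thesis using subgroup_nat_pow_mem[OF subgroup_zassenhaus] by simp
qed

text \<open>
  The commutator of \<open>x\<close> to the power \<open>n\<close> and \<open>y\<close> to the power \<open>m\<close> is polynomial in both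
  \<open>n\<close> and \<open>m\<close>, and trivial when either is 0.  Hence it is a product of elements \<open>z\<close> of
  weight \<open>r * i + s * l\<close>, with \<open>r, s \<ge> 1\<close>, raised to the power
  \<open>(n choose r) * (m choose s)\<close>.  For \<open>n = p ^ j\<close> and \<open>m = p ^ t\<close> this exponent is
  divisible by \<open>p ^ (j - a + (t - b))\<close>, where \<open>p ^ a \<le> r\<close> and \<open>p ^ b \<le> s\<close>, and
  so each factor lies deep enough.  The variable \<open>m\<close> is hidden in the group \<open>?P\<close> of
  polynomial sequences, and the outer expansion is in \<open>n\<close>.
\<close>

lemma zassenhaus_gcomm_generators:
  assumes p: "prime p" and x: "x \<in> lower_central_series G i" "1 \<le> i"
    and y: "y \<in> lower_central_series G l" "1 \<le> l"
  shows "gcomm G (x [^] (p ^ j)) (y [^] (p ^ t)) \<in> zassenhaus_series p G (i * p ^ j + l * p ^ t)"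
proof -
  interpret L: n_series G "lower_central_series G" by (rule n_series_lower_central)
  let ?P = "L.poly_group l"
  interpret P: n_series ?P "L.poly_seq l" by (rule L.n_series_poly_group)
  let ?Z = "zassenhaus_series p G (i * p ^ j + l * p ^ t)"
  have Z1: "\<one> \<in> ?Z" by (rule subgroup.one_closed[OF subgroup_zassenhaus])
  define X where "X = (\<lambda>m::nat. x)"
  define Y where "Y = (\<lambda>m::nat. y [^] m)"
  have X: "X \<in> L.poly_seq l i" unfolding X_def using x(1) by (rule L.poly_seq_const)
  have Y: "Y \<in> L.poly_seq l 0" unfolding Y_def using y(1) by (intro L.poly_seq_power) simp
  have X0: "X \<in> L.poly_seq l 0" using L.poly_seq_weight[OF X] by simp
  define F where "F = (\<lambda>n::nat. gcomm ?P (X [^]\<^bsub>?P\<^esub> n) Y)"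
  have F_apply: "F n m = gcomm G (x [^] n) (y [^] m)" for n m
  proof -
    have "X [^]\<^bsub>?P\<^esub> n \<in> L.poly_seq l 0" using X0 P.nat_pow_closed by simp
    with Y show ?thesis
      by (simp add: F_def L.gcomm_poly_group) (simp add: L.pow_poly_group X_def Y_def)
  qed
  \<comment> \<open>the claim about the outer expansion is membership in \<open>K\<close>; the side condition \<open>L0\<close> excludes \<open>s = 0\<close>\<close>
  define K where "K = {f \<in> P.poly_seq i 0. f (p ^ j) (p ^ t) \<in> ?Z}"
  define L0 where "L0 = {h \<in> L.poly_seq l 0. h 0 = \<one>}"
  have K: "subgroup K (P.poly_group i)"
  proof (rule group.subgroupI[OF P.group_poly_group])
    have "(\<lambda>n. \<one>\<^bsub>?P\<^esub>) \<in> K"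
      unfolding K_def using Z1 P.poly_seq_const[OF P.one_mem] by simp
    then show "K \<noteq> {}" by blast
    show "inv\<^bsub>P.poly_group i\<^esub> f \<in> K" if f: "f \<in> K" for f
    proof -
      have "f \<in> P.poly_seq i 0" using f by (simp add: K_def)
      moreover from this have "f (p ^ j) \<in> L.poly_seq l 0" by (rule P.poly_seq_value)
      ultimately show ?thesis
        using f subgroup.m_inv_closed[OF subgroup_zassenhaus]
        by (simp add: K_def P.inv_poly_group P.poly_seq_inv) (simp add: L.inv_poly_group)
    qed
  next
    fix f g assume "f \<in> K" "g \<in> K"
    then show "f \<otimes>\<^bsub>P.poly_group i\<^esub> g \<in> K"
      using P.poly_seq_mult[of f i 0 g] subgroup.m_closed[OF subgroup_zassenhaus]
      by (simp add: K_def)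
  qed (auto simp: K_def)
  have L0: "subgroup L0 ?P"
  proof (rule P.subgroupI)
    have "(\<lambda>n. \<one>) \<in> L0" unfolding L0_def using L.poly_seq_const[OF L.one_mem] by simp
    then show "L0 \<noteq> {}" by blast
  qed (auto simp: L0_def L.inv_poly_group L.poly_seq_inv L.poly_seq_mult)
  have "F \<in> K"
  proof (rule P.taylor[OF K L0, where q = 0 and N = "p ^ j" and s = 1])
    show "F \<in> P.poly_seq i 0"
      unfolding F_def
      using P.poly_seq_gcomm[OF P.poly_seq_power[of X 0 i] P.poly_seq_const[OF Y]] X by simp
    then have "F n \<in> L.poly_seq l 0" for n by (rule P.poly_seq_value)
    then show "F n \<in> L0" for n
      using L.mem_carrier[OF x(1)] by (simp add: L0_def F_apply) (simp add: gcomm_def)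
    show "F n = \<one>\<^bsub>?P\<^esub>" if "n < 1" for n
      using that L.mem_carrier[OF y(1)] by (auto simp: F_apply gcomm_def)
    show "\<rho> \<in> K" if "\<rho> \<in> P.poly_seq i 0" "\<And>n. n \<le> p ^ j \<Longrightarrow> \<rho> n = \<one>\<^bsub>?P\<^esub>" for \<rho>
      using that Z1 by (simp add: K_def)
    fix r assume r: "1 \<le> r" "r \<le> p ^ j"
    define B where
      "B = {c \<in> L.poly_seq l (0 + r * i) \<inter> L0. (\<lambda>n. c [^]\<^bsub>?P\<^esub> (n choose r)) \<in> K}"
    have Bc: "B \<subseteq> carrier ?P" by (auto simp: B_def L0_def)
    have B_mem: "b \<in> B"
      if "b \<in> L.poly_seq l (r * i)" "b 0 = \<one>" "b (p ^ t) [^] (p ^ j choose r) \<in> ?Z" for b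
    proof -
      have "(\<lambda>n. b [^]\<^bsub>?P\<^esub> (n choose r)) \<in> P.poly_seq i 0"
        using that by (intro P.poly_seq_power_choose) simp
      with that show ?thesis
        using L.poly_seq_weight[OF that(1), of 0] by (simp add: B_def L0_def K_def L.pow_poly_group)
    qed
    \<comment> \<open>the inner expansion splits a coefficient into factors whose powers are under control\<close>
    have "c \<in> generate ?P B" if c: "c \<in> L.poly_seq l (r * i)" "c 0 = \<one>" for c
    proof (rule L.taylor[OF P.generate_is_subgroup[OF Bc] subgroup_self,
          where q = "r * i" and N = "p ^ t" and s = 1])
      show "c \<in> L.poly_seq l (r * i)" by fact
      then show "c n \<in> carrier G" for n by (rule L.poly_seq_carrier)
      show "c n = \<one>" if "n < 1" for n using that c by simp
      show "\<rho> \<in> generate ?P B"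
        if "\<rho> \<in> L.poly_seq l (r * i)" "\<And>n. n \<le> p ^ t \<Longrightarrow> \<rho> n = \<one>" for \<rho>
        using that Z1 by (intro generate.incl B_mem) auto
      fix s assume s: "1 \<le> s" "s \<le> p ^ t"
      show "lower_central_series G (r * i + s * l) \<inter> carrier G \<subseteq>
        generate G {c \<in> lower_central_series G (r * i + s * l) \<inter> carrier G.
          (\<lambda>n. c [^] (n choose s)) \<in> generate ?P B}"
      proof
        fix z assume "z \<in> lower_central_series G (r * i + s * l) \<inter> carrier G"
        then have z: "z \<in> lower_central_series G (r * i + s * l)" "z \<in> carrier G" by auto
        obtain a where a: "a \<le> j" "p ^ a \<le> r" "p ^ (j - a) dvd (p ^ j choose r)"
          using prime_power_dvd_binomial[OF p r] .
        obtain b where b: "b \<le> t" "p ^ b \<le> s" "p ^ (t - b) dvd (p ^ t choose s)"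
          using prime_power_dvd_binomial[OF p s] .
        have "z [^] ((p ^ t choose s) * (p ^ j choose r)) \<in> ?Z"
        proof (rule zassenhaus_pow_mem[OF z(1), where e = "(j - a) + (t - b)"])
          show "1 \<le> r * i + s * l" using mult_le_mono[OF r(1) x(2)] by linarith
          show "p ^ (j - a + (t - b)) dvd (p ^ t choose s) * (p ^ j choose r)"
            using mult_dvd_mono[OF b(3) a(3)] by (simp add: power_add mult.commute)
          have pos: "1 \<le> p ^ n" for n using p by (simp add: prime_gt_0_nat Suc_leI)
          have "p ^ j = p ^ a * p ^ (j - a)" "p ^ t = p ^ b * p ^ (t - b)"
            using a b by (simp_all flip: power_add)
          then have le: "p ^ j \<le> r * p ^ (j - a)" "p ^ t \<le> s * p ^ (t - b)"
            using a b by (simp_all add: mult_right_mono)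
          have 1: "i * p ^ j \<le> r * i * p ^ (j - a)" and 2: "l * p ^ t \<le> s * l * p ^ (t - b)"
            using mult_left_mono[OF le(1), of i] mult_left_mono[OF le(2), of l] by (simp_all add: mult_ac)
          have "i * p ^ j * 1 + l * p ^ t * 1
              \<le> r * i * p ^ (j - a) * p ^ (t - b) + s * l * p ^ (t - b) * p ^ (j - a)"
            by (intro add_mono mult_le_mono 1 2 pos)
          also have "\<dots> = (r * i + s * l) * p ^ (j - a + (t - b))"
            by (simp add: power_add algebra_simps)
          finally show "i * p ^ j + l * p ^ t \<le> (r * i + s * l) * p ^ (j - a + (t - b))" by simp
        qed
        then have "(\<lambda>n. z [^] (n choose s)) \<in> B"
          using s z L.poly_seq_power_choose[OF z(1)]
          by (intro B_mem) (auto simp: nat_pow_pow binomial_eq_0)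
        with z show "z \<in> generate G {c \<in> lower_central_series G (r * i + s * l) \<inter> carrier G.
          (\<lambda>n. c [^] (n choose s)) \<in> generate ?P B}"
          by (intro generate.incl) (auto intro: generate.incl)
      qed
    qed
    then show "L.poly_seq l (0 + r * i) \<inter> L0 \<subseteq>
      generate ?P {c \<in> L.poly_seq l (0 + r * i) \<inter> L0. (\<lambda>n. c [^]\<^bsub>?P\<^esub> (n choose r)) \<in> K}"
      by (auto simp: B_def L0_def)
  qed
  then show ?thesis by (simp add: K_def F_apply)
qed

lemma zassenhaus_carrier: "n \<le> Suc 0 \<Longrightarrow> zassenhaus_series p G n = carrier G"
proof
  assume n: "n \<le> Suc 0"
  show "zassenhaus_series p G n \<subseteq> carrier G" by (rule subgroup.subset[OF subgroup_zassenhaus])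
  have "x \<in> zassenhaus_series p G n" if "x \<in> carrier G" for x
    using zassenhaus_pow_mem[of x 1 n p 0 1] that n by simp
  then show "carrier G \<subseteq> zassenhaus_series p G n" by blast
qed

lemma lower_central_subset_zassenhaus: "1 \<le> i \<Longrightarrow> lower_central_series G i \<subseteq> zassenhaus_series p G i"
proof
  fix x assume "1 \<le> i" and x: "x \<in> lower_central_series G i"
  moreover have "x \<in> carrier G" by (rule lower_central_series_carrier[OF x])
  ultimately show "x \<in> zassenhaus_series p G i" using zassenhaus_pow_mem[of x i i p 0 1] by simp
qed

lemma n_series_zassenhaus:
  assumes p: "prime p"
  shows "n_series G (zassenhaus_series p G)"
proof (rule n_series.intro[OF is_group n_series_axioms.intro])
  show "zassenhaus_series p G 0 = carrier G" by (simp add: zassenhaus_carrier)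
  show "subgroup (zassenhaus_series p G n) G" for n by (rule subgroup_zassenhaus)
  show "zassenhaus_series p G (Suc n) \<subseteq> zassenhaus_series p G n" for n
    by (rule zassenhaus_antimono) simp
  fix x y m n assume x: "x \<in> zassenhaus_series p G m" and y: "y \<in> zassenhaus_series p G n"
  show "gcomm G x y \<in> zassenhaus_series p G (m + n)"
  proof (rule gcomm_generate[OF _ _ normal_zassenhaus _
        x[unfolded zassenhaus_generators] y[unfolded zassenhaus_generators]])
    fix u v
    assume "u \<in> {x [^] (p ^ j) |x i j. 1 \<le> i \<and> m \<le> i * p ^ j \<and> x \<in> lower_central_series G i}"
      "v \<in> {x [^] (p ^ j) |x i j. 1 \<le> i \<and> n \<le> i * p ^ j \<and> x \<in> lower_central_series G i}"
    then obtain x i j y l t where u: "u = x [^] (p ^ j)" "1 \<le> i" "m \<le> i * p ^ j" "x \<in> lower_central_series G i"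
      and v: "v = y [^] (p ^ t)" "1 \<le> l" "n \<le> l * p ^ t" "y \<in> lower_central_series G l" by blast
    have "gcomm G u v \<in> zassenhaus_series p G (i * p ^ j + l * p ^ t)"
      using zassenhaus_gcomm_generators[OF p u(4,2) v(4,2)] u v by simp
    moreover have "zassenhaus_series p G (i * p ^ j + l * p ^ t) \<subseteq> zassenhaus_series p G (m + n)"
      using u(3) v(3) by (intro zassenhaus_antimono add_mono)
    ultimately show "gcomm G u v \<in> zassenhaus_series p G (m + n)" by blast
  qed (use lower_central_series_carrier in blast)+
qed

lemma hom_generate_subset:
  assumes f: "f \<in> hom G G" and A: "A \<subseteq> carrier G" "f ` A \<subseteq> A"
  shows "f ` generate G A \<subseteq> generate G A"
proof -
  interpret f: group_hom G G f using f by unfold_locales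
  show ?thesis unfolding f.generate_img[OF A(1), symmetric] by (rule mono_generate[OF A(2)])
qed

text \<open>
  By downward induction on \<open>m\<close>, starting from \<open>m = p * a\<close>, where nothing is to be done.  For
  the step, the \<open>p\<close>-th power of a product of generators is compared with the product of the
  \<open>p\<close>-th powers by means of a polynomial sequence that is trivial at 0 and 1.  The coefficients of
  order \<open>r\<close> with \<open>2 \<le> r < p\<close> have weight at least \<open>2 * m\<close> and occur with an exponent
  divisible by \<open>p\<close>; the one of order \<open>p\<close> has weight \<open>p * m\<close>.
\<close>

lemma zassenhaus_power_mem:
  assumes p: "prime p" and a: "1 \<le> a" "a \<le> m" and x: "x \<in> zassenhaus_series p G m"
  shows "x [^] p \<in> zassenhaus_series p G (p * a)"
proof -
  interpret Z: n_series G "zassenhaus_series p G" by (rule n_series_zassenhaus[OF p])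
  have "x [^] p \<in> zassenhaus_series p G (p * a)"
    if "p * a \<le> m + d" "a \<le> m" "x \<in> zassenhaus_series p G m" for d m x
    using that
  proof (induction d arbitrary: m x)
    case 0
    then show ?case using Z.pow_mem Z.mem_mono by (metis add_0_right)
  next
    case (Suc d)
    let ?A = "{x [^] (p ^ j) |x i j. 1 \<le> i \<and> m \<le> i * p ^ j \<and> x \<in> lower_central_series G i}"
    have Ac: "?A \<subseteq> carrier G" using lower_central_series_carrier by blast
    have gen: "h [^] p \<in> zassenhaus_series p G (p * a)" "h \<in> carrier G" if "h \<in> ?A" for h
    proof -
      from that obtain y i j where y: "h = y [^] (p ^ j)" "1 \<le> i" "m \<le> i * p ^ j"
        "y \<in> lower_central_series G i" by blast
      have "h [^] p = y [^] (p ^ Suc j)"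
        using lower_central_series_carrier[OF y(4)] y(1) by (simp add: nat_pow_pow mult.commute)
      moreover have "p * a \<le> i * p ^ Suc j"
        using mult_le_mono2[of a "i * p ^ j" p] y(3) Suc.prems(2) by (simp add: mult_ac)
      then have "y [^] (p ^ Suc j) \<in> zassenhaus_series p G (p * a)"
        by (rule zassenhaus_pow_mem[OF y(4,2)]) simp
      ultimately show "h [^] p \<in> zassenhaus_series p G (p * a)" by simp
      show "h \<in> carrier G" using that Ac by blast
    qed
    have "x \<in> generate G ?A" using Suc.prems(3) by (simp add: zassenhaus_generators)
    then show ?case
    proof (induction x rule: generate.induct)
      case one
      then show ?case by (simp add: Z.one_mem)
    next
      case (incl h)
      then show ?case by (rule gen)
    next
      case (inv h)
      then show ?case using gen[OF inv] by (simp add: nat_pow_inv Z.inv_mem)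
    next
      case (eng u v)
      then have uv: "u \<in> zassenhaus_series p G m" "v \<in> zassenhaus_series p G m"
        by (simp_all add: zassenhaus_generators)
      have c: "u \<in> carrier G" "v \<in> carrier G" using uv Z.mem_carrier by auto
      define q where "q = (\<lambda>n::nat. inv (v [^] n) \<otimes> inv (u [^] n) \<otimes> (u \<otimes> v) [^] n)"
      have poly: "q \<in> Z.poly_seq m 0"
        unfolding q_def using uv Z.mult_mem[OF uv]
        by (intro Z.poly_seq_mult Z.poly_seq_inv Z.poly_seq_power) auto
      have vanish: "q i = \<one>" if "i < 2" for i
      proof -
        have "i = 0 \<or> i = 1" using that by auto
        then show ?thesis using c by (auto simp: q_def free_reduce)
      qed
      have coeff: "c [^] (p choose r) \<in> zassenhaus_series p G (p * a)"
        if r: "2 \<le> r" "r \<le> p" and c: "c \<in> zassenhaus_series p G (0 + r * m)" for r c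
      proof (cases "r = p")
        case True
        have "p * a \<le> p * m" using Suc.prems by simp
        with True c Z.mem_mono Z.mem_carrier show ?thesis by auto
      next
        case False
        then obtain k where k: "p choose r = p * k"
          using prime_dvd_binomial[OF p, of r] r by (auto elim: dvdE)
        have "2 * m \<le> r * m" using r by simp
        then have le: "Suc m \<le> r * m" using a Suc.prems(2) by linarith
        then have "c [^] p \<in> zassenhaus_series p G (p * a)"
          using Suc.prems c by (intro Suc.IH[of "r * m"]) auto
        with Z.pow_mem[of "c [^] p" "p * a" k] Z.mem_carrier[OF c] k show ?thesis
          by (simp add: nat_pow_pow)
      qed
      have "q p \<in> zassenhaus_series p G (p * a)"
        by (rule Z.taylor_value[OF subgroup_zassenhaus, where s = 2 and q = 0 and l = m];
            fact coeff poly vanish)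
      with eng.IH have "u [^] p \<otimes> v [^] p \<otimes> q p \<in> zassenhaus_series p G (p * a)"
        by (intro Z.mult_mem)
      then show ?case using c by (simp add: q_def free_reduce)
    qed
  qed
  from this[of m "p * a" x] a x show ?thesis by simp
qed

text \<open>
  The sequence \<open>n \<mapsto> (e z)\<^sup>n z\<^sup>-\<^sup>n\<close> has differences conjugate to \<open>e\<close>.  So its coefficient of order
  \<open>r\<close> has weight \<open>1 + r * m\<close>, one more than expected from \<open>z\<close> alone.
\<close>

lemma zassenhaus_displacement_power:
  assumes p: "prime p" and m: "1 \<le> m" and z: "z \<in> zassenhaus_series p G m"
    and e: "e \<in> zassenhaus_series p G (Suc m)"
  shows "(e \<otimes> z) [^] p \<otimes> inv (z [^] p) \<in> zassenhaus_series p G (Suc (m * p))"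
proof -
  interpret Z: n_series G "zassenhaus_series p G" by (rule n_series_zassenhaus[OF p])
  have c: "e \<in> carrier G" "z \<in> carrier G" using z e Z.mem_carrier by auto
  have ez: "e \<otimes> z \<in> zassenhaus_series p G m"
    using Z.mult_mem[OF Z.mem_mono[OF e] z] by simp
  define u where "u = (\<lambda>n::nat. (e \<otimes> z) [^] n \<otimes> inv (z [^] n))"
  have "Z.difference u = (\<lambda>n. (e \<otimes> z) [^] n \<otimes> e \<otimes> inv ((e \<otimes> z) [^] n))"
    using c by (auto simp: Z.difference_def u_def free_reduce)
  also have "\<dots> \<in> Z.poly_seq m (1 + m)"
    using ez e by (intro Z.poly_seq_conj[where q' = 0] Z.poly_seq_const Z.poly_seq_power) auto
  finally have poly: "u \<in> Z.poly_seq m 1"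
    using c by (subst Z.poly_seq_difference) (auto simp: u_def zassenhaus_carrier)
  have vanish: "u n = \<one>" if "n < 1" for n using that by (simp add: u_def)
  have coeff: "c [^] (p choose r) \<in> zassenhaus_series p G (Suc (m * p))"
    if r: "1 \<le> r" "r \<le> p" and c: "c \<in> zassenhaus_series p G (1 + r * m)" for r c
  proof (cases "r = p")
    case True
    with c Z.mem_carrier show ?thesis by (auto simp: mult.commute)
  next
    case False
    then obtain k where k: "p choose r = p * k"
      using prime_dvd_binomial[OF p, of r] r by (auto elim: dvdE)
    have "1 * m \<le> r * m" using r by (intro mult_right_mono) auto
    then have "c \<in> zassenhaus_series p G (Suc m)" using c by (intro Z.mem_mono[OF c]) simp
    then have "c [^] p \<in> zassenhaus_series p G (p * Suc m)"
      by (intro zassenhaus_power_mem[OF p]) auto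
    moreover have "Suc (m * p) \<le> p * Suc m" using p prime_gt_0_nat[OF p] by (simp add: mult.commute)
    ultimately have "c [^] p \<in> zassenhaus_series p G (Suc (m * p))" by (rule Z.mem_mono)
    with Z.pow_mem[of "c [^] p" "Suc (m * p)" k] Z.mem_carrier[OF c] k show ?thesis
      by (simp add: nat_pow_pow)
  qed
  have "u p \<in> zassenhaus_series p G (Suc (m * p))"
    by (rule Z.taylor_value[OF subgroup_zassenhaus, where s = 1 and q = 1 and l = m];
        fact coeff poly vanish)
  then show ?thesis by (simp add: u_def)
qed

lemma hom_lower_central_series:
  assumes f: "f \<in> hom G G"
  shows "x \<in> lower_central_series G n \<Longrightarrow> f x \<in> lower_central_series G n"
proof -
  interpret f: group_hom G G f using f by unfold_locales
  have "f ` lower_central_series G n \<subseteq> lower_central_series G n \<and>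
    f ` lower_central_series G (Suc n) \<subseteq> lower_central_series G (Suc n)"
  proof (induction n)
    case (Suc n)
    let ?A = "{gcomm G x y |x y. x \<in> carrier G \<and> y \<in> lower_central_series G (Suc n)}"
    have A: "?A \<subseteq> carrier G" using lower_central_series_carrier by auto
    have "f ` ?A \<subseteq> ?A"
    proof
      fix w assume "w \<in> f ` ?A"
      then obtain x y where xy: "w = f (gcomm G x y)" "x \<in> carrier G"
        "y \<in> lower_central_series G (Suc n)" by blast
      then have "w = gcomm G (f x) (f y)"
        using lower_central_series_carrier[OF xy(3)] by (simp add: gcomm_def)
      moreover have "f x \<in> carrier G" "f y \<in> lower_central_series G (Suc n)"
        using xy Suc.IH by auto
      ultimately show "w \<in> ?A" by blast
    qed
    then have "f ` generate G ?A \<subseteq> generate G ?A"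
      using hom_generate_subset[OF f A] by blast
    with Suc.IH show ?case by (simp add: commutator_subgroup_gcomm)
  qed auto
  then show "x \<in> lower_central_series G n \<Longrightarrow> f x \<in> lower_central_series G n" by blast
qed

lemma johnson_series_zassenhaus:
  assumes p: "prime p"
  shows "johnson_series G (zassenhaus_series p G) p"
proof (rule johnson_series.intro[OF n_series_zassenhaus[OF p] johnson_series_axioms.intro])
  interpret Z: n_series G "zassenhaus_series p G" by (rule n_series_zassenhaus[OF p])
  show "zassenhaus_series p G (Suc 0) = carrier G" by (simp add: zassenhaus_carrier)
  show "x [^] p \<in> zassenhaus_series p G (Suc n)" if "1 \<le> n" "x \<in> zassenhaus_series p G n" for n x
  proof -
    have "2 * n \<le> p * n" using prime_ge_2_nat[OF p] by simp
    then have "Suc n \<le> p * n" using that(1) by linarith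
    from Z.mem_mono[OF zassenhaus_power_mem[OF p that(1) _ that(2)] this] show ?thesis by simp
  qed
  show "f x \<in> zassenhaus_series p G n"
    if f: "f \<in> hom G G" and x: "x \<in> zassenhaus_series p G n" for f x n
  proof -
    interpret f: group_hom G G f using f by unfold_locales
    let ?A = "{x [^] (p ^ j) |x i j. 1 \<le> i \<and> n \<le> i * p ^ j \<and> x \<in> lower_central_series G i}"
    have A: "?A \<subseteq> carrier G" using lower_central_series_carrier by blast
    have "f ` ?A \<subseteq> ?A"
      using hom_lower_central_series[OF f] lower_central_series_carrier
      by (fastforce simp: f.hom_nat_pow)
    then have "f ` generate G ?A \<subseteq> generate G ?A"
      using hom_generate_subset[OF f A] by blast
    with x show ?thesis unfolding zassenhaus_generators by blast
  qed
  fix f n z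
  assume f: "f \<in> hom G G" and triv: "\<And>x. x \<in> carrier G \<Longrightarrow> f x \<otimes> inv x \<in> zassenhaus_series p G 2"
    and n: "1 \<le> n" and z: "z \<in> zassenhaus_series p G n"
  interpret f: group_hom G G f using f by unfold_locales
  have lower: "f y \<otimes> inv y \<in> zassenhaus_series p G (Suc (Suc i))"
    if "y \<in> lower_central_series G (Suc i)" for i y
    using that
  proof (induction i arbitrary: y)
    case 0
    with triv[of y] show ?case by (simp add: numeral_2_eq_2)
  next
    case (Suc i)
    let ?A = "{gcomm G x y |x y. x \<in> carrier G \<and> y \<in> lower_central_series G (Suc i)}"
    have A: "?A \<subseteq> carrier G" using lower_central_series_carrier by auto
    have "f a \<otimes> inv a \<in> zassenhaus_series p G (Suc (Suc (Suc i)))" if a: "a \<in> ?A" for a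
    proof -
      from a obtain g y where gy: "a = gcomm G g y" "g \<in> carrier G"
        "y \<in> lower_central_series G (Suc i)" by blast
      have "y \<in> zassenhaus_series p G (Suc i)"
        using lower_central_subset_zassenhaus[of "Suc i"] gy(3) by auto
      from Z.displacement_gcomm_mem[OF zassenhaus_carrier f gy(2) this triv[OF gy(2)] Suc.IH[OF gy(3)]]
      show ?thesis using gy(1) by simp
    qed
    moreover have "y \<in> generate G ?A" using Suc.prems by (simp add: commutator_subgroup_gcomm)
    ultimately show ?case by (rule displacement_generate[OF f normal_zassenhaus A])
  qed
  have power: "f (y [^] (p ^ j)) \<otimes> inv (y [^] (p ^ j)) \<in> zassenhaus_series p G (Suc (i * p ^ j))"
    if y: "y \<in> lower_central_series G i" "1 \<le> i" for y i j
  proof (induction j)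
    case 0
    then show ?case using lower[of y "i - 1"] y lower_central_series_carrier[OF y(1)] by simp
  next
    case (Suc j)
    have yc: "y \<in> carrier G" by (rule lower_central_series_carrier[OF y(1)])
    define w where "w = y [^] (p ^ j)"
    have w: "w \<in> zassenhaus_series p G (i * p ^ j)"
      unfolding w_def by (rule zassenhaus_pow_mem[OF y, where e = j]) simp_all
    have wc: "w \<in> carrier G" using yc by (simp add: w_def)
    have "1 \<le> i * p ^ j" using y prime_gt_0_nat[OF p] by (simp add: Suc_leI)
    from zassenhaus_displacement_power[OF p this w Suc.IH[folded w_def]]
    have "(f w \<otimes> inv w \<otimes> w) [^] p \<otimes> inv (w [^] p) \<in> zassenhaus_series p G (Suc (i * p ^ j * p))" .
    moreover have "f w \<otimes> inv w \<otimes> w = f w" using wc by (simp add: m_assoc)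
    moreover have "y [^] (p ^ Suc j) = w [^] p" using yc by (simp add: w_def nat_pow_pow mult.commute)
    ultimately show ?case using wc by (simp add: f.hom_nat_pow mult_ac)
  qed
  show "f z \<otimes> inv z \<in> zassenhaus_series p G (Suc n)"
  proof (rule displacement_generate[OF f normal_zassenhaus _ _ z[unfolded zassenhaus_generators]])
    show "{x [^] (p ^ j) |x i j. 1 \<le> i \<and> n \<le> i * p ^ j \<and> x \<in> lower_central_series G i} \<subseteq> carrier G"
      using lower_central_series_carrier by blast
    fix a assume "a \<in> {x [^] (p ^ j) |x i j. 1 \<le> i \<and> n \<le> i * p ^ j \<and> x \<in> lower_central_series G i}"
    then obtain x i j where x: "a = x [^] (p ^ j)" "1 \<le> i" "n \<le> i * p ^ j" "x \<in> lower_central_series G i"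
      by blast
    have "Suc n \<le> Suc (i * p ^ j)" using x by simp
    from Z.mem_mono[OF power[OF x(4,2)] this] x(1) show "f a \<otimes> inv a \<in> zassenhaus_series p G (Suc n)"
      by simp
  qed
qed

end

section \<open>The Stallings series\<close>

context group
begin

lemma normal_stallings: "stallings_series p G n \<lhd> G"
proof -
  have "stallings_series p G n \<lhd> G \<and> stallings_series p G (Suc n) \<lhd> G"
    by (induction n) (auto simp: normal_commutator_subgroup normal_power_subgroup
        normal_subgroup_set_mult_closed normal_self)
  then show ?thesis by simp
qed

lemma stallings_carrier: "x \<in> stallings_series p G n \<Longrightarrow> x \<in> carrier G"
  by (rule subgroup.mem_carrier[OF normal_imp_subgroup[OF normal_stallings]])

lemma stallings_Suc_Suc:
  "stallings_series p G (Suc (Suc n)) = generate G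
    ({gcomm G x y |x y. x \<in> carrier G \<and> y \<in> stallings_series p G (Suc n)} \<union>
     {x [^] p |x. x \<in> stallings_series p G (Suc n)})"
  (is "?S = generate G (?A \<union> ?B)")
proof
  have A: "?A \<subseteq> carrier G" and B: "?B \<subseteq> carrier G" using stallings_carrier by auto
  have S: "?S = generate G ?A <#> generate G ?B"
    by (simp add: commutator_subgroup_gcomm power_subgroup_def)
  show "?S \<subseteq> generate G (?A \<union> ?B)"
    unfolding S set_mult_def
    using mono_generate[of ?A "?A \<union> ?B"] mono_generate[of ?B "?A \<union> ?B"] by (auto intro: generate.eng)
  have "a \<in> ?S" if "a \<in> ?A \<union> ?B" for a
  proof (cases "a \<in> ?A")
    case True
    have "a \<in> carrier G" using True A by blast
    then have "a = a \<otimes> \<one>" by simp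
    with True show ?thesis unfolding S set_mult_def by (auto intro: generate.incl generate.one)
  next
    case False
    then have aB: "a \<in> ?B" using that by blast
    then have "a \<in> carrier G" using B by blast
    then have "a = \<one> \<otimes> a" by simp
    with aB show ?thesis unfolding S set_mult_def by (auto intro: generate.incl generate.one)
  qed
  then show "generate G (?A \<union> ?B) \<subseteq> ?S"
    by (intro generate_subgroup_incl normal_imp_subgroup normal_stallings) blast
qed

lemma stallings_gcomm_mem:
  "x \<in> carrier G \<Longrightarrow> y \<in> stallings_series p G (Suc n) \<Longrightarrow> gcomm G x y \<in> stallings_series p G (Suc (Suc n))"
  unfolding stallings_Suc_Suc by (intro generate.incl) blast

lemma stallings_pow_mem:
  "x \<in> stallings_series p G (Suc n) \<Longrightarrow> x [^] p \<in> stallings_series p G (Suc (Suc n))"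
  unfolding stallings_Suc_Suc by (intro generate.incl) blast

lemma stallings_Suc_subset: "stallings_series p G (Suc n) \<subseteq> stallings_series p G n"
proof (cases n)
  case (Suc m)
  show ?thesis
    unfolding Suc stallings_Suc_Suc
  proof (rule generate_subgroup_incl[OF _ normal_imp_subgroup[OF normal_stallings]], rule Un_least)
    show "{gcomm G x y |x y. x \<in> carrier G \<and> y \<in> stallings_series p G (Suc m)} \<subseteq> stallings_series p G (Suc m)"
      using gcomm_mem_normal_right[OF normal_stallings] by blast
    show "{x [^] p |x. x \<in> stallings_series p G (Suc m)} \<subseteq> stallings_series p G (Suc m)"
      using subgroup_nat_pow_mem[OF normal_imp_subgroup[OF normal_stallings]] by blast
  qed
qed simp

lemma n_series_stallings: "n_series G (stallings_series p G)"
proof (rule n_series_of_generators[where E = "\<lambda>m. {x [^] p |x. x \<in> stallings_series p G (Suc m)}"])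
  show "stallings_series p G n \<lhd> G" for n by (rule normal_stallings)
  show "stallings_series p G (Suc n) \<subseteq> stallings_series p G n" for n by (rule stallings_Suc_subset)
  show "gcomm G x y \<in> stallings_series p G (Suc (Suc n))"
    if "x \<in> carrier G" "y \<in> stallings_series p G (Suc n)" for x y n
    using that by (rule stallings_gcomm_mem)
  show "stallings_series p G (Suc (Suc m)) \<subseteq> generate G
     ({gcomm G x y |x y. x \<in> carrier G \<and> y \<in> stallings_series p G (Suc m)} \<union>
      {x [^] p |x. x \<in> stallings_series p G (Suc m)})" for m
    by (simp only: stallings_Suc_Suc subset_refl)
  show "{x [^] p |x. x \<in> stallings_series p G (Suc m)} \<subseteq> carrier G" for m
    using stallings_carrier by blast
  fix m n e z
  assume IH: "\<And>x. x \<in> stallings_series p G (Suc m) \<Longrightarrow> gcomm G x z \<in> stallings_series p G (Suc m + Suc n)"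
    and "e \<in> {x [^] p |x. x \<in> stallings_series p G (Suc m)}" and z: "z \<in> stallings_series p G (Suc n)"
  then obtain y where y: "e = y [^] p" "y \<in> stallings_series p G (Suc m)" by blast
  let ?C = "stallings_series p G (Suc (Suc m) + Suc n)"
  have yz: "gcomm G y z \<in> stallings_series p G (Suc (m + Suc n))" using IH[OF y(2)] by simp
  have C: "?C = stallings_series p G (Suc (Suc (m + Suc n)))" by (simp only: add_Suc)
  have "\<exists>c\<in>?C. gcomm G (y [^] p) z = c \<otimes> gcomm G y z [^] p"
  proof (rule gcomm_pow_left[OF normal_stallings stallings_carrier[OF y(2)] stallings_carrier[OF z]])
    show "gcomm G g (gcomm G y z) \<in> ?C" if "g \<in> carrier G" for g
      unfolding C by (rule stallings_gcomm_mem[OF that yz])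
  qed
  then obtain c where c: "c \<in> ?C" "gcomm G (y [^] p) z = c \<otimes> gcomm G y z [^] p" by blast
  have "gcomm G y z [^] p \<in> ?C" unfolding C by (rule stallings_pow_mem[OF yz])
  then show "gcomm G e z \<in> ?C"
    unfolding y(1) c(2) by (rule subgroup.m_closed[OF normal_imp_subgroup[OF normal_stallings] c(1)])
qed simp_all

lemma johnson_series_stallings: "johnson_series G (stallings_series p G) p"
proof (rule johnson_series.intro[OF n_series_stallings johnson_series_axioms.intro])
  interpret S: n_series G "stallings_series p G" by (rule n_series_stallings)
  show "stallings_series p G (Suc 0) = carrier G" by simp
  show "x [^] p \<in> stallings_series p G (Suc n)" if "1 \<le> n" "x \<in> stallings_series p G n" for n x
    using that stallings_pow_mem[of x p "n - 1"] by simp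
  have endo: "f ` stallings_series p G n \<subseteq> stallings_series p G n \<and>
      f ` stallings_series p G (Suc n) \<subseteq> stallings_series p G (Suc n)" if f: "f \<in> hom G G" for f n
  proof (induction n)
    interpret f: group_hom G G f using f by unfold_locales
    {
      case 0
      then show ?case by auto
    next
      case (Suc n)
      let ?A = "{gcomm G x y |x y. x \<in> carrier G \<and> y \<in> stallings_series p G (Suc n)} \<union>
        {x [^] p |x. x \<in> stallings_series p G (Suc n)}"
      have A: "?A \<subseteq> carrier G" using stallings_carrier by auto
      have "f a \<in> ?A" if "a \<in> ?A" for a
        using that
      proof
        assume "a \<in> {gcomm G x y |x y. x \<in> carrier G \<and> y \<in> stallings_series p G (Suc n)}"
        then obtain x y where xy: "a = gcomm G x y" "x \<in> carrier G" "y \<in> stallings_series p G (Suc n)"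
          by blast
        then have "f a = gcomm G (f x) (f y)"
          using stallings_carrier[OF xy(3)] by (simp add: gcomm_def)
        moreover have "f y \<in> stallings_series p G (Suc n)" using xy(3) Suc.IH by blast
        moreover have "f x \<in> carrier G" using xy(2) by simp
        ultimately show ?thesis by blast
      next
        assume "a \<in> {x [^] p |x. x \<in> stallings_series p G (Suc n)}"
        then obtain x where x: "a = x [^] p" "x \<in> stallings_series p G (Suc n)" by blast
        then have "f a = f x [^] p" using stallings_carrier[OF x(2)] by (simp add: f.hom_nat_pow)
        moreover have "f x \<in> stallings_series p G (Suc n)" using x(2) Suc.IH by blast
        ultimately show ?thesis by blast
      qed
      then have "f ` ?A \<subseteq> ?A" by blast
      then have "f ` generate G ?A \<subseteq> generate G ?A"
        using hom_generate_subset[OF f A] by blast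
      with Suc.IH show ?case by (simp only: stallings_Suc_Suc)
    }
  qed
  then show "f x \<in> stallings_series p G n"
    if "f \<in> hom G G" "x \<in> stallings_series p G n" for f x n
    using that by blast
  fix f n z
  assume f: "f \<in> hom G G" and triv: "\<And>x. x \<in> carrier G \<Longrightarrow> f x \<otimes> inv x \<in> stallings_series p G 2"
    and n: "1 \<le> n" and z: "z \<in> stallings_series p G n"
  interpret f: group_hom G G f using f by unfold_locales
  have "f y \<otimes> inv y \<in> stallings_series p G (Suc (Suc i))"
    if "y \<in> stallings_series p G (Suc i)" for i y
    using that
  proof (induction i arbitrary: y)
    case 0
    with triv[of y] show ?case by (simp add: numeral_2_eq_2)
  next
    case (Suc i)
    let ?A = "{gcomm G x y |x y. x \<in> carrier G \<and> y \<in> stallings_series p G (Suc i)} \<union>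
      {x [^] p |x. x \<in> stallings_series p G (Suc i)}"
    let ?C = "stallings_series p G (Suc (Suc (Suc i)))"
    have A: "?A \<subseteq> carrier G" using stallings_carrier by auto
    have "f a \<otimes> inv a \<in> ?C" if "a \<in> ?A" for a
      using that
    proof
      assume "a \<in> {gcomm G x y |x y. x \<in> carrier G \<and> y \<in> stallings_series p G (Suc i)}"
      then obtain g y where gy: "a = gcomm G g y" "g \<in> carrier G" "y \<in> stallings_series p G (Suc i)"
        by blast
      from S.displacement_gcomm_mem[OF _ f gy(2,3) triv[OF gy(2)] Suc.IH[OF gy(3)]] gy(1)
      show ?thesis by simp
    next
      assume "a \<in> {x [^] p |x. x \<in> stallings_series p G (Suc i)}"
      then obtain x where x: "a = x [^] p" "x \<in> stallings_series p G (Suc i)" by blast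
      have xc: "x \<in> carrier G" by (rule stallings_carrier[OF x(2)])
      define e where "e = f x \<otimes> inv x"
      have e: "e \<in> stallings_series p G (Suc (Suc i))" unfolding e_def by (rule Suc.IH[OF x(2)])
      have ec: "e \<in> carrier G" by (rule stallings_carrier[OF e])
      obtain c where c: "c \<in> ?C" "(e \<otimes> x) [^] p = c \<otimes> e [^] p \<otimes> x [^] p"
        using pow_mult_central[OF normal_stallings ec xc stallings_gcomm_mem[OF _ e]] by blast
      have cc: "c \<in> carrier G" by (rule stallings_carrier[OF c(1)])
      have "f a = (e \<otimes> x) [^] p" using x(1) xc by (simp add: f.hom_nat_pow e_def m_assoc)
      then have "f a \<otimes> inv a = c \<otimes> e [^] p" using c(2) x(1) xc ec cc by (simp add: free_reduce)
      with S.mult_mem[OF c(1) stallings_pow_mem[OF e]] show ?thesis by simp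
    qed
    moreover have "y \<in> generate G ?A" using Suc.prems by (simp only: stallings_Suc_Suc)
    ultimately show ?case by (rule displacement_generate[OF f normal_stallings A])
  qed
  from this[of z "n - 1"] n z show "f z \<otimes> inv z \<in> stallings_series p G (Suc n)" by simp
qed

end

section \<open>The fundamental group\<close>

text \<open>
  In a convex set only the end points of a path matter.  The unit and inverse laws of the fundamental
  group, and the relation between the edges of a singular triangle, are images of such homotopies.
\<close>

lemma homotopic_paths_convex_image:
  fixes F :: "'v::real_normed_vector \<Rightarrow> 'a::topological_space"
  assumes C: "convex C" and F: "continuous_on C F" "F \<in> C \<rightarrow> S"
    and q: "path q" "path_image q \<subseteq> C" and r: "path r" "path_image r \<subseteq> C"
    and ends: "pathstart q = pathstart r" "pathfinish q = pathfinish r"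
  shows "homotopic_paths S (F \<circ> q) (F \<circ> r)"
proof -
  have "homotopic_paths C q r"
  proof (rule homotopic_paths_linear)
    fix t :: real assume "t \<in> {0..1}"
    then have "q t \<in> C" "r t \<in> C" using q r by (auto simp: path_image_def)
    then show "closed_segment (q t) (r t) \<subseteq> C" using C by (rule closed_segment_subset)
  qed (use q r ends in auto)
  then show ?thesis using F by (rule homotopic_paths_continuous_image)
qed

definition based_loops :: "'a::topological_space set \<Rightarrow> 'a \<Rightarrow> (real \<Rightarrow> 'a) set" where
  "based_loops S b = {\<gamma>. path \<gamma> \<and> path_image \<gamma> \<subseteq> S \<and> pathstart \<gamma> = b \<and> pathfinish \<gamma> = b}"

lemma path_const: "path (\<lambda>_. a :: 'a::topological_space)"
  by (simp add: path_def)

lemma path_image_const: "path_image (\<lambda>_. a) = {a}"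
  by (auto simp: path_image_def)

lemma pathstart_const [simp]: "pathstart (\<lambda>_. a) = a" and pathfinish_const [simp]: "pathfinish (\<lambda>_. a) = a"
  by (simp_all add: pathstart_def pathfinish_def)

text \<open>
  Both sides of each homotopy are images under \<open>p\<close> of paths in the unit interval.
\<close>

lemma
  fixes p :: "real \<Rightarrow> 'a::topological_space"
  assumes p: "path p" "path_image p \<subseteq> S"
  shows homotopic_paths_const_join: "homotopic_paths S ((\<lambda>_. pathstart p) +++ p) p"
    and homotopic_paths_join_reversepath: "homotopic_paths S (p +++ reversepath p) (\<lambda>_. pathstart p)"
    and homotopic_paths_reversepath_join: "homotopic_paths S (reversepath p +++ p) (\<lambda>_. pathfinish p)"
proof -
  let ?I = "linepath 0 (1::real)" and ?c = "\<lambda>t::real. (\<lambda>_. t) :: real \<Rightarrow> real"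
  have cont: "continuous_on {0..1} p" "p \<in> {0..1} \<rightarrow> S"
    using p by (auto simp: path_def path_image_def)
  have hom: "homotopic_paths S (p \<circ> q) (p \<circ> r)"
    if "path q" "path_image q \<subseteq> {0..1}" "path r" "path_image r \<subseteq> {0..1}"
      "pathstart q = pathstart r" "pathfinish q = pathfinish r" for q r
    using homotopic_paths_convex_image[OF _ cont that] by simp
  have I: "path_image ?I \<subseteq> {0..1}" "path_image (?c 0) \<subseteq> {0..1}" "path_image (?c 1) \<subseteq> {0..1}"
    by (auto simp: path_image_const closed_segment_eq_real_ivl)
  have pI: "p \<circ> ?I = p" by (auto simp: linepath_def)
  have "homotopic_paths S (p \<circ> (?c 0 +++ ?I)) (p \<circ> ?I)"
    by (intro hom) (simp_all add: path_const subset_path_image_join I del: path_image_linepath)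
  then show "homotopic_paths S ((\<lambda>_. pathstart p) +++ p) p"
    by (simp add: path_compose_join pI) (simp add: comp_def pathstart_def)
  have "homotopic_paths S (p \<circ> (?I +++ reversepath ?I)) (p \<circ> ?c 0)"
    by (intro hom) (simp_all add: path_const subset_path_image_join I del: path_image_linepath reversepath_linepath)
  then show "homotopic_paths S (p +++ reversepath p) (\<lambda>_. pathstart p)"
    by (simp add: path_compose_join path_compose_reversepath pI del: reversepath_linepath)
      (simp add: comp_def pathstart_def)
  have "homotopic_paths S (p \<circ> (reversepath ?I +++ ?I)) (p \<circ> ?c 1)"
    by (intro hom) (simp_all add: path_const subset_path_image_join I del: path_image_linepath reversepath_linepath)
  then show "homotopic_paths S (reversepath p +++ p) (\<lambda>_. pathfinish p)"
    by (simp add: path_compose_join path_compose_reversepath pI del: reversepath_linepath)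
      (simp add: comp_def pathfinish_def)
qed

lemma loop_class_eqI: "homotopic_paths S \<gamma> \<delta> \<Longrightarrow> loop_class S \<gamma> = loop_class S \<delta>"
  unfolding loop_class_def using homotopic_paths_sym homotopic_paths_trans by blast

lemma mem_loop_class_self: "path \<gamma> \<Longrightarrow> path_image \<gamma> \<subseteq> S \<Longrightarrow> \<gamma> \<in> loop_class S \<gamma>"
  by (simp add: loop_class_def)

lemma carrier_fundamental_group: "carrier (fundamental_group S b) = loop_class S ` based_loops S b"
  by (simp add: fundamental_group_def based_loops_def)

lemma one_fundamental_group: "\<one>\<^bsub>fundamental_group S b\<^esub> = loop_class S (\<lambda>_. b)"
  by (simp add: fundamental_group_def)

lemma mult_fundamental_group:
  assumes "\<gamma> \<in> based_loops S b" "\<delta> \<in> based_loops S b"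
  shows "loop_class S \<gamma> \<otimes>\<^bsub>fundamental_group S b\<^esub> loop_class S \<delta> = loop_class S (\<gamma> +++ \<delta>)"
proof -
  have 1: "loop_class S (\<gamma>' +++ \<delta>') = loop_class S (\<gamma> +++ \<delta>)"
    if "\<gamma>' \<in> loop_class S \<gamma>" "\<delta>' \<in> loop_class S \<delta>" for \<gamma>' \<delta>'
  proof -
    have "homotopic_paths S (\<gamma> +++ \<delta>) (\<gamma>' +++ \<delta>')"
      using that assms by (intro homotopic_paths_join) (auto simp: loop_class_def based_loops_def)
    then show ?thesis by (rule loop_class_eqI[symmetric])
  qed
  have 2: "\<gamma> \<in> loop_class S \<gamma>" "\<delta> \<in> loop_class S \<delta>"
    using assms by (auto simp: based_loops_def mem_loop_class_self)
  have "loop_class S \<gamma> \<otimes>\<^bsub>fundamental_group S b\<^esub> loop_class S \<delta> =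
      (\<Union>\<gamma>'\<in>loop_class S \<gamma>. \<Union>\<delta>'\<in>loop_class S \<delta>. loop_class S (\<gamma>' +++ \<delta>'))"
    by (simp add: fundamental_group_def)
  also have "\<dots> = (\<Union>\<gamma>'\<in>loop_class S \<gamma>. \<Union>\<delta>'\<in>loop_class S \<delta>. loop_class S (\<gamma> +++ \<delta>))"
    using 1 by simp
  also have "\<dots> = loop_class S (\<gamma> +++ \<delta>)" using 2 by blast
  finally show ?thesis .
qed

lemma based_loops_const: "b \<in> S \<Longrightarrow> (\<lambda>_. b) \<in> based_loops S b"
  by (simp add: based_loops_def path_const path_image_const)

lemma based_loops_join: "\<gamma> \<in> based_loops S b \<Longrightarrow> \<delta> \<in> based_loops S b \<Longrightarrow> \<gamma> +++ \<delta> \<in> based_loops S b"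
  by (simp add: based_loops_def subset_path_image_join)

lemma based_loops_reversepath: "\<gamma> \<in> based_loops S b \<Longrightarrow> reversepath \<gamma> \<in> based_loops S b"
  by (simp add: based_loops_def)

lemma fundamental_group_cases:
  assumes "x \<in> carrier (fundamental_group S b)"
  obtains \<gamma> where "\<gamma> \<in> based_loops S b" "x = loop_class S \<gamma>"
  using assms by (auto simp: carrier_fundamental_group)

lemma loop_class_carrier: "\<gamma> \<in> based_loops S b \<Longrightarrow> loop_class S \<gamma> \<in> carrier (fundamental_group S b)"
  by (simp add: carrier_fundamental_group)

lemma group_fundamental_group:
  fixes S :: "'a::topological_space set"
  assumes b: "b \<in> S"
  shows "group (fundamental_group S b)"
proof (rule groupI)
  let ?G = "fundamental_group S b"
  show "\<one>\<^bsub>?G\<^esub> \<in> carrier ?G"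
    by (simp add: one_fundamental_group based_loops_const[OF b] loop_class_carrier)
  fix x assume "x \<in> carrier ?G"
  then obtain \<gamma> where \<gamma>: "\<gamma> \<in> based_loops S b" "x = loop_class S \<gamma>" by (rule fundamental_group_cases)
  have p: "path \<gamma>" "path_image \<gamma> \<subseteq> S" "pathstart \<gamma> = b" "pathfinish \<gamma> = b"
    using \<gamma>(1) by (auto simp: based_loops_def)
  show "\<one>\<^bsub>?G\<^esub> \<otimes>\<^bsub>?G\<^esub> x = x"
    using loop_class_eqI[OF homotopic_paths_const_join[OF p(1,2)]] \<gamma> p
    by (simp add: one_fundamental_group mult_fundamental_group based_loops_const[OF b])
  have "loop_class S (reversepath \<gamma>) \<otimes>\<^bsub>?G\<^esub> x = \<one>\<^bsub>?G\<^esub>"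
    using loop_class_eqI[OF homotopic_paths_reversepath_join[OF p(1,2)]] \<gamma> p
    by (simp add: one_fundamental_group mult_fundamental_group based_loops_reversepath)
  then show "\<exists>y\<in>carrier ?G. y \<otimes>\<^bsub>?G\<^esub> x = \<one>\<^bsub>?G\<^esub>"
    using loop_class_carrier[OF based_loops_reversepath[OF \<gamma>(1)]] by blast
  fix y assume "y \<in> carrier ?G"
  then obtain \<delta> where \<delta>: "\<delta> \<in> based_loops S b" "y = loop_class S \<delta>" by (rule fundamental_group_cases)
  show "x \<otimes>\<^bsub>?G\<^esub> y \<in> carrier ?G"
    using \<gamma> \<delta> by (simp add: mult_fundamental_group based_loops_join loop_class_carrier)
  fix z assume "z \<in> carrier ?G"
  then obtain \<epsilon> where \<epsilon>: "\<epsilon> \<in> based_loops S b" "z = loop_class S \<epsilon>" by (rule fundamental_group_cases)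
  have "homotopic_paths S (\<gamma> +++ (\<delta> +++ \<epsilon>)) ((\<gamma> +++ \<delta>) +++ \<epsilon>)"
    using \<gamma> \<delta> \<epsilon> by (intro homotopic_paths_assoc) (auto simp: based_loops_def)
  then show "x \<otimes>\<^bsub>?G\<^esub> y \<otimes>\<^bsub>?G\<^esub> z = x \<otimes>\<^bsub>?G\<^esub> (y \<otimes>\<^bsub>?G\<^esub> z)"
    using \<gamma> \<delta> \<epsilon> by (simp add: mult_fundamental_group based_loops_join loop_class_eqI)
qed

section \<open>Paths as singular chains\<close>

lemma singular_simplex_top_of_set:
  "singular_simplex n (top_of_set S) f \<longleftrightarrow>
     continuous_on (standard_simplex n) f \<and> f \<in> standard_simplex n \<rightarrow> S \<and> f \<in> extensional (standard_simplex n)"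
  by (auto simp: singular_simplex_def euclidean_product_topology)

lemma continuous_on_coordinate: "continuous_on A (\<lambda>x. x i)"
  for A :: "('i \<Rightarrow> 'a::topological_space) set"
  by (rule continuous_on_subset[OF continuous_on_product_coordinates]) simp

lemma standard_simplex_1: "x \<in> standard_simplex 1 \<Longrightarrow> x 0 = 1 - x 1 \<and> 0 \<le> x 1 \<and> x 1 \<le> 1"
  by (auto simp: standard_simplex_def)

lemma singular_simplex_path_simplex:
  assumes "path \<gamma>" "path_image \<gamma> \<subseteq> S"
  shows "singular_simplex 1 (top_of_set S) (path_simplex \<gamma>)"
proof -
  have "continuous_on (standard_simplex 1) (\<lambda>x. \<gamma> (x 1))"
  proof (rule continuous_on_compose2[of "{0..1}" \<gamma>])
    show "continuous_on {0..1} \<gamma>" using assms(1) by (simp add: path_def)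
    show "continuous_on (standard_simplex 1) (\<lambda>x. x 1)" by (rule continuous_on_coordinate)
  qed (auto dest: standard_simplex_1 simp del: One_nat_def)
  then have "continuous_on (standard_simplex 1) (path_simplex \<gamma>)"
    by (rule continuous_on_eq) (simp add: path_simplex_def)
  moreover have "\<gamma> (x 1) \<in> S" if "x \<in> standard_simplex 1" for x
    using standard_simplex_1[OF that] assms(2) by (auto simp: path_image_def)
  ultimately show ?thesis
    by (auto simp: singular_simplex_top_of_set path_simplex_def simp del: One_nat_def)
qed

text \<open>
  The inverse of the passage from paths to singular 1-simplices, up to the values outside the unit
  interval.
\<close>

definition simplex_path :: "((nat \<Rightarrow> real) \<Rightarrow> 'a) \<Rightarrow> real \<Rightarrow> 'a" where
  "simplex_path \<sigma> t = \<sigma> (\<lambda>i. if i = 0 then 1 - t else if i = 1 then t else 0)"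

lemma edge_point_mem: "0 \<le> t \<Longrightarrow> t \<le> 1 \<Longrightarrow> (\<lambda>i. if i = 0 then 1 - t else if i = 1 then t else 0) \<in> standard_simplex 1"
  by (auto simp: standard_simplex_def)

lemma path_simplex_cong: "(\<And>t. 0 \<le> t \<Longrightarrow> t \<le> 1 \<Longrightarrow> \<gamma> t = \<delta> t) \<Longrightarrow> path_simplex \<gamma> = path_simplex \<delta>"
  unfolding path_simplex_def by (rule restrict_ext) (use standard_simplex_1 in blast)

lemma path_simplex_simplex_path:
  assumes "\<sigma> \<in> extensional (standard_simplex 1)"
  shows "path_simplex (simplex_path \<sigma>) = \<sigma>"
proof (rule extensionalityI[OF _ assms])
  show "path_simplex (simplex_path \<sigma>) \<in> extensional (standard_simplex 1)" by (simp add: path_simplex_def)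
  fix x assume x: "x \<in> standard_simplex 1"
  then have "(\<lambda>i. if i = 0 then 1 - x 1 else if i = 1 then x 1 else 0) = x"
    using standard_simplex_1[OF x] by (force simp: standard_simplex_def)
  with x show "path_simplex (simplex_path \<sigma>) x = \<sigma> x"
    by (simp add: path_simplex_def simplex_path_def del: One_nat_def)
qed

lemma simplex_path_path_simplex: "0 \<le> t \<Longrightarrow> t \<le> 1 \<Longrightarrow> simplex_path (path_simplex \<gamma>) t = \<gamma> t"
  using edge_point_mem[of t] by (simp add: simplex_path_def path_simplex_def)

lemma path_simplex_path:
  fixes S :: "'a::topological_space set"
  assumes "singular_simplex 1 (top_of_set S) \<sigma>"
  shows "path (simplex_path \<sigma>)" "path_image (simplex_path \<sigma>) \<subseteq> S"
proof -
  have c: "continuous_on (standard_simplex 1) \<sigma>" and S: "\<sigma> \<in> standard_simplex 1 \<rightarrow> S"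
    using assms by (auto simp: singular_simplex_top_of_set)
  have "continuous_on {0..1} (\<lambda>t::real. (\<lambda>i::nat. if i = 0 then 1 - t else if i = 1 then t else 0))"
  proof (rule continuous_on_coordinatewise_then_product)
    fix i :: nat
    consider "i = 0" | "i = 1" | "i > 1" by linarith
    then show "continuous_on {0..1} (\<lambda>t::real. if i = 0 then 1 - t else if i = 1 then t else 0)"
      by cases (auto intro!: continuous_intros)
  qed
  then show "path (simplex_path \<sigma>)"
    unfolding path_def simplex_path_def[abs_def]
    by (rule continuous_on_compose2[OF c]) (auto simp: edge_point_mem simp del: One_nat_def)
  show "path_image (simplex_path \<sigma>) \<subseteq> S"
    using S edge_point_mem by (auto simp: path_image_def simplex_path_def Pi_iff)
qed

definition affine_triangle :: "('v::real_vector \<Rightarrow> 'a) \<Rightarrow> 'v \<Rightarrow> 'v \<Rightarrow> 'v \<Rightarrow> (nat \<Rightarrow> real) \<Rightarrow> 'a" where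
  "affine_triangle F u v w = (\<lambda>x\<in>standard_simplex 2. F (x 0 *\<^sub>R u + x 1 *\<^sub>R v + x 2 *\<^sub>R w))"

lemma standard_simplex_2: "x \<in> standard_simplex 2 \<Longrightarrow> x 0 + x 1 + x 2 = 1 \<and> 0 \<le> x 0 \<and> 0 \<le> x 1 \<and> 0 \<le> x 2"
  by (simp add: standard_simplex_def numeral_2_eq_2)

lemma singular_simplex_affine_triangle:
  fixes F :: "'v::real_normed_vector \<Rightarrow> 'a::topological_space"
  assumes C: "convex C" "u \<in> C" "v \<in> C" "w \<in> C" and F: "continuous_on C F" "F \<in> C \<rightarrow> S"
  shows "singular_simplex 2 (top_of_set S) (affine_triangle F u v w)"
proof -
  have C': "x 0 *\<^sub>R u + x 1 *\<^sub>R v + x 2 *\<^sub>R w \<in> C" if "x \<in> standard_simplex 2" for x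
  proof -
    have "x 0 *\<^sub>R u + x 1 *\<^sub>R v + x 2 *\<^sub>R w \<in> convex hull {u, v, w}"
      unfolding convex_hull_3 using standard_simplex_2[OF that] by blast
    also have "\<dots> \<subseteq> C" using C by (intro hull_minimal) auto
    finally show ?thesis .
  qed
  have "continuous_on (standard_simplex 2) (\<lambda>x. F (x 0 *\<^sub>R u + x 1 *\<^sub>R v + x 2 *\<^sub>R w))"
    using C' by (intro continuous_on_compose2[OF F(1)] continuous_intros continuous_on_coordinate) auto
  then have "continuous_on (standard_simplex 2) (affine_triangle F u v w)"
    by (rule continuous_on_eq) (simp add: affine_triangle_def)
  then show ?thesis
    using C' F by (auto simp: singular_simplex_top_of_set affine_triangle_def)
qed

lemma chain_boundary_affine_triangle:
  "chain_boundary 2 (frag_of (affine_triangle F u v w)) =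
     frag_of (path_simplex (F \<circ> linepath v w)) - frag_of (path_simplex (F \<circ> linepath u w))
     + frag_of (path_simplex (F \<circ> linepath u v))"
proof -
  have face: "singular_face 2 k (affine_triangle F u v w) = path_simplex (F \<circ> linepath a c)"
    if "k \<le> 2" and eq: "\<And>x. x \<in> standard_simplex 1 \<Longrightarrow>
        (let y = simplical_face k x in y 0 *\<^sub>R u + y 1 *\<^sub>R v + y 2 *\<^sub>R w) = x 0 *\<^sub>R a + x 1 *\<^sub>R c" for k a c
  proof
    fix x
    show "singular_face 2 k (affine_triangle F u v w) x = path_simplex (F \<circ> linepath a c) x"
    proof (cases "x \<in> standard_simplex 1")
      case True
      then have "simplical_face k x \<in> standard_simplex 2"
        using simplical_face_in_standard_simplex[of 2 k x] that(1) by simp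
      with True show ?thesis
        using eq[OF True] standard_simplex_1[OF True]
        by (simp add: singular_face_def affine_triangle_def path_simplex_def linepath_def Let_def)
    qed (simp add: singular_face_def path_simplex_def)
  qed
  have "singular_face 2 0 (affine_triangle F u v w) = path_simplex (F \<circ> linepath v w)"
    by (rule face) (auto simp: simplical_face_def)
  moreover have "singular_face 2 1 (affine_triangle F u v w) = path_simplex (F \<circ> linepath u w)"
    by (rule face) (auto simp: simplical_face_def)
  moreover have "singular_face 2 2 (affine_triangle F u v w) = path_simplex (F \<circ> linepath u v)"
    by (rule face) (auto simp: simplical_face_def)
  ultimately show ?thesis
    by (simp add: chain_boundary_of numeral_2_eq_2)
qed

subsection \<open>Mod-p boundaries\<close>

context
  fixes S :: "'a::topological_space set" and p :: nat
begin

abbreviation (input) bdry :: "'a chain set" where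
  "bdry \<equiv> modp_boundaries p 1 (top_of_set S)"

lemma singular_chain_path_simplex:
  "path \<gamma> \<Longrightarrow> path_image \<gamma> \<subseteq> S \<Longrightarrow> singular_chain 1 (top_of_set S) (frag_of (path_simplex \<gamma>))"
  using singular_simplex_path_simplex by (simp add: singular_chain_of)

lemma modp_boundaries_boundary:
  "singular_chain (Suc n) T d \<Longrightarrow> chain_boundary (Suc n) d \<in> modp_boundaries p n T"
  unfolding modp_boundaries_def by (rule CollectI, rule exI[of _ d], rule exI[of _ 0]) simp

lemma modp_boundaries_cmul:
  "singular_chain n T e \<Longrightarrow> frag_cmul (int p) e \<in> modp_boundaries p n T"
  unfolding modp_boundaries_def by (rule CollectI, rule exI[of _ 0], rule exI[of _ e]) simp

lemma modp_boundaries_add: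
  assumes "c \<in> modp_boundaries p n T" "c' \<in> modp_boundaries p n T"
  shows "c + c' \<in> modp_boundaries p n T"
proof -
  from assms obtain d e d' e' where
    "c = chain_boundary (Suc n) d + frag_cmul (int p) e" "singular_chain (Suc n) T d" "singular_chain n T e"
    "c' = chain_boundary (Suc n) d' + frag_cmul (int p) e'" "singular_chain (Suc n) T d'" "singular_chain n T e'"
    unfolding modp_boundaries_def by blast
  then show ?thesis
    unfolding modp_boundaries_def
    by (intro CollectI exI[of _ "d + d'"] exI[of _ "e + e'"])
      (simp add: chain_boundary_add frag_cmul_distrib2 singular_chain_add)
qed

lemma modp_boundaries_uminus:
  assumes "c \<in> modp_boundaries p n T"
  shows "- c \<in> modp_boundaries p n T"
proof -
  from assms obtain d e where
    "c = chain_boundary (Suc n) d + frag_cmul (int p) e" "singular_chain (Suc n) T d" "singular_chain n T e"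
    unfolding modp_boundaries_def by blast
  moreover have "frag_cmul (int p) (- e) = - frag_cmul (int p) e"
    by (metis frag_cmul_cmul frag_cmul_minus_one mult.commute)
  ultimately show ?thesis
    unfolding modp_boundaries_def
    by (intro CollectI exI[of _ "- d"] exI[of _ "- e"])
      (simp add: chain_boundary_minus singular_chain_minus)
qed

lemma modp_boundaries_diff:
  "c \<in> modp_boundaries p n T \<Longrightarrow> c' \<in> modp_boundaries p n T \<Longrightarrow> c - c' \<in> modp_boundaries p n T"
  using modp_boundaries_add[OF _ modp_boundaries_uminus] by fastforce

lemma modp_boundaries_zero: "0 \<in> modp_boundaries p n T"
  using modp_boundaries_cmul[of n T 0] by simp

text \<open>
  The source of the relations between paths that are needed in homology: images of affine triangles.
\<close>

lemma triangle_mem_bdry: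
  fixes F :: "'v::real_normed_vector \<Rightarrow> 'a"
  assumes "convex C" "u \<in> C" "v \<in> C" "w \<in> C" "continuous_on C F" "F \<in> C \<rightarrow> S"
  shows "frag_of (path_simplex (F \<circ> linepath u v)) + frag_of (path_simplex (F \<circ> linepath v w))
    - frag_of (path_simplex (F \<circ> linepath u w)) \<in> bdry"
proof -
  have "singular_chain (Suc 1) (top_of_set S) (frag_of (affine_triangle F u v w))"
    using singular_simplex_affine_triangle[OF assms] by (simp add: singular_chain_of numeral_2_eq_2)
  moreover have "frag_of (path_simplex (F \<circ> linepath u v)) + frag_of (path_simplex (F \<circ> linepath v w))
      - frag_of (path_simplex (F \<circ> linepath u w)) = chain_boundary (Suc 1) (frag_of (affine_triangle F u v w))"
    using chain_boundary_affine_triangle[of F u v w] by (simp add: numeral_2_eq_2)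
  ultimately show ?thesis by (simp only: modp_boundaries_boundary)
qed

text \<open>
  The three faces of a constant triangle are equal, and two of them cancel in its boundary.
\<close>

lemma const_mem_bdry:
  assumes "a \<in> S"
  shows "frag_of (path_simplex (\<lambda>_. a)) \<in> bdry"
  using triangle_mem_bdry[of UNIV "0::real" 0 0 "\<lambda>_. a"] assms by (simp add: comp_def)

text \<open>
  Apply the joined path to the degenerate triangle in the unit interval with vertices 0, 1/2 and 1.
\<close>

lemma join_mem_bdry:
  assumes "path \<gamma>" "path_image \<gamma> \<subseteq> S" "path \<delta>" "path_image \<delta> \<subseteq> S" "pathfinish \<gamma> = pathstart \<delta>"
  shows "frag_of (path_simplex \<gamma>) + frag_of (path_simplex \<delta>) - frag_of (path_simplex (\<gamma> +++ \<delta>)) \<in> bdry"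
proof -
  let ?F = "\<gamma> +++ \<delta>"
  have "path ?F" "path_image ?F \<subseteq> S" using assms by (auto simp: subset_path_image_join)
  then have F: "continuous_on {0..1} ?F" "?F \<in> {0..1} \<rightarrow> S" by (auto simp: path_def path_image_def)
  have 1: "path_simplex (?F \<circ> linepath 0 (1/2)) = path_simplex \<gamma>"
    by (rule path_simplex_cong) (simp add: linepath_def joinpaths_def)
  have 2: "path_simplex (?F \<circ> linepath (1/2) 1) = path_simplex \<delta>"
    using assms(5)
    by (intro path_simplex_cong) (auto simp: linepath_def joinpaths_def pathfinish_def pathstart_def field_simps)
  have 3: "path_simplex (?F \<circ> linepath 0 1) = path_simplex ?F"
    by (rule path_simplex_cong) (simp add: linepath_def)
  show ?thesis
    using triangle_mem_bdry[of "{0..1}" 0 "1/2" 1 ?F] F by (simp add: 1 2 3)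
qed

text \<open>
  The diagonal cuts the square on which the homotopy is defined into two triangles.
\<close>

lemma homotopic_paths_mem_bdry:
  assumes "homotopic_paths S \<gamma> \<delta>"
  shows "frag_of (path_simplex \<gamma>) - frag_of (path_simplex \<delta>) \<in> bdry"
proof -
  obtain h where h: "continuous_on ({0..1} \<times> {0..1}) h" "h \<in> {0..1} \<times> {0..1} \<rightarrow> S"
    "\<forall>x\<in>{0..1}. h (0, x) = \<gamma> x" "\<forall>x\<in>{0..1}. h (1, x) = \<delta> x"
    and ends: "\<forall>t\<in>{0..1::real}. pathstart (h \<circ> Pair t) = pathstart \<gamma> \<and> pathfinish (h \<circ> Pair t) = pathfinish \<gamma>"
    using assms unfolding homotopic_paths by blast
  have C: "convex ({0..1::real} \<times> {0..1::real})" by (intro convex_Times) auto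
  have \<gamma>: "path_simplex (h \<circ> linepath (0,0) (0,1)) = path_simplex \<gamma>"
    using h by (intro path_simplex_cong) (simp add: linepath_def)
  have \<delta>: "path_simplex (h \<circ> linepath (1,0) (1,1)) = path_simplex \<delta>"
    using h by (intro path_simplex_cong) (simp add: linepath_def)
  have e0: "path_simplex (h \<circ> linepath (0,0) (1,0)) = path_simplex (\<lambda>_. pathstart \<gamma>)"
    using ends by (intro path_simplex_cong) (simp add: linepath_def pathstart_def)
  have e1: "path_simplex (h \<circ> linepath (0,1) (1,1)) = path_simplex (\<lambda>_. pathfinish \<gamma>)"
    using ends by (intro path_simplex_cong) (simp add: linepath_def pathfinish_def)
  let ?diag = "frag_of (path_simplex (h \<circ> linepath (0,0) (1,1)))"
  have "path_image \<gamma> \<subseteq> S" using homotopic_paths_imp_subset[OF assms] by simp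
  then have c: "frag_of (path_simplex (\<lambda>_. pathstart \<gamma>)) \<in> bdry" "frag_of (path_simplex (\<lambda>_. pathfinish \<gamma>)) \<in> bdry"
    using pathstart_in_path_image pathfinish_in_path_image by (blast intro: const_mem_bdry)+
  have 1: "frag_of (path_simplex \<gamma>) + frag_of (path_simplex (\<lambda>_. pathfinish \<gamma>)) - ?diag \<in> bdry"
    using triangle_mem_bdry[OF C _ _ _ h(1,2), of "(0,0)" "(0,1)" "(1,1)"] by (simp add: \<gamma> e1)
  have 2: "frag_of (path_simplex (\<lambda>_. pathstart \<gamma>)) + frag_of (path_simplex \<delta>) - ?diag \<in> bdry"
    using triangle_mem_bdry[OF C _ _ _ h(1,2), of "(0,0)" "(1,0)" "(1,1)"] by (simp add: \<delta> e0)
  from modp_boundaries_add[OF modp_boundaries_diff[OF modp_boundaries_diff[OF 1 2] c(2)] c(1)]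
  show ?thesis by (simp add: algebra_simps)
qed

end

section \<open>First homology mod p and the fundamental group\<close>

lemma subgroup_modp_cycles: "subgroup (modp_cycles p n T) (chain_group n T)"
proof (rule group.subgroupI[OF group_chain_group])
  show "modp_cycles p n T \<subseteq> carrier (chain_group n T)" by (auto simp: modp_cycles_def)
  have "0 \<in> modp_cycles p n T" by (auto simp: modp_cycles_def intro!: exI[of _ 0])
  then show "modp_cycles p n T \<noteq> {}" by blast
  fix c assume "c \<in> modp_cycles p n T"
  then obtain e where c: "singular_chain n T c" "singular_chain (n - 1) T e" "chain_boundary n c = frag_cmul (int p) e"
    by (auto simp: modp_cycles_def)
  have "frag_cmul (int p) (- e) = - frag_cmul (int p) e"
    by (metis frag_cmul_cmul frag_cmul_minus_one mult.commute)
  with c have "- c \<in> modp_cycles p n T"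
    by (auto simp: modp_cycles_def chain_boundary_minus singular_chain_minus intro!: exI[of _ "- e"])
  then show "inv\<^bsub>chain_group n T\<^esub> c \<in> modp_cycles p n T"
    using c by (simp add: singular_chain_def)
  fix c' assume "c' \<in> modp_cycles p n T"
  then obtain e' where c': "singular_chain n T c'" "singular_chain (n - 1) T e'" "chain_boundary n c' = frag_cmul (int p) e'"
    by (auto simp: modp_cycles_def)
  show "c \<otimes>\<^bsub>chain_group n T\<^esub> c' \<in> modp_cycles p n T"
    using c c' by (auto simp: modp_cycles_def chain_boundary_add singular_chain_add frag_cmul_distrib2
        intro!: exI[of _ "e + e'"])
qed

abbreviation modp_cycle_group :: "nat \<Rightarrow> nat \<Rightarrow> 'a topology \<Rightarrow> 'a chain monoid" where
  "modp_cycle_group p n T \<equiv> subgroup_generated (chain_group n T) (modp_cycles p n T)"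

lemma carrier_modp_cycle_group: "carrier (modp_cycle_group p n T) = modp_cycles p n T"
  by (rule subgroup.carrier_subgroup_generated_subgroup[OF subgroup_modp_cycles])

lemma comm_group_modp_cycle_group: "comm_group (modp_cycle_group p n T)"
  by (intro group.abelian_subgroup_generated group_chain_group abelian_chain_group
      subgroup.subset[OF subgroup_modp_cycles])

lemma modp_boundaries_subset_cycles: "modp_boundaries p n T \<subseteq> modp_cycles p n T"
proof
  fix c assume "c \<in> modp_boundaries p n T"
  then obtain d e where c: "c = chain_boundary (Suc n) d + frag_cmul (int p) e"
    "singular_chain (Suc n) T d" "singular_chain n T e"
    unfolding modp_boundaries_def by blast
  then have "chain_boundary n c = frag_cmul (int p) (chain_boundary n e)"
    by (simp add: chain_boundary_add chain_boundary_cmul chain_boundary_boundary_alt)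
  moreover have "singular_chain n T c"
    using c by (simp add: singular_chain_add singular_chain_cmul singular_chain_boundary_alt)
  ultimately show "c \<in> modp_cycles p n T"
    using singular_chain_boundary[OF c(3)] by (auto simp: modp_cycles_def)
qed

lemma normal_modp_boundaries: "modp_boundaries p n T \<lhd> modp_cycle_group p n T"
proof -
  interpret comm_group "modp_cycle_group p n T" by (rule comm_group_modp_cycle_group)
  have "subgroup (modp_boundaries p n T) (modp_cycle_group p n T)"
  proof (rule subgroupI)
    show "modp_boundaries p n T \<subseteq> carrier (modp_cycle_group p n T)"
      by (simp add: carrier_modp_cycle_group modp_boundaries_subset_cycles)
    show "modp_boundaries p n T \<noteq> {}" using modp_boundaries_zero by blast
    fix c assume c: "c \<in> modp_boundaries p n T"
    then have "inv\<^bsub>modp_cycle_group p n T\<^esub> c = - c"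
      using modp_boundaries_subset_cycles[of p n T] modp_boundaries_uminus[OF c]
      by (intro inv_equality) (auto simp: carrier_modp_cycle_group)
    then show "inv\<^bsub>modp_cycle_group p n T\<^esub> c \<in> modp_boundaries p n T"
      using modp_boundaries_uminus[OF c] by simp
  qed (simp add: modp_boundaries_add)
  then show ?thesis by (rule subgroup_imp_normal)
qed

lemma group_modp_homology_group: "group (modp_homology_group p n T)"
  unfolding modp_homology_group_def by (rule normal.factorgroup_is_group[OF normal_modp_boundaries])

lemma modp_boundary_coset_eq_iff:
  "modp_boundaries p n T #>\<^bsub>chain_group n T\<^esub> c = modp_boundaries p n T #>\<^bsub>chain_group n T\<^esub> c' \<longleftrightarrow>
    c - c' \<in> modp_boundaries p n T"
proof
  assume eq: "modp_boundaries p n T #>\<^bsub>chain_group n T\<^esub> c = modp_boundaries p n T #>\<^bsub>chain_group n T\<^esub> c'"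
  have "c \<in> modp_boundaries p n T #>\<^bsub>chain_group n T\<^esub> c"
    unfolding r_coset_def using modp_boundaries_zero[of p n T] by force
  then obtain d where "d \<in> modp_boundaries p n T" "c = d + c'"
    unfolding eq unfolding r_coset_def by auto
  then show "c - c' \<in> modp_boundaries p n T" by simp
next
  assume B: "c - c' \<in> modp_boundaries p n T"
  have "d + c \<in> modp_boundaries p n T #>\<^bsub>chain_group n T\<^esub> c'" if "d \<in> modp_boundaries p n T" for d
    unfolding r_coset_def using modp_boundaries_add[OF that B]
    by (auto intro!: bexI[of _ "d + (c - c')"])
  moreover have "d + c' \<in> modp_boundaries p n T #>\<^bsub>chain_group n T\<^esub> c" if "d \<in> modp_boundaries p n T" for d
    unfolding r_coset_def using modp_boundaries_diff[OF that B]
    by (auto intro!: bexI[of _ "d - (c - c')"])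
  ultimately show "modp_boundaries p n T #>\<^bsub>chain_group n T\<^esub> c = modp_boundaries p n T #>\<^bsub>chain_group n T\<^esub> c'"
    unfolding r_coset_def by auto
qed

lemma r_coset_modp_cycle_group:
  "modp_boundaries p n T #>\<^bsub>modp_cycle_group p n T\<^esub> c = modp_boundaries p n T #>\<^bsub>chain_group n T\<^esub> c"
  by (simp add: r_coset_def)

lemma carrier_modp_homology_group:
  "carrier (modp_homology_group p n T) =
     (\<lambda>c. modp_boundaries p n T #>\<^bsub>chain_group n T\<^esub> c) ` modp_cycles p n T"
  by (auto simp: modp_homology_group_def FactGroup_def RCOSETS_def carrier_modp_cycle_group
      r_coset_modp_cycle_group)

lemma mult_modp_homology_group:
  assumes "c \<in> modp_cycles p n T" "c' \<in> modp_cycles p n T"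
  shows "(modp_boundaries p n T #>\<^bsub>chain_group n T\<^esub> c) \<otimes>\<^bsub>modp_homology_group p n T\<^esub>
      (modp_boundaries p n T #>\<^bsub>chain_group n T\<^esub> c') = modp_boundaries p n T #>\<^bsub>chain_group n T\<^esub> (c + c')"
  using normal.rcos_sum[OF normal_modp_boundaries, where x = c and y = c'] assms
  by (simp add: modp_homology_group_def carrier_modp_cycle_group r_coset_modp_cycle_group)

definition simplex_0 :: "'a \<Rightarrow> (nat \<Rightarrow> real) \<Rightarrow> 'a" where
  "simplex_0 v = (\<lambda>x\<in>standard_simplex 0. v)"

lemma singular_face_path_simplex:
  "singular_face 1 0 (path_simplex \<gamma>) = simplex_0 (pathfinish \<gamma>)"
  "singular_face 1 1 (path_simplex \<gamma>) = simplex_0 (pathstart \<gamma>)"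
proof -
  have f: "simplical_face k (\<lambda>j. if j = 0 then 1 else 0 :: real) \<in> standard_simplex 1" if "k \<le> 1" for k
    using that by (auto simp: simplical_face_def standard_simplex_def)
  from f[of 0] f[of 1] show "singular_face 1 0 (path_simplex \<gamma>) = simplex_0 (pathfinish \<gamma>)"
    "singular_face 1 1 (path_simplex \<gamma>) = simplex_0 (pathstart \<gamma>)"
    by (auto simp: singular_face_def path_simplex_def simplex_0_def standard_simplex_0 pathfinish_def
        pathstart_def simplical_face_def)
qed

lemma chain_boundary_path_simplex:
  "chain_boundary 1 (frag_of (path_simplex \<gamma>)) =
     frag_of (simplex_0 (pathfinish \<gamma>)) - frag_of (simplex_0 (pathstart \<gamma>))"
  using singular_face_path_simplex[of \<gamma>] by (simp add: chain_boundary_of)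

lemma based_loop_modp_cycle:
  assumes "\<gamma> \<in> based_loops S b"
  shows "frag_of (path_simplex \<gamma>) \<in> modp_cycles p 1 (top_of_set S)"
  using assms singular_chain_path_simplex[of \<gamma> S] chain_boundary_path_simplex[of \<gamma>]
  by (auto simp: modp_cycles_def based_loops_def intro!: exI[of _ 0])

lemma homology_class_loop_class:
  assumes "\<gamma> \<in> based_loops S b"
  shows "homology_class p S (loop_class S \<gamma>) =
    modp_boundaries p 1 (top_of_set S) #>\<^bsub>chain_group 1 (top_of_set S)\<^esub> frag_of (path_simplex \<gamma>)"
proof -
  have "modp_boundaries p 1 (top_of_set S) #>\<^bsub>chain_group 1 (top_of_set S)\<^esub> frag_of (path_simplex \<delta>) =
      modp_boundaries p 1 (top_of_set S) #>\<^bsub>chain_group 1 (top_of_set S)\<^esub> frag_of (path_simplex \<gamma>)"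
    if "\<delta> \<in> loop_class S \<gamma>" for \<delta>
    unfolding modp_boundary_coset_eq_iff
    using that by (intro homotopic_paths_mem_bdry) (simp add: loop_class_def homotopic_paths_sym)
  moreover have "\<gamma> \<in> loop_class S \<gamma>"
    using assms by (auto simp: based_loops_def mem_loop_class_self)
  ultimately show ?thesis unfolding homology_class_def by blast
qed

lemma homology_class_carrier:
  "x \<in> carrier (fundamental_group S b) \<Longrightarrow>
     homology_class p S x \<in> carrier (modp_homology_group p 1 (top_of_set S))"
  by (erule fundamental_group_cases)
    (simp only: homology_class_loop_class carrier_modp_homology_group based_loop_modp_cycle imageI)

lemma homology_class_mult:
  assumes "x \<in> carrier (fundamental_group S b)" "y \<in> carrier (fundamental_group S b)"
  shows "homology_class p S (x \<otimes>\<^bsub>fundamental_group S b\<^esub> y) =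
    homology_class p S x \<otimes>\<^bsub>modp_homology_group p 1 (top_of_set S)\<^esub> homology_class p S y"
proof -
  obtain \<gamma> where \<gamma>: "\<gamma> \<in> based_loops S b" "x = loop_class S \<gamma>" using assms(1) by (rule fundamental_group_cases)
  obtain \<delta> where \<delta>: "\<delta> \<in> based_loops S b" "y = loop_class S \<delta>" using assms(2) by (rule fundamental_group_cases)
  have "frag_of (path_simplex \<gamma>) + frag_of (path_simplex \<delta>) - frag_of (path_simplex (\<gamma> +++ \<delta>))
      \<in> modp_boundaries p 1 (top_of_set S)"
    using \<gamma> \<delta> by (intro join_mem_bdry) (auto simp: based_loops_def)
  then have "modp_boundaries p 1 (top_of_set S) #>\<^bsub>chain_group 1 (top_of_set S)\<^esub>
        (frag_of (path_simplex \<gamma>) + frag_of (path_simplex \<delta>)) =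
      modp_boundaries p 1 (top_of_set S) #>\<^bsub>chain_group 1 (top_of_set S)\<^esub> frag_of (path_simplex (\<gamma> +++ \<delta>))"
    unfolding modp_boundary_coset_eq_iff .
  then show ?thesis
    using \<gamma> \<delta> based_loops_join[OF \<gamma>(1) \<delta>(1)]
    by (simp only: mult_fundamental_group homology_class_loop_class mult_modp_homology_group based_loop_modp_cycle)
qed

text \<open>
  A path from the base point to every point.  With these paths, every path, and not only every loop,
  gives an element of the fundamental group.
\<close>

locale connected_by_paths =
  fixes S :: "'a::topological_space set" and b :: 'a and L :: "'a \<Rightarrow> real \<Rightarrow> 'a"
  assumes base: "b \<in> S"
    and L: "\<And>v. v \<in> S \<Longrightarrow> path (L v) \<and> path_image (L v) \<subseteq> S \<and> pathstart (L v) = b \<and> pathfinish (L v) = v"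
begin

sublocale pi: group "fundamental_group S b"
  by (rule group_fundamental_group[OF base])

definition lasso :: "(real \<Rightarrow> 'a) \<Rightarrow> real \<Rightarrow> 'a" where
  "lasso q = L (pathstart q) +++ (q +++ reversepath (L (pathfinish q)))"

lemma ends_mem: "path_image q \<subseteq> S \<Longrightarrow> pathstart q \<in> S \<and> pathfinish q \<in> S"
  by (meson pathfinish_in_path_image pathstart_in_path_image subsetD)

lemma lasso_based_loop: "path q \<Longrightarrow> path_image q \<subseteq> S \<Longrightarrow> lasso q \<in> based_loops S b"
  using L ends_mem[of q] by (simp add: lasso_def based_loops_def subset_path_image_join)

lemma lasso_homotopic:
  assumes "homotopic_paths S q r"
  shows "loop_class S (lasso q) = loop_class S (lasso r)"
proof -
  have q: "path q" "path_image q \<subseteq> S"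
    using homotopic_paths_imp_path[OF assms] homotopic_paths_imp_subset[OF assms] by auto
  have ends: "pathstart r = pathstart q" "pathfinish r = pathfinish q"
    using homotopic_paths_imp_pathstart[OF assms] homotopic_paths_imp_pathfinish[OF assms] by auto
  have "homotopic_paths S (lasso q) (lasso r)"
    unfolding lasso_def ends
    using L ends_mem[OF q(2)] q assms
    by (intro homotopic_paths_join) auto
  then show ?thesis by (rule loop_class_eqI)
qed

text \<open>
  The way back to the base point at the end of the first lasso cancels against the way out at the
  start of the second one.
\<close>

lemma lasso_join:
  assumes q: "path q" "path_image q \<subseteq> S" and r: "path r" "path_image r \<subseteq> S"
    and qr: "pathfinish q = pathstart r"
  shows "loop_class S (lasso (q +++ r)) =
    loop_class S (lasso q) \<otimes>\<^bsub>fundamental_group S b\<^esub> loop_class S (lasso r)"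
proof -
  define v where "v = pathstart r"
  define A where "A = L (pathstart q)"
  define B where "B = L v"
  define C where "C = reversepath (L (pathfinish r))"
  have A: "path A" "path_image A \<subseteq> S" "pathfinish A = pathstart q"
    and B: "path B" "path_image B \<subseteq> S" "pathfinish B = v" "pathstart B = b"
    and C: "path C" "path_image C \<subseteq> S" "pathstart C = pathfinish r"
    using L ends_mem[OF q(2)] ends_mem[OF r(2)] by (auto simp: A_def B_def C_def v_def)
  define t where "t = r +++ C"
  have t: "path t" "path_image t \<subseteq> S" "pathstart t = v"
    using r C by (auto simp: t_def v_def subset_path_image_join)
  note [simp] = A B C q t qr v_def[symmetric] subset_path_image_join
  have "homotopic_paths S (reversepath B +++ (B +++ t)) ((reversepath B +++ B) +++ t)"
    by (rule homotopic_paths_assoc) auto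
  also have "homotopic_paths S \<dots> ((\<lambda>_. v) +++ t)"
    using homotopic_paths_reversepath_join[OF B(1,2)] by (intro homotopic_paths_join) auto
  also have "homotopic_paths S \<dots> t" using homotopic_paths_const_join[OF t(1,2)] by simp
  finally have Bt: "homotopic_paths S (reversepath B +++ (B +++ t)) t" .
  have "homotopic_paths S ((A +++ (q +++ reversepath B)) +++ (B +++ t))
      (A +++ ((q +++ reversepath B) +++ (B +++ t)))"
    by (rule homotopic_paths_sym, rule homotopic_paths_assoc) auto
  also have "homotopic_paths S \<dots> (A +++ (q +++ (reversepath B +++ (B +++ t))))"
    by (intro homotopic_paths_join homotopic_paths_sym[OF homotopic_paths_assoc]) auto
  also have "homotopic_paths S \<dots> (A +++ (q +++ t))"
    using Bt by (intro homotopic_paths_join) auto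
  also have "homotopic_paths S \<dots> (A +++ ((q +++ r) +++ C))"
    unfolding t_def using r by (intro homotopic_paths_join homotopic_paths_assoc) auto
  finally have "homotopic_paths S (lasso q +++ lasso r) (lasso (q +++ r))"
    by (simp add: lasso_def A_def[symmetric] B_def[symmetric] C_def[symmetric] t_def[symmetric])
  from loop_class_eqI[OF this] show ?thesis
    using q r by (simp add: mult_fundamental_group lasso_based_loop)
qed

lemma simplex_path_face:
  assumes "0 \<le> t" "t \<le> 1"
  shows "simplex_path (singular_face 2 k \<tau>) t =
    \<tau> (simplical_face k (\<lambda>i. if i = 0 then 1 - t else if i = 1 then t else 0))"
  using edge_point_mem[OF assms] by (simp add: simplex_path_def singular_face_def)

text \<open>
  A singular triangle is a continuous image of the convex triangle \<open>C\<close> in the plane.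
\<close>

lemma triangle_boundary_homotopic:
  fixes \<tau> :: "(nat \<Rightarrow> real) \<Rightarrow> 'a"
  assumes \<tau>: "singular_simplex 2 (top_of_set S) \<tau>"
  shows "homotopic_paths S (simplex_path (singular_face 2 2 \<tau>) +++ simplex_path (singular_face 2 0 \<tau>))
     (simplex_path (singular_face 2 1 \<tau>))"
    and "pathfinish (simplex_path (singular_face 2 2 \<tau>)) = pathstart (simplex_path (singular_face 2 0 \<tau>))"
proof -
  define P where "P = (\<lambda>(s, t) (i::nat). if i = 0 then 1 - s - t else if i = 1 then s else if i = 2 then t else (0::real))"
  define C where "C = {(s, t). 0 \<le> s \<and> 0 \<le> t \<and> s + t \<le> (1::real)}"
  define F where "F = (\<lambda>z. \<tau> (P z))"
  have C: "convex C"
  proof -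
    have "C = {z. inner (-1, 0) z \<le> 0} \<inter> {z. inner (0, -1) z \<le> 0} \<inter> {z. inner (1, 1) z \<le> 1}"
      by (auto simp: C_def)
    then show ?thesis by (simp add: convex_Int convex_halfspace_le)
  qed
  have PC: "P z \<in> standard_simplex 2" if "z \<in> C" for z
    using that by (auto simp: P_def C_def standard_simplex_def numeral_2_eq_2 split: prod.splits)
  have "continuous_on C P"
  proof (rule continuous_on_coordinatewise_then_product)
    fix i :: nat
    consider "i = 0" | "i = 1" | "i = 2" | "i > 2" by linarith
    then show "continuous_on C (\<lambda>z. P z i)"
      by cases (auto simp: P_def case_prod_beta intro!: continuous_intros)
  qed
  moreover have c: "continuous_on (standard_simplex 2) \<tau>" "\<tau> \<in> standard_simplex 2 \<rightarrow> S"
    using \<tau> by (auto simp: singular_simplex_top_of_set)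
  moreover have "P ` C \<subseteq> standard_simplex 2" using PC by blast
  ultimately have "continuous_on C F" unfolding F_def by (intro continuous_on_compose2[OF c(1)])
  moreover have "F \<in> C \<rightarrow> S" using PC c(2) by (simp add: F_def Pi_iff)
  ultimately have F: "continuous_on C F" "F \<in> C \<rightarrow> S" by auto
  have sub: "path_image (linepath a c) \<subseteq> C" if "a \<in> C" "c \<in> C" for a c
    using that C by (simp add: closed_segment_subset)
  have mem: "(0,0) \<in> C" "(1,0) \<in> C" "(0,1) \<in> C" by (auto simp: C_def)
  have hom: "homotopic_paths S (F \<circ> (linepath (0,0) (1,0) +++ linepath (1,0) (0,1))) (F \<circ> linepath (0,0) (0,1))"
    using mem sub by (intro homotopic_paths_convex_image[OF C F]) (auto simp: subset_path_image_join)
  have edge: "homotopic_paths S (simplex_path (singular_face 2 k \<tau>)) (F \<circ> linepath a c)"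
    if "a \<in> C" "c \<in> C" "k \<le> 2"
      and eq: "\<And>t. 0 \<le> t \<Longrightarrow> t \<le> 1 \<Longrightarrow>
        simplical_face k (\<lambda>i. if i = 0 then 1 - t else if i = 1 then t else 0) = P (linepath a c t)" for a c k
  proof (rule homotopic_paths_sym, rule homotopic_paths_eq)
    show "path (F \<circ> linepath a c)"
      using sub[OF that(1,2)] F by (intro path_continuous_image) (auto intro: continuous_on_subset)
    show "path_image (F \<circ> linepath a c) \<subseteq> S"
      using sub[OF that(1,2)] F unfolding path_image_compose by blast
    fix t :: real assume "t \<in> {0..1}"
    then show "(F \<circ> linepath a c) t = simplex_path (singular_face 2 k \<tau>) t"
      using eq[of t] by (simp add: simplex_path_face F_def)
  qed
  have e2: "homotopic_paths S (simplex_path (singular_face 2 2 \<tau>)) (F \<circ> linepath (0,0) (1,0))"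
    using mem by (intro edge) (auto simp: simplical_face_def P_def linepath_def fun_eq_iff)
  have e0: "homotopic_paths S (simplex_path (singular_face 2 0 \<tau>)) (F \<circ> linepath (1,0) (0,1))"
    using mem by (intro edge) (auto simp: simplical_face_def P_def linepath_def fun_eq_iff)
  have e1: "homotopic_paths S (simplex_path (singular_face 2 1 \<tau>)) (F \<circ> linepath (0,0) (0,1))"
    using mem by (intro edge) (auto simp: simplical_face_def P_def linepath_def fun_eq_iff)
  show fs: "pathfinish (simplex_path (singular_face 2 2 \<tau>)) = pathstart (simplex_path (singular_face 2 0 \<tau>))"
    using homotopic_paths_imp_pathfinish[OF e2] homotopic_paths_imp_pathstart[OF e0]
    by (simp add: pathfinish_compose pathstart_compose)
  have "homotopic_paths S (simplex_path (singular_face 2 2 \<tau>) +++ simplex_path (singular_face 2 0 \<tau>))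
      ((F \<circ> linepath (0,0) (1,0)) +++ (F \<circ> linepath (1,0) (0,1)))"
    using e2 e0 fs by (rule homotopic_paths_join)
  also have "homotopic_paths S \<dots> (F \<circ> linepath (0,0) (0,1))"
    using hom by (simp add: path_compose_join)
  also have "homotopic_paths S \<dots> (simplex_path (singular_face 2 1 \<tau>))"
    using e1 by (rule homotopic_paths_sym)
  finally show "homotopic_paths S (simplex_path (singular_face 2 2 \<tau>) +++ simplex_path (singular_face 2 0 \<tau>))
     (simplex_path (singular_face 2 1 \<tau>))" .
qed

lemma inv_loop_class:
  assumes "\<gamma> \<in> based_loops S b"
  shows "inv\<^bsub>fundamental_group S b\<^esub> loop_class S \<gamma> = loop_class S (reversepath \<gamma>)"
proof (rule pi.inv_equality)
  show "loop_class S (reversepath \<gamma>) \<otimes>\<^bsub>fundamental_group S b\<^esub> loop_class S \<gamma> = \<one>\<^bsub>fundamental_group S b\<^esub>"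
    using assms loop_class_eqI[OF homotopic_paths_reversepath_join[of \<gamma> S]]
    by (simp add: mult_fundamental_group based_loops_reversepath one_fundamental_group)
      (simp add: based_loops_def)
qed (use assms in \<open>auto intro: loop_class_carrier based_loops_reversepath\<close>)

text \<open>
  The kernel part of the Hurewicz theorem, for homomorphisms to abelian groups of exponent \<open>p\<close>.
  Closing up singular 1-simplices with the chosen paths extends \<open>u\<close> to all 1-chains.  The extension
  \<open>h\<close> kills boundaries of triangles because these are null-homotopic, and multiples of \<open>p\<close> by the
  exponent; on a loop it agrees with \<open>u\<close>, because conjugation is invisible in an abelian group.
\<close>

lemma hom_eq_of_homology_class_eq:
  assumes A: "comm_group A" and exponent: "\<And>a. a \<in> carrier A \<Longrightarrow> a [^]\<^bsub>A\<^esub> p = \<one>\<^bsub>A\<^esub>"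
    and u: "u \<in> hom (fundamental_group S b) A"
    and x: "x \<in> carrier (fundamental_group S b)" and y: "y \<in> carrier (fundamental_group S b)"
    and eq: "homology_class p S x = homology_class p S y"
  shows "u x = u y"
proof -
  let ?T = "top_of_set S" and ?G = "fundamental_group S b"
  interpret A: comm_group A by fact
  interpret u: group_hom ?G A u using u by unfold_locales
  define \<theta> where "\<theta> = (\<lambda>q. u (loop_class S (lasso q)))"
  have \<theta>_carrier: "\<theta> q \<in> carrier A" if "path q" "path_image q \<subseteq> S" for q
    using that by (simp add: \<theta>_def lasso_based_loop loop_class_carrier)
  have "(\<lambda>\<sigma>. \<theta> (simplex_path \<sigma>)) ` singular_simplex_set 1 ?T \<subseteq> carrier A"
    using path_simplex_path \<theta>_carrier by blast
  then obtain h where h: "h \<in> hom (chain_group 1 ?T) A"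
    and h_of: "\<And>\<sigma>. singular_simplex 1 ?T \<sigma> \<Longrightarrow> h (frag_of \<sigma>) = \<theta> (simplex_path \<sigma>)"
    unfolding chain_group_def by (rule A.free_Abelian_group_universal) auto
  interpret h: group_hom "chain_group 1 ?T" A h
    using h by (simp add: group_hom_def group_hom_axioms_def A.is_group)
  have h_add: "h (c + d) = h c \<otimes>\<^bsub>A\<^esub> h d" if "singular_chain 1 ?T c" "singular_chain 1 ?T d" for c d
    using h.hom_mult[of c d] that by simp
  have h_minus: "h (- c) = inv\<^bsub>A\<^esub> h c" if "singular_chain 1 ?T c" for c
    using h.hom_inv[of c] that by (simp add: singular_chain_def)
  have h_diff: "h (c - d) = h c \<otimes>\<^bsub>A\<^esub> inv\<^bsub>A\<^esub> h d" if "singular_chain 1 ?T c" "singular_chain 1 ?T d" for c d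
    using h_add[of c "- d"] h_minus[of d] that by (simp add: singular_chain_minus)
  have h_0: "h 0 = \<one>\<^bsub>A\<^esub>" using h.hom_one by simp
  have h_carrier: "h c \<in> carrier A" if "singular_chain 1 ?T c" for c
    using h.hom_closed[of c] that by simp
  have boundary: "h (chain_boundary 2 d) = \<one>\<^bsub>A\<^esub>" if "singular_chain 2 ?T d" for d
  proof -
    have "Poly_Mapping.keys d \<subseteq> singular_simplex_set 2 ?T" using that by (simp add: singular_chain_def)
    then show ?thesis
    proof (induction d rule: free_Abelian_group_induct [consumes 1, case_names zero diff single])
      case zero
      then show ?case by (simp add: h_0)
    next
      case (diff c d)
      have "singular_chain 1 ?T (chain_boundary 2 c)" "singular_chain 1 ?T (chain_boundary 2 d)"
        using diff(1,2) singular_chain_boundary[of 2 ?T] by (simp_all add: singular_chain_def)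
      with diff show ?case by (simp add: chain_boundary_diff h_diff)
    next
      case (single \<tau>)
      then have \<tau>: "singular_simplex 2 ?T \<tau>" by simp
      define f where "f k = singular_face 2 k \<tau>" for k
      have f: "singular_simplex 1 ?T (f k)" if "k \<le> 2" for k
        using singular_simplex_singular_face[OF \<tau>, of k] that by (simp add: f_def)
      have fp: "path (simplex_path (f k))" "path_image (simplex_path (f k)) \<subseteq> S" if "k \<le> 2" for k
        using path_simplex_path[OF f[OF that]] by auto
      have fc: "singular_chain 1 ?T (frag_of (f k))" if "k \<le> 2" for k
        using f[OF that] by (simp add: singular_chain_of)
      have bd: "chain_boundary 2 (frag_of \<tau>) = frag_of (f 2) + frag_of (f 0) - frag_of (f 1)"
        by (simp add: chain_boundary_of numeral_2_eq_2 f_def)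
      have "\<theta> (simplex_path (f 1)) = \<theta> (simplex_path (f 2) +++ simplex_path (f 0))"
        unfolding \<theta>_def using lasso_homotopic[OF triangle_boundary_homotopic(1)[OF \<tau>]] by (simp add: f_def)
      also have "\<dots> = \<theta> (simplex_path (f 2)) \<otimes>\<^bsub>A\<^esub> \<theta> (simplex_path (f 0))"
        unfolding \<theta>_def
        using lasso_join[OF fp(1,2)[of 2] fp(1,2)[of 0]] triangle_boundary_homotopic(2)[OF \<tau>] fp
        by (simp add: f_def[symmetric] lasso_based_loop loop_class_carrier)
      finally show ?case
        using fc f \<theta>_carrier[OF fp]
        by (simp add: bd h_diff h_add singular_chain_add h_of)
    qed
  qed
  have vanish: "h c = \<one>\<^bsub>A\<^esub>" if cB: "c \<in> modp_boundaries p 1 ?T" for c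
  proof -
    obtain d e where c: "c = chain_boundary 2 d + frag_cmul (int p) e"
      "singular_chain 2 ?T d" "singular_chain 1 ?T e"
      using cB by (auto simp: modp_boundaries_def numeral_2_eq_2)
    have "frag_cmul (int p) e = e [^]\<^bsub>chain_group 1 ?T\<^esub> p" by (simp add: chain_group_def)
    then have "h (frag_cmul (int p) e) = h e [^]\<^bsub>A\<^esub> p" using h.hom_nat_pow[of e p] c(3) by simp
    then have "h (frag_cmul (int p) e) = \<one>\<^bsub>A\<^esub>" using exponent h_carrier[OF c(3)] by simp
    moreover have "singular_chain 1 ?T (chain_boundary 2 d)"
      using singular_chain_boundary[OF c(2)] by simp
    ultimately show ?thesis
      using c boundary[OF c(2)] by (simp add: h_add singular_chain_cmul)
  qed
  have h_loop: "h (frag_of (path_simplex \<gamma>)) = u (loop_class S \<gamma>)" if \<gamma>: "\<gamma> \<in> based_loops S b" for \<gamma>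
  proof -
    have p: "path \<gamma>" "path_image \<gamma> \<subseteq> S" "pathstart \<gamma> = b" "pathfinish \<gamma> = b"
      using \<gamma> by (auto simp: based_loops_def)
    have "homotopic_paths S \<gamma> (simplex_path (path_simplex \<gamma>))"
      using p by (intro homotopic_paths_eq) (auto simp: simplex_path_path_simplex)
    then have "h (frag_of (path_simplex \<gamma>)) = \<theta> \<gamma>"
      using h_of[OF singular_simplex_path_simplex[OF p(1,2)]] lasso_homotopic by (simp add: \<theta>_def)
    moreover have l: "L b \<in> based_loops S b" using L[OF base] by (simp add: based_loops_def)
    then have "loop_class S (lasso \<gamma>) = loop_class S (L b) \<otimes>\<^bsub>?G\<^esub> (loop_class S \<gamma> \<otimes>\<^bsub>?G\<^esub> inv\<^bsub>?G\<^esub> loop_class S (L b))"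
      using \<gamma> p
      by (simp add: lasso_def inv_loop_class mult_fundamental_group based_loops_join based_loops_reversepath)
    ultimately show ?thesis
      using loop_class_carrier[OF l] loop_class_carrier[OF \<gamma>]
        A.m_lcomm[of "u (loop_class S (L b))" "u (loop_class S \<gamma>)" "inv\<^bsub>A\<^esub> u (loop_class S (L b))"]
      by (simp add: \<theta>_def)
  qed
  obtain \<gamma> where \<gamma>: "\<gamma> \<in> based_loops S b" "x = loop_class S \<gamma>" using x by (rule fundamental_group_cases)
  obtain \<delta> where \<delta>: "\<delta> \<in> based_loops S b" "y = loop_class S \<delta>" using y by (rule fundamental_group_cases)
  have sc: "singular_chain 1 ?T (frag_of (path_simplex \<epsilon>))" if "\<epsilon> \<in> based_loops S b" for \<epsilon>
    using that singular_chain_path_simplex by (auto simp: based_loops_def)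
  have "frag_of (path_simplex \<gamma>) - frag_of (path_simplex \<delta>) \<in> modp_boundaries p 1 ?T"
    using eq \<gamma> \<delta> by (simp only: homology_class_loop_class modp_boundary_coset_eq_iff)
  from vanish[OF this] have "u x \<otimes>\<^bsub>A\<^esub> inv\<^bsub>A\<^esub> u y = \<one>\<^bsub>A\<^esub>"
    using \<gamma> \<delta> sc by (simp add: h_diff h_loop)
  then show ?thesis using x y by (metis A.inv_closed A.inv_equality A.inv_inv u.hom_closed)
qed

text \<open>
  The surjectivity part of the Hurewicz theorem.  Let \<open>\<Lambda>\<close> send a point to its chosen path.  Then
  \<open>d - \<Lambda> (\<partial> d)\<close> is homologous to a loop for every 1-chain \<open>d\<close>, and for a cycle mod \<open>p\<close> the
  correction \<open>\<Lambda> (\<partial> d)\<close> is a multiple of \<open>p\<close>.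
\<close>

lemma homology_class_surj:
  assumes c: "c \<in> carrier (modp_homology_group p 1 (top_of_set S))"
  obtains x where "x \<in> carrier (fundamental_group S b)" "homology_class p S x = c"
proof -
  let ?T = "top_of_set S" and ?B = "modp_boundaries p 1 (top_of_set S)"
  obtain z where z: "z \<in> modp_cycles p 1 ?T" "c = ?B #>\<^bsub>chain_group 1 ?T\<^esub> z"
    using c by (auto simp: carrier_modp_homology_group)
  define \<Lambda> where "\<Lambda> = frag_extend (\<lambda>f. frag_of (path_simplex (L (f (\<lambda>j::nat. if j = 0 then 1 else (0::real))))))"
  have \<Lambda>_of: "\<Lambda> (frag_of (simplex_0 v)) = frag_of (path_simplex (L v))" for v
    by (simp add: \<Lambda>_def simplex_0_def)
  have \<Lambda>_diff: "\<Lambda> (d - e) = \<Lambda> d - \<Lambda> e" for d e by (simp add: \<Lambda>_def frag_extend_diff)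
  have bd_add: "d + e \<in> ?B" if "d \<in> ?B" "e \<in> ?B" for d e using modp_boundaries_add that .
  have rev: "frag_of (path_simplex q) + frag_of (path_simplex (reversepath q)) \<in> ?B"
    if q: "path q" "path_image q \<subseteq> S" for q
  proof -
    have 1: "frag_of (path_simplex q) + frag_of (path_simplex (reversepath q))
        - frag_of (path_simplex (q +++ reversepath q)) \<in> ?B"
      using q by (intro join_mem_bdry) auto
    have 2: "frag_of (path_simplex (q +++ reversepath q)) - frag_of (path_simplex (\<lambda>_. pathstart q)) \<in> ?B"
      by (rule homotopic_paths_mem_bdry[OF homotopic_paths_join_reversepath[OF q]])
    have 3: "frag_of (path_simplex (\<lambda>_. pathstart q)) \<in> ?B"
      using ends_mem[OF q(2)] by (intro const_mem_bdry) simp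
    from bd_add[OF bd_add[OF 1 2] 3] show ?thesis by simp
  qed
  have "\<exists>\<gamma>\<in>based_loops S b. d - \<Lambda> (chain_boundary 1 d) - frag_of (path_simplex \<gamma>) \<in> ?B"
    if "singular_chain 1 ?T d" for d
  proof -
    have "Poly_Mapping.keys d \<subseteq> singular_simplex_set 1 ?T" using that by (simp add: singular_chain_def)
    then show ?thesis
    proof (induction d rule: free_Abelian_group_induct [consumes 1, case_names zero diff single])
      case zero
      have "- frag_of (path_simplex (\<lambda>_. b)) \<in> ?B"
        by (rule modp_boundaries_uminus[OF const_mem_bdry[OF base]])
      then show ?case
        by (intro bexI[OF _ based_loops_const[OF base]]) (simp add: \<Lambda>_def)
    next
      case (diff d e)
      then obtain \<gamma> \<delta> where \<gamma>: "\<gamma> \<in> based_loops S b" "d - \<Lambda> (chain_boundary 1 d) - frag_of (path_simplex \<gamma>) \<in> ?B"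
        and \<delta>: "\<delta> \<in> based_loops S b" "e - \<Lambda> (chain_boundary 1 e) - frag_of (path_simplex \<delta>) \<in> ?B" by blast
      have 1: "frag_of (path_simplex \<gamma>) + frag_of (path_simplex (reversepath \<delta>))
          - frag_of (path_simplex (\<gamma> +++ reversepath \<delta>)) \<in> ?B"
        using \<gamma>(1) \<delta>(1) by (intro join_mem_bdry) (auto simp: based_loops_def)
      have 2: "frag_of (path_simplex \<delta>) + frag_of (path_simplex (reversepath \<delta>)) \<in> ?B"
        using \<delta>(1) by (intro rev) (auto simp: based_loops_def)
      have "frag_of (path_simplex \<gamma>) - frag_of (path_simplex \<delta>)
          - frag_of (path_simplex (\<gamma> +++ reversepath \<delta>)) \<in> ?B"
        using modp_boundaries_diff[OF 1 2] by (simp add: algebra_simps)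
      from bd_add[OF modp_boundaries_diff[OF \<gamma>(2) \<delta>(2)] this]
      have "d - e - \<Lambda> (chain_boundary 1 (d - e)) - frag_of (path_simplex (\<gamma> +++ reversepath \<delta>)) \<in> ?B"
        by (simp add: chain_boundary_diff \<Lambda>_diff algebra_simps)
      then show ?case
        using based_loops_join[OF \<gamma>(1) based_loops_reversepath[OF \<delta>(1)]] by blast
    next
      case (single \<sigma>)
      then have \<sigma>: "singular_simplex 1 ?T \<sigma>" by simp
      define q where "q = simplex_path \<sigma>"
      have q: "path q" "path_image q \<subseteq> S" using path_simplex_path[OF \<sigma>] by (auto simp: q_def)
      have \<sigma>q: "\<sigma> = path_simplex q"
        using path_simplex_simplex_path[of \<sigma>] \<sigma> by (simp add: q_def singular_simplex_def)
      define M where "M = L (pathstart q)"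
      define N where "N = L (pathfinish q)"
      have M: "path M" "path_image M \<subseteq> S" "pathfinish M = pathstart q"
        and N: "path N" "path_image N \<subseteq> S" "pathfinish N = pathfinish q"
        using L ends_mem[OF q(2)] by (auto simp: M_def N_def)
      have lasso: "lasso q = M +++ (q +++ reversepath N)" by (simp add: lasso_def M_def N_def)
      have 1: "frag_of (path_simplex q) + frag_of (path_simplex (reversepath N))
          - frag_of (path_simplex (q +++ reversepath N)) \<in> ?B"
        using q N by (intro join_mem_bdry) auto
      have 2: "frag_of (path_simplex M) + frag_of (path_simplex (q +++ reversepath N))
          - frag_of (path_simplex (lasso q)) \<in> ?B"
        unfolding lasso using q M N by (intro join_mem_bdry) (auto simp: subset_path_image_join)
      have 3: "frag_of (path_simplex N) + frag_of (path_simplex (reversepath N)) \<in> ?B"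
        by (rule rev[OF N(1,2)])
      have "frag_of \<sigma> - \<Lambda> (chain_boundary 1 (frag_of \<sigma>)) - frag_of (path_simplex (lasso q)) \<in> ?B"
        using modp_boundaries_diff[OF bd_add[OF 1 2] 3]
        by (simp add: \<sigma>q chain_boundary_path_simplex \<Lambda>_diff \<Lambda>_of M_def N_def algebra_simps
            del: One_nat_def)
      then show ?case using lasso_based_loop[OF q] by blast
    qed
  qed
  moreover have "singular_chain 1 ?T z" using z by (simp add: modp_cycles_def)
  ultimately obtain \<gamma> where \<gamma>: "\<gamma> \<in> based_loops S b"
    "z - \<Lambda> (chain_boundary 1 z) - frag_of (path_simplex \<gamma>) \<in> ?B" by blast
  obtain e where e: "singular_chain 0 ?T e" "chain_boundary 1 z = frag_cmul (int p) e"
    using z by (auto simp: modp_cycles_def)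
  have "singular_chain 1 ?T (\<Lambda> e)"
  proof -
    have "f (\<lambda>j. if j = 0 then 1 else 0) \<in> S" if "f \<in> Poly_Mapping.keys e" for f
      using that e(1) by (auto simp: singular_chain_def singular_simplex_top_of_set standard_simplex_0)
    then show ?thesis
      unfolding \<Lambda>_def using L by (intro singular_chain_extend singular_chain_path_simplex) auto
  qed
  then have "frag_cmul (int p) (\<Lambda> e) \<in> ?B" by (rule modp_boundaries_cmul)
  then have "\<Lambda> (chain_boundary 1 z) \<in> ?B"
    unfolding e(2) by (simp add: \<Lambda>_def frag_extend_cmul)
  from bd_add[OF \<gamma>(2) this] have "z - frag_of (path_simplex \<gamma>) \<in> ?B" by simp
  then have "homology_class p S (loop_class S \<gamma>) = c"
    unfolding z(2) homology_class_loop_class[OF \<gamma>(1)] by (simp only: modp_boundary_coset_eq_iff[symmetric])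
  with that loop_class_carrier[OF \<gamma>(1)] show ?thesis by blast
qed

end

section \<open>Connected surfaces\<close>

text \<open>
  Every point has a path-connected neighbourhood: in a local chart, the intersection of a small disc
  with the half plane, which is convex.
\<close>

lemma path_connected_connected_surface:
  fixes S :: "'a::topological_space set"
  assumes S: "surface_with_boundary S" and conn: "connected S"
  shows "path_connected S"
  unfolding path_connected_component
proof (intro ballI)
  fix a b assume ab: "a \<in> S" "b \<in> S"
  show "path_component S a b"
  proof (rule connected_equivalence_relation[OF conn ab])
    fix x assume x: "x \<in> S"
    then obtain U V where U: "openin (top_of_set S) U" "x \<in> U"
      and V: "openin (top_of_set {z::complex. 0 \<le> Im z}) V" and UV: "U homeomorphic V"
      using S unfolding surface_with_boundary_def by meson
    then obtain f g where fg: "homeomorphism U V f g" by (auto simp: homeomorphic_def)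
    have fx: "f x \<in> V" using fg U by (auto simp: homeomorphism_def)
    obtain e where e: "e > 0" "ball (f x) e \<inter> {z. 0 \<le> Im z} \<subseteq> V"
      using V fx unfolding openin_contains_ball by blast
    let ?W = "ball (f x) e \<inter> {z::complex. 0 \<le> Im z}"
    have "convex ?W" by (intro convex_Int convex_ball convex_halfspace_Im_ge)
    then have W: "path_connected ?W" by (rule convex_imp_path_connected)
    have "openin (top_of_set {z. 0 \<le> Im z}) ?W"
      using openin_open_Int[of "ball (f x) e" "{z. 0 \<le> Im z}"] by (simp add: Int_commute)
    then have "openin (top_of_set V) ?W"
      using e V openin_imp_subset by (blast intro: openin_subset_trans)
    then have "openin (top_of_set U) (g ` ?W)"
      using homeomorphism_imp_open_map[of V U g f] homeomorphism_symD[OF fg] by blast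
    then have gW: "openin (top_of_set S) (g ` ?W)" using U(1) by (rule openin_trans)
    have "continuous_on ?W g" using fg e by (auto simp: homeomorphism_def intro: continuous_on_subset)
    then have pg: "path_connected (g ` ?W)" using W by (rule path_connected_continuous_image)
    have fx': "f x \<in> ?W" using fx V e openin_imp_subset by fastforce
    then have xW: "x \<in> g ` ?W" using fg U(2) by (force simp: homeomorphism_def)
    have "path_component S x y" if "y \<in> g ` ?W" for y
      using pg xW that openin_imp_subset[OF gW]
      by (meson path_component_of_subset path_connected_component)
    with gW xW show "\<exists>T. openin (top_of_set S) T \<and> x \<in> T \<and> (\<forall>y\<in>T. path_component S x y)" by blast
  qed (auto intro: path_component_sym path_component_trans)
qed

section \<open>The mapping class group\<close>

lemma homeomorphism_interior_mem:
  assumes f: "homeomorphism S S f g" and x: "x \<in> surface_interior S"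
  shows "f x \<in> surface_interior S"
proof -
  obtain U and V :: "complex set" where UV: "openin (top_of_set S) U" "x \<in> U" "open V" "U homeomorphic V" and xS: "x \<in> S"
    using x unfolding surface_interior_def by blast
  have US: "U \<subseteq> S" using UV(1) by (rule openin_imp_subset)
  have "openin (top_of_set S) (f ` U)" using homeomorphism_imp_open_map[OF f UV(1)] .
  moreover have "homeomorphism U (f ` U) f g"
    using homeomorphism_of_subsets[OF f US] f US by (auto simp: homeomorphism_def)
  then have "f ` U homeomorphic V"
    using UV(4) homeomorphic_def homeomorphic_sym homeomorphic_trans by metis
  moreover have "f x \<in> S" using f xS by (auto simp: homeomorphism_def)
  ultimately show ?thesis using UV by (auto simp: surface_interior_def)
qed

lemma surface_boundary_subset: "surface_boundary S \<subseteq> S"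
  by (auto simp: surface_boundary_def)

lemma boundary_homeosE:
  assumes "f \<in> boundary_homeos S"
  obtains h where "homeomorphism S S f h"
  using assms by (auto simp: boundary_homeos_def)

lemma boundary_homeos_Bij: "f \<in> boundary_homeos S \<Longrightarrow> f \<in> Bij S"
  by (simp add: boundary_homeos_def)

lemma boundary_homeos_continuous:
  "f \<in> boundary_homeos S \<Longrightarrow> continuous_map (top_of_set S) (top_of_set S) f"
  by (auto simp: boundary_homeos_def homeomorphism_def)

lemma boundary_homeos_mem: "f \<in> boundary_homeos S \<Longrightarrow> x \<in> S \<Longrightarrow> f x \<in> S"
  using boundary_homeos_continuous[of f S] by (auto simp: continuous_map_def)

lemma boundary_homeos_id: "(\<lambda>x\<in>S. x) \<in> boundary_homeos S"
proof -
  have "homeomorphism S S (\<lambda>x\<in>S. x) id"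
    by (rule homeomorphism_cong[of S S id id]) (auto simp: homeomorphism_def)
  then show ?thesis
    using surface_boundary_subset[of S] by (auto simp: boundary_homeos_def id_Bij)
qed

lemma boundary_homeos_compose:
  assumes "f \<in> boundary_homeos S" "g \<in> boundary_homeos S"
  shows "compose S f g \<in> boundary_homeos S"
proof -
  obtain h k where "homeomorphism S S f h" "homeomorphism S S g k"
    using assms by (auto elim!: boundary_homeosE)
  then have "homeomorphism S S (f \<circ> g) (k \<circ> h)" by (rule homeomorphism_compose[rotated])
  then have "homeomorphism S S (compose S f g) (k \<circ> h)"
    by (rule homeomorphism_cong) (auto simp: compose_def)
  moreover have "compose S f g \<in> Bij S"
    using assms by (intro compose_Bij boundary_homeos_Bij)
  moreover have "compose S f g x = x" if "x \<in> surface_boundary S" for x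
    using assms that surface_boundary_subset[of S] by (auto simp: boundary_homeos_def compose_def)
  ultimately show ?thesis by (auto simp: boundary_homeos_def)
qed

lemma boundary_homeos_inverse:
  assumes "f \<in> boundary_homeos S"
  shows "(\<lambda>x\<in>S. inv_into S f x) \<in> boundary_homeos S"
proof -
  obtain h where h: "homeomorphism S S f h" using assms by (rule boundary_homeosE)
  have B: "f \<in> Bij S" using assms by (rule boundary_homeos_Bij)
  have inj: "inj_on f S" using B by (auto simp: Bij_def bij_betw_def)
  have eq: "inv_into S f x = h x" if "x \<in> S" for x
    using h that inj by (metis homeomorphism_def imageI inv_into_f_eq)
  have "homeomorphism S S h f" using h by (rule homeomorphism_symD)
  then have "homeomorphism S S (\<lambda>x\<in>S. inv_into S f x) f"
    by (rule homeomorphism_cong) (auto simp: eq)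
  moreover have "inv_into S f x = x" if "x \<in> surface_boundary S" for x
    using that assms inj surface_boundary_subset[of S]
    by (intro inv_into_f_eq) (auto simp: boundary_homeos_def)
  ultimately show ?thesis
    using surface_boundary_subset[of S] restrict_inv_into_Bij[OF B]
    by (auto simp: boundary_homeos_def)
qed

lemma boundary_homeos_minus_point:
  assumes "f \<in> boundary_homeos S" "x \<in> S"
  shows "f \<in> (S - {x}) \<rightarrow> (S - {f x})"
  using boundary_homeos_Bij[OF assms(1)] assms boundary_homeos_mem[OF assms(1)]
  by (auto simp: Bij_def bij_betw_def inj_on_def)

lemma boundary_homeos_interior:
  "f \<in> boundary_homeos S \<Longrightarrow> x \<in> surface_interior S \<Longrightarrow> f x \<in> surface_interior S"
  by (elim boundary_homeosE) (rule homeomorphism_interior_mem)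

lemma surface_interior_mem: "x \<in> surface_interior S \<Longrightarrow> x \<in> S"
  by (simp add: surface_interior_def)

lemma orientation_mem:
  "surface_orientation S \<mu> \<Longrightarrow> x \<in> surface_interior S \<Longrightarrow> \<mu> x \<in> carrier (local_homology S x)"
  by (simp add: surface_orientation_def)

lemma orientation_preserving_id: "orientation_preserving S (\<lambda>x\<in>S. x)"
  unfolding orientation_preserving_def
proof (intro allI impI ballI)
  fix \<mu> x assume \<mu>: "surface_orientation S \<mu>" and x: "x \<in> surface_interior S"
  have "hom_induced 2 (top_of_set S) (S - {x}) (top_of_set S) (S - {x}) (\<lambda>x\<in>S. x) (\<mu> x) = \<mu> x"
    by (rule hom_induced_id_gen[OF boundary_homeos_continuous[OF boundary_homeos_id] _ orientation_mem[OF \<mu> x]]) simp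
  then show "hom_induced 2 (top_of_set S) (S - {x}) (top_of_set S) (S - {(\<lambda>x\<in>S. x) x}) (\<lambda>x\<in>S. x) (\<mu> x)
      = \<mu> ((\<lambda>x\<in>S. x) x)"
    using surface_interior_mem[OF x] by simp
qed

lemma orientation_preserving_compose:
  assumes f: "f \<in> boundary_homeos S" "orientation_preserving S f"
    and g: "g \<in> boundary_homeos S" "orientation_preserving S g"
  shows "orientation_preserving S (compose S f g)"
  unfolding orientation_preserving_def
proof (intro allI impI ballI)
  fix \<mu> x assume \<mu>: "surface_orientation S \<mu>" and x: "x \<in> surface_interior S"
  note xS = surface_interior_mem[OF x]
  have gx: "g x \<in> surface_interior S" by (rule boundary_homeos_interior[OF g(1) x])
  let ?h = "\<lambda>x y f. hom_induced 2 (top_of_set S) (S - {x}) (top_of_set S) (S - {y}) f"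
  have "?h x (f (g x)) (compose S f g) (\<mu> x) = ?h x (f (g x)) (f \<circ> g) (\<mu> x)"
    by (rule arg_cong[where f = "\<lambda>h. h (\<mu> x)"], rule hom_induced_eq) (simp add: compose_def)
  also have "\<dots> = ?h (g x) (f (g x)) f (?h x (g x) g (\<mu> x))"
    using boundary_homeos_minus_point[OF g(1) xS]
      boundary_homeos_minus_point[OF f(1) surface_interior_mem[OF gx]]
    by (intro hom_induced_compose'[symmetric] boundary_homeos_continuous f g) auto
  also have "\<dots> = \<mu> (f (g x))"
    using f(2) g(2) \<mu> x gx by (simp add: orientation_preserving_def)
  finally show "?h x (compose S f g x) (compose S f g) (\<mu> x) = \<mu> (compose S f g x)"
    using xS by (simp add: compose_def)
qed

lemma orientation_preserving_inverse:
  assumes f: "f \<in> boundary_homeos S" "orientation_preserving S f"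
  shows "orientation_preserving S (\<lambda>x\<in>S. inv_into S f x)"
  unfolding orientation_preserving_def
proof (intro allI impI ballI)
  let ?k = "\<lambda>x\<in>S. inv_into S f x"
  fix \<mu> y assume \<mu>: "surface_orientation S \<mu>" and y: "y \<in> surface_interior S"
  have k: "?k \<in> boundary_homeos S" by (rule boundary_homeos_inverse[OF f(1)])
  define x where "x = ?k y"
  have x: "x \<in> surface_interior S" unfolding x_def by (rule boundary_homeos_interior[OF k y])
  note xS = surface_interior_mem[OF x] and yS = surface_interior_mem[OF y]
  have bij: "bij_betw f S S" using boundary_homeos_Bij[OF f(1)] by (simp add: Bij_def)
  have fx: "f x = y" using bij yS by (simp add: x_def bij_betw_inv_into_right)
  have kf: "?k (f z) = z" if "z \<in> S" for z
    using bij that boundary_homeos_mem[OF f(1) that] by (simp add: bij_betw_inv_into_left)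
  let ?h = "\<lambda>x y f. hom_induced 2 (top_of_set S) (S - {x}) (top_of_set S) (S - {y}) f"
  have "?h x (f x) f (\<mu> x) = \<mu> (f x)"
    using f(2) \<mu> x unfolding orientation_preserving_def by blast
  then have "?h y x ?k (\<mu> y) = ?h y x ?k (?h x y f (\<mu> x))" by (simp only: fx)
  also have "\<dots> = ?h x x (?k \<circ> f) (\<mu> x)"
    using boundary_homeos_minus_point[OF f(1) xS] boundary_homeos_minus_point[OF k yS]
    unfolding fx x_def[symmetric]
    by (intro hom_induced_compose' boundary_homeos_continuous f k) auto
  also have "\<dots> = \<mu> x"
  proof (rule hom_induced_id_gen)
    show "continuous_map (top_of_set S) (top_of_set S) (?k \<circ> f)"
      by (rule continuous_map_compose[OF boundary_homeos_continuous[OF f(1)] boundary_homeos_continuous[OF k]])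
    show "(?k \<circ> f) z = z" if "z \<in> topspace (top_of_set S)" for z using kf that by simp
    show "\<mu> x \<in> carrier (local_homology S x)" by (rule orientation_mem[OF \<mu> x])
  qed
  finally show "?h y (?k y) ?k (\<mu> y) = \<mu> (?k y)" unfolding x_def .
qed

lemma subgroup_homeos:
  "subgroup {f \<in> boundary_homeos S. orientation_preserving S f} (BijGroup S)"
proof (rule group.subgroupI[OF group_BijGroup])
  show "{f \<in> boundary_homeos S. orientation_preserving S f} \<subseteq> carrier (BijGroup S)"
    by (auto simp: BijGroup_def boundary_homeos_Bij)
  show "{f \<in> boundary_homeos S. orientation_preserving S f} \<noteq> {}"
    using boundary_homeos_id orientation_preserving_id by blast
qed (auto simp: inv_BijGroup boundary_homeos_Bij boundary_homeos_inverse orientation_preserving_inverse,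
    auto simp: BijGroup_def boundary_homeos_Bij boundary_homeos_compose orientation_preserving_compose)

lemma group_homeo_group: "group (homeo_group S)"
  unfolding homeo_group_def by (rule subgroup.subgroup_is_group[OF subgroup_homeos group_BijGroup])

lemma carrier_homeo_group: "f \<in> carrier (homeo_group S) \<Longrightarrow> f \<in> boundary_homeos S"
  by (simp add: homeo_group_def)

lemma one_homeo_group: "\<one>\<^bsub>homeo_group S\<^esub> = (\<lambda>x\<in>S. x)"
  by (simp add: homeo_group_def BijGroup_def)

lemma mult_homeo_group:
  "f \<in> boundary_homeos S \<Longrightarrow> g \<in> boundary_homeos S \<Longrightarrow> f \<otimes>\<^bsub>homeo_group S\<^esub> g = compose S f g"
  by (simp add: homeo_group_def BijGroup_def boundary_homeos_Bij)

abbreviation (input) isotopy_pred :: "'a::topological_space set \<Rightarrow> ('a \<Rightarrow> 'a) \<Rightarrow> bool" where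
  "isotopy_pred S \<equiv> \<lambda>u. restrict u S \<in> boundary_homeos S"

lemma restrict_boundary_homeos: "f \<in> boundary_homeos S \<Longrightarrow> restrict f S = f"
  by (auto simp: boundary_homeos_def Bij_def extensional_restrict)

lemma isotopic_cong:
  assumes "isotopic_rel_boundary S f g" "\<And>x. x \<in> S \<Longrightarrow> f' x = f x" "\<And>x. x \<in> S \<Longrightarrow> g' x = g x"
  shows "isotopic_rel_boundary S f' g'"
  using assms(1) unfolding isotopic_rel_boundary_def
proof (rule homotopic_with_eq)
  fix h k :: "'a \<Rightarrow> 'a" assume "\<And>x. x \<in> topspace (top_of_set S) \<Longrightarrow> h x = k x"
  then have "restrict h S = restrict k S" by (auto simp: restrict_def)
  then show "restrict h S \<in> boundary_homeos S \<longleftrightarrow> restrict k S \<in> boundary_homeos S" by simp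
qed (use assms in auto)

lemma isotopic_sym: "isotopic_rel_boundary S f g \<Longrightarrow> isotopic_rel_boundary S g f"
  unfolding isotopic_rel_boundary_def by (rule homotopic_with_symD)

lemma isotopic_trans:
  "isotopic_rel_boundary S f g \<Longrightarrow> isotopic_rel_boundary S g h \<Longrightarrow> isotopic_rel_boundary S f h"
  unfolding isotopic_rel_boundary_def by (rule homotopic_with_trans)

lemma isotopic_refl: "f \<in> boundary_homeos S \<Longrightarrow> isotopic_rel_boundary S f f"
  unfolding isotopic_rel_boundary_def
  using boundary_homeos_continuous[of f S] restrict_boundary_homeos[of f S] by simp

lemma isotopic_compose_left:
  assumes fg: "isotopic_rel_boundary S f g" and h: "h \<in> boundary_homeos S"
  shows "isotopic_rel_boundary S (compose S h f) (compose S h g)"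
proof -
  have "isotopic_rel_boundary S (h \<circ> f) (h \<circ> g)"
    unfolding isotopic_rel_boundary_def
  proof (rule homotopic_with_compose_continuous_map_left)
    show "homotopic_with_canon (isotopy_pred S) S S f g" using fg by (simp add: isotopic_rel_boundary_def)
    show "continuous_map (top_of_set S) (top_of_set S) h" by (rule boundary_homeos_continuous[OF h])
    fix j assume "restrict j S \<in> boundary_homeos S"
    from boundary_homeos_compose[OF h this] show "restrict (h \<circ> j) S \<in> boundary_homeos S"
      by (simp add: compose_def restrict_def cong: if_cong)
  qed
  then show ?thesis by (rule isotopic_cong) (auto simp: compose_def)
qed

lemma isotopic_compose_right:
  assumes fg: "isotopic_rel_boundary S f g" and h: "h \<in> boundary_homeos S"
  shows "isotopic_rel_boundary S (compose S f h) (compose S g h)"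
proof -
  have "isotopic_rel_boundary S (f \<circ> h) (g \<circ> h)"
    unfolding isotopic_rel_boundary_def
  proof (rule homotopic_with_compose_continuous_map_right)
    show "homotopic_with_canon (isotopy_pred S) S S f g" using fg by (simp add: isotopic_rel_boundary_def)
    show "continuous_map (top_of_set S) (top_of_set S) h" by (rule boundary_homeos_continuous[OF h])
    fix j assume "restrict j S \<in> boundary_homeos S"
    from boundary_homeos_compose[OF this h] have "compose S (restrict j S) h \<in> boundary_homeos S" .
    moreover have "compose S (restrict j S) h = restrict (j \<circ> h) S"
      using boundary_homeos_mem[OF h] by (auto simp: compose_def restrict_def)
    ultimately show "restrict (j \<circ> h) S \<in> boundary_homeos S" by simp
  qed
  then show ?thesis by (rule isotopic_cong) (auto simp: compose_def)
qed

definition isotopic_to_id :: "'a::topological_space set \<Rightarrow> ('a \<Rightarrow> 'a) set" where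
  "isotopic_to_id S = {f \<in> carrier (homeo_group S). isotopic_rel_boundary S (\<lambda>x\<in>S. x) f}"

lemma isotopic_to_idD:
  assumes "f \<in> isotopic_to_id S"
  shows "f \<in> boundary_homeos S" "isotopic_rel_boundary S (\<lambda>x\<in>S. x) f"
  using assms carrier_homeo_group[of f S] by (auto simp: isotopic_to_id_def)

text \<open>
  An isotopy stays an isotopy relative to the boundary when it is composed, on either side, with a
  homeomorphism that fixes the boundary.
\<close>

lemma normal_isotopic_to_id: "isotopic_to_id S \<lhd> homeo_group S"
proof -
  interpret HG: group "homeo_group S" by (rule group_homeo_group)
  have bh: "f \<in> boundary_homeos S" if "f \<in> carrier (homeo_group S)" for f
    using that by (rule carrier_homeo_group)
  have inv_bh: "inv\<^bsub>homeo_group S\<^esub> f \<in> boundary_homeos S" if "f \<in> carrier (homeo_group S)" for f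
    using that by (intro bh HG.inv_closed)
  have left: "isotopic_rel_boundary S (f \<otimes>\<^bsub>homeo_group S\<^esub> u) (f \<otimes>\<^bsub>homeo_group S\<^esub> v)"
    if "isotopic_rel_boundary S u v" "f \<in> carrier (homeo_group S)"
      "u \<in> carrier (homeo_group S)" "v \<in> carrier (homeo_group S)" for f u v
    using isotopic_compose_left[OF that(1) bh[OF that(2)]] bh that by (simp add: mult_homeo_group)
  have right: "isotopic_rel_boundary S (u \<otimes>\<^bsub>homeo_group S\<^esub> f) (v \<otimes>\<^bsub>homeo_group S\<^esub> f)"
    if "isotopic_rel_boundary S u v" "f \<in> carrier (homeo_group S)"
      "u \<in> carrier (homeo_group S)" "v \<in> carrier (homeo_group S)" for f u v
    using isotopic_compose_right[OF that(1) bh[OF that(2)]] bh that by (simp add: mult_homeo_group)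
  have N: "f \<in> isotopic_to_id S \<longleftrightarrow> f \<in> carrier (homeo_group S) \<and> isotopic_rel_boundary S \<one>\<^bsub>homeo_group S\<^esub> f" for f
    by (simp add: isotopic_to_id_def one_homeo_group)
  have sub: "subgroup (isotopic_to_id S) (homeo_group S)"
  proof (rule HG.subgroupI)
    show "isotopic_to_id S \<subseteq> carrier (homeo_group S)" by (auto simp: N)
    have "\<one>\<^bsub>homeo_group S\<^esub> \<in> isotopic_to_id S"
      using isotopic_refl[OF bh[OF HG.one_closed]] by (simp add: N)
    then show "isotopic_to_id S \<noteq> {}" by blast
    fix f assume f: "f \<in> isotopic_to_id S"
    then have "isotopic_rel_boundary S (inv\<^bsub>homeo_group S\<^esub> f \<otimes>\<^bsub>homeo_group S\<^esub> \<one>\<^bsub>homeo_group S\<^esub>)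
        (inv\<^bsub>homeo_group S\<^esub> f \<otimes>\<^bsub>homeo_group S\<^esub> f)"
      by (intro left) (auto simp: N)
    then show "inv\<^bsub>homeo_group S\<^esub> f \<in> isotopic_to_id S"
      using f isotopic_sym by (auto simp: N)
    fix g assume g: "g \<in> isotopic_to_id S"
    have "isotopic_rel_boundary S (f \<otimes>\<^bsub>homeo_group S\<^esub> \<one>\<^bsub>homeo_group S\<^esub>) (f \<otimes>\<^bsub>homeo_group S\<^esub> g)"
      using f g by (intro left) (auto simp: N)
    then show "f \<otimes>\<^bsub>homeo_group S\<^esub> g \<in> isotopic_to_id S"
      using f g isotopic_trans[of S "\<one>\<^bsub>homeo_group S\<^esub>" f] by (auto simp: N)
  qed
  show ?thesis
  proof (rule HG.normal_invI[OF sub])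
    fix g f assume g: "g \<in> carrier (homeo_group S)" and f: "f \<in> isotopic_to_id S"
    then have "isotopic_rel_boundary S (g \<otimes>\<^bsub>homeo_group S\<^esub> \<one>\<^bsub>homeo_group S\<^esub> \<otimes>\<^bsub>homeo_group S\<^esub> inv\<^bsub>homeo_group S\<^esub> g)
        (g \<otimes>\<^bsub>homeo_group S\<^esub> f \<otimes>\<^bsub>homeo_group S\<^esub> inv\<^bsub>homeo_group S\<^esub> g)"
      by (intro right left) (auto simp: N)
    with f g show "g \<otimes>\<^bsub>homeo_group S\<^esub> f \<otimes>\<^bsub>homeo_group S\<^esub> inv\<^bsub>homeo_group S\<^esub> g \<in> isotopic_to_id S"
      by (simp add: N)
  qed
qed

lemma mapping_class_group_eq: "mapping_class_group S = homeo_group S Mod isotopic_to_id S"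
  by (simp add: mapping_class_group_def isotopic_to_id_def)

lemma group_mapping_class_group: "group (mapping_class_group S)"
  unfolding mapping_class_group_eq by (rule normal.factorgroup_is_group[OF normal_isotopic_to_id])

abbreviation mapping_class :: "'a::topological_space set \<Rightarrow> ('a \<Rightarrow> 'a) \<Rightarrow> ('a \<Rightarrow> 'a) set" where
  "mapping_class S f \<equiv> isotopic_to_id S #>\<^bsub>homeo_group S\<^esub> f"

lemma carrier_mapping_class_group:
  "carrier (mapping_class_group S) = mapping_class S ` carrier (homeo_group S)"
  by (simp add: mapping_class_group_eq carrier_FactGroup)

lemma mult_mapping_class_group:
  "f \<in> carrier (homeo_group S) \<Longrightarrow> g \<in> carrier (homeo_group S) \<Longrightarrow>
    mapping_class S f \<otimes>\<^bsub>mapping_class_group S\<^esub> mapping_class S g = mapping_class S (f \<otimes>\<^bsub>homeo_group S\<^esub> g)"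
  by (simp add: mapping_class_group_eq normal.rcos_sum[OF normal_isotopic_to_id])

lemma one_mapping_class_group: "\<one>\<^bsub>mapping_class_group S\<^esub> = mapping_class S \<one>\<^bsub>homeo_group S\<^esub>"
proof -
  interpret N: normal "isotopic_to_id S" "homeo_group S" by (rule normal_isotopic_to_id)
  show ?thesis by (simp add: mapping_class_group_eq N.coset_mult_one N.subset)
qed

subsection \<open>The action on the fundamental group\<close>

lemma based_loops_image:
  assumes b: "b \<in> surface_boundary S" and f: "f \<in> boundary_homeos S" and \<gamma>: "\<gamma> \<in> based_loops S b"
  shows "f \<circ> \<gamma> \<in> based_loops S b"
proof -
  have "continuous_on S f" "f ` S \<subseteq> S"
    using boundary_homeos_continuous[OF f] by auto
  then show ?thesis
    using \<gamma> b f
    by (auto simp: based_loops_def pathstart_compose pathfinish_compose path_image_compose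
        boundary_homeos_def intro!: path_continuous_image intro: continuous_on_subset)
qed

lemma isotopic_loop_image:
  assumes b: "b \<in> surface_boundary S" and iso: "isotopic_rel_boundary S f g" and \<gamma>: "\<gamma> \<in> based_loops S b"
  shows "homotopic_paths S (f \<circ> \<gamma>) (g \<circ> \<gamma>)"
proof -
  have bS: "b \<in> S" using b surface_boundary_subset by blast
  have fix_b: "j b = b" if "restrict j S \<in> boundary_homeos S" for j
  proof -
    have "restrict j S b = b" using that b by (simp add: boundary_homeos_def)
    then show ?thesis using bS by simp
  qed
  have "isotopy_pred S f" using homotopic_with_imp_property iso unfolding isotopic_rel_boundary_def by blast
  then have fb: "f b = b" by (rule fix_b)
  show ?thesis
    unfolding homotopic_paths_def
  proof (rule homotopic_with_compose_continuous_map_right)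
    show "homotopic_with_canon (isotopy_pred S) S S f g" using iso by (simp add: isotopic_rel_boundary_def)
    show "continuous_map (top_of_set {0..1}) (top_of_set S) \<gamma>"
      using \<gamma> by (auto simp: based_loops_def path_def path_image_def)
    show "pathstart (j \<circ> \<gamma>) = pathstart (f \<circ> \<gamma>) \<and> pathfinish (j \<circ> \<gamma>) = pathfinish (f \<circ> \<gamma>)"
      if "restrict j S \<in> boundary_homeos S" for j
      using fix_b[OF that] fb \<gamma> by (simp add: based_loops_def pathstart_compose pathfinish_compose)
  qed
qed

text \<open>
  Isotopies fix the boundary, hence the base point, so the representative of a mapping class does not
  matter.
\<close>

lemma mcg_action_loop_class:
  assumes b: "b \<in> surface_boundary S" and f: "f \<in> carrier (homeo_group S)" and \<gamma>: "\<gamma> \<in> based_loops S b"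
  shows "mcg_action S (mapping_class S f) (loop_class S \<gamma>) = loop_class S (f \<circ> \<gamma>)"
proof -
  interpret N: normal "isotopic_to_id S" "homeo_group S" by (rule normal_isotopic_to_id)
  have fb: "f \<in> boundary_homeos S" by (rule carrier_homeo_group[OF f])
  have "loop_class S (h \<circ> \<delta>) = loop_class S (f \<circ> \<gamma>)"
    if h: "h \<in> mapping_class S f" and \<delta>: "\<delta> \<in> loop_class S \<gamma>" for h \<delta>
  proof -
    from h have "\<exists>n\<in>isotopic_to_id S. h = n \<otimes>\<^bsub>homeo_group S\<^esub> f"
      by (simp only: r_coset_def UN_iff singleton_iff)
    then obtain n where n: "n \<in> isotopic_to_id S" "h = n \<otimes>\<^bsub>homeo_group S\<^esub> f" by (elim bexE)
    have nb: "n \<in> boundary_homeos S" "isotopic_rel_boundary S (\<lambda>x\<in>S. x) n"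
      by (rule isotopic_to_idD[OF n(1)])+
    have "isotopic_rel_boundary S (compose S (\<lambda>x\<in>S. x) f) (compose S n f)"
      by (rule isotopic_compose_right[OF nb(2) fb])
    then have "isotopic_rel_boundary S f h"
    proof (rule isotopic_cong)
      fix x assume x: "x \<in> S"
      show "f x = compose S (\<lambda>x\<in>S. x) f x" using x boundary_homeos_mem[OF fb x] by (simp add: compose_def)
      show "h x = compose S n f x" by (simp add: n(2) mult_homeo_group[OF nb(1) fb])
    qed
    then have 1: "homotopic_paths S (f \<circ> \<gamma>) (h \<circ> \<gamma>)" by (rule isotopic_loop_image[OF b _ \<gamma>])
    have h': "h \<in> boundary_homeos S" using n nb fb by (simp add: mult_homeo_group boundary_homeos_compose)
    have 2: "homotopic_paths S (h \<circ> \<gamma>) (h \<circ> \<delta>)"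
      using \<delta> boundary_homeos_continuous[OF h']
      by (intro homotopic_paths_continuous_image[of S]) (auto simp: loop_class_def)
    show ?thesis by (rule loop_class_eqI[OF homotopic_paths_trans[OF 1 2], symmetric])
  qed
  moreover have "f \<in> mapping_class S f" by (rule N.rcos_self[OF f N.subgroup_axioms])
  moreover have "\<gamma> \<in> loop_class S \<gamma>" using \<gamma> by (auto simp: based_loops_def mem_loop_class_self)
  ultimately show ?thesis unfolding mcg_action_def by blast
qed

lemma mcg_action_hom:
  assumes b: "b \<in> surface_boundary S" and \<phi>: "\<phi> \<in> carrier (mapping_class_group S)"
  shows "mcg_action S \<phi> \<in> hom (fundamental_group S b) (fundamental_group S b)"
proof -
  obtain f where f: "f \<in> carrier (homeo_group S)" "\<phi> = mapping_class S f"
    using \<phi> by (auto simp: carrier_mapping_class_group)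
  have fl: "f \<circ> \<gamma> \<in> based_loops S b" if "\<gamma> \<in> based_loops S b" for \<gamma>
    by (rule based_loops_image[OF b carrier_homeo_group[OF f(1)] that])
  show ?thesis
  proof (rule homI)
    fix x y assume "x \<in> carrier (fundamental_group S b)" "y \<in> carrier (fundamental_group S b)"
    then obtain \<gamma> \<delta> where "\<gamma> \<in> based_loops S b" "x = loop_class S \<gamma>" "\<delta> \<in> based_loops S b" "y = loop_class S \<delta>"
      by (auto elim!: fundamental_group_cases)
    then show "mcg_action S \<phi> x \<in> carrier (fundamental_group S b)"
      "mcg_action S \<phi> (x \<otimes>\<^bsub>fundamental_group S b\<^esub> y) =
        mcg_action S \<phi> x \<otimes>\<^bsub>fundamental_group S b\<^esub> mcg_action S \<phi> y"
      by (simp_all add: f(2) mcg_action_loop_class[OF b f(1)] fl loop_class_carrier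
          mult_fundamental_group based_loops_join path_compose_join)
  qed
qed

lemma mcg_action_mult:
  assumes b: "b \<in> surface_boundary S"
    and \<phi>: "\<phi> \<in> carrier (mapping_class_group S)" and \<psi>: "\<psi> \<in> carrier (mapping_class_group S)"
    and x: "x \<in> carrier (fundamental_group S b)"
  shows "mcg_action S (\<phi> \<otimes>\<^bsub>mapping_class_group S\<^esub> \<psi>) x = mcg_action S \<phi> (mcg_action S \<psi> x)"
proof -
  interpret HG: group "homeo_group S" by (rule group_homeo_group)
  obtain f where f: "f \<in> carrier (homeo_group S)" "\<phi> = mapping_class S f"
    using \<phi> by (auto simp: carrier_mapping_class_group)
  obtain g where g: "g \<in> carrier (homeo_group S)" "\<psi> = mapping_class S g"
    using \<psi> by (auto simp: carrier_mapping_class_group)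
  obtain \<gamma> where \<gamma>: "\<gamma> \<in> based_loops S b" "x = loop_class S \<gamma>" using x by (rule fundamental_group_cases)
  have gl: "g \<circ> \<gamma> \<in> based_loops S b"
    by (rule based_loops_image[OF b carrier_homeo_group[OF g(1)] \<gamma>(1)])
  have fgl: "f \<circ> (g \<circ> \<gamma>) \<in> based_loops S b"
    by (rule based_loops_image[OF b carrier_homeo_group[OF f(1)] gl])
  have "homotopic_paths S (f \<circ> (g \<circ> \<gamma>)) ((f \<otimes>\<^bsub>homeo_group S\<^esub> g) \<circ> \<gamma>)"
  proof (rule homotopic_paths_eq)
    fix t :: real assume "t \<in> {0..1}"
    then have "\<gamma> t \<in> S" using \<gamma>(1) by (auto simp: based_loops_def path_image_def)
    then show "(f \<circ> (g \<circ> \<gamma>)) t = ((f \<otimes>\<^bsub>homeo_group S\<^esub> g) \<circ> \<gamma>) t"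
      using f g by (simp add: mult_homeo_group carrier_homeo_group compose_def)
  qed (use fgl in \<open>auto simp: based_loops_def\<close>)
  then show ?thesis
    using f g \<gamma> gl
    by (simp add: mult_mapping_class_group mcg_action_loop_class[OF b] loop_class_eqI)
qed

lemma mcg_action_one:
  assumes b: "b \<in> surface_boundary S" and x: "x \<in> carrier (fundamental_group S b)"
  shows "mcg_action S \<one>\<^bsub>mapping_class_group S\<^esub> x = x"
proof -
  interpret HG: group "homeo_group S" by (rule group_homeo_group)
  obtain \<gamma> where \<gamma>: "\<gamma> \<in> based_loops S b" "x = loop_class S \<gamma>" using x by (rule fundamental_group_cases)
  have "homotopic_paths S \<gamma> (\<one>\<^bsub>homeo_group S\<^esub> \<circ> \<gamma>)"
    using \<gamma>(1) by (intro homotopic_paths_eq) (auto simp: based_loops_def path_image_def one_homeo_group image_subset_iff)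
  from loop_class_eqI[OF this] show ?thesis
    using mcg_action_loop_class[OF b HG.one_closed \<gamma>(1)] \<gamma>(2) by (simp add: one_mapping_class_group)
qed

section \<open>The Johnson homomorphism of a filtration\<close>

lemma group_Hom_group:
  assumes "group G" and H: "comm_group H"
  shows "group (Hom_group G H)"
proof -
  interpret G: group G by fact
  interpret H: comm_group H by fact
  have cl: "u x \<in> carrier H" if "u \<in> carrier (Hom_group G H)" "x \<in> carrier G" for u x
    using that by (auto simp: Hom_group_def hom_def)
  have mult: "u (x \<otimes>\<^bsub>G\<^esub> y) = u x \<otimes>\<^bsub>H\<^esub> u y"
    if "u \<in> carrier (Hom_group G H)" "x \<in> carrier G" "y \<in> carrier G" for u x y
    using that by (auto simp: Hom_group_def hom_def)
  have carrierI: "restrict u (carrier G) \<in> carrier (Hom_group G H)"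
    if "\<And>x. x \<in> carrier G \<Longrightarrow> u x \<in> carrier H"
      "\<And>x y. x \<in> carrier G \<Longrightarrow> y \<in> carrier G \<Longrightarrow> u (x \<otimes>\<^bsub>G\<^esub> y) = u x \<otimes>\<^bsub>H\<^esub> u y" for u
    using that by (auto simp: Hom_group_def hom_def)
  have ext: "u \<in> extensional (carrier G)" if "u \<in> carrier (Hom_group G H)" for u
    using that by (simp add: Hom_group_def)
  have prod: "u \<otimes>\<^bsub>Hom_group G H\<^esub> v = (\<lambda>x\<in>carrier G. u x \<otimes>\<^bsub>H\<^esub> v x)" for u v
    by (simp add: Hom_group_def)
  have unit: "\<one>\<^bsub>Hom_group G H\<^esub> = (\<lambda>x\<in>carrier G. \<one>\<^bsub>H\<^esub>)" by (simp add: Hom_group_def)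
  show ?thesis
  proof (rule groupI)
    show one: "\<one>\<^bsub>Hom_group G H\<^esub> \<in> carrier (Hom_group G H)"
      unfolding unit by (rule carrierI) auto
    fix u assume u: "u \<in> carrier (Hom_group G H)"
    show "\<one>\<^bsub>Hom_group G H\<^esub> \<otimes>\<^bsub>Hom_group G H\<^esub> u = u"
      unfolding prod unit using u cl by (intro extensionalityI[OF restrict_extensional ext]) auto
    have "(\<lambda>x\<in>carrier G. inv\<^bsub>H\<^esub> u x) \<in> carrier (Hom_group G H)"
      by (intro carrierI) (simp_all add: cl[OF u] mult[OF u] H.inv_mult)
    moreover have "(\<lambda>x\<in>carrier G. inv\<^bsub>H\<^esub> u x) \<otimes>\<^bsub>Hom_group G H\<^esub> u = \<one>\<^bsub>Hom_group G H\<^esub>"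
      unfolding prod unit using u cl by (intro restrict_ext) auto
    ultimately show "\<exists>v\<in>carrier (Hom_group G H). v \<otimes>\<^bsub>Hom_group G H\<^esub> u = \<one>\<^bsub>Hom_group G H\<^esub>" by blast
    fix v assume v: "v \<in> carrier (Hom_group G H)"
    show "u \<otimes>\<^bsub>Hom_group G H\<^esub> v \<in> carrier (Hom_group G H)"
      unfolding prod
      by (intro carrierI) (simp_all add: cl[OF u] cl[OF v] mult[OF u] mult[OF v] H.m_ac)
    fix w assume w: "w \<in> carrier (Hom_group G H)"
    show "u \<otimes>\<^bsub>Hom_group G H\<^esub> v \<otimes>\<^bsub>Hom_group G H\<^esub> w = u \<otimes>\<^bsub>Hom_group G H\<^esub> (v \<otimes>\<^bsub>Hom_group G H\<^esub> w)"
      unfolding prod using u v w cl by (intro restrict_ext) (auto simp: H.m_assoc)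
  qed
qed

context johnson_series
begin

lemma term_coset_eqI:
  assumes "x \<in> carrier G" "y \<in> carrier G" "x \<otimes> inv y \<in> D n"
  shows "D n #> x = D n #> y"
  using assms subgroup.subset[OF subgroup_term]
  by (intro coset_mult_inv1 coset_join2 subgroup_term) auto

lemma normal_graded: "D (Suc n) \<lhd> G\<lparr>carrier := D n\<rparr>"
  by (rule normal_restrict_supergroup[OF subgroup_term normal_term Suc_subset])

lemma carrier_graded_quotient: "carrier (graded_quotient G D n) = (\<lambda>x. D (Suc n) #> x) ` D n"
  by (simp add: graded_quotient_def carrier_FactGroup r_coset_def)

lemma mult_graded_quotient:
  assumes "x \<in> carrier G" "y \<in> carrier G"
  shows "(D (Suc n) #> x) \<otimes>\<^bsub>graded_quotient G D n\<^esub> (D (Suc n) #> y) = D (Suc n) #> (x \<otimes> y)"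
  using normal.rcos_sum[OF normal_term assms, of "Suc n"]
  by (simp add: graded_quotient_def set_mult_def)

lemma one_graded_quotient: "\<one>\<^bsub>graded_quotient G D n\<^esub> = D (Suc n)"
  by (simp add: graded_quotient_def)

lemma group_graded_quotient: "group (graded_quotient G D n)"
  unfolding graded_quotient_def by (rule normal.factorgroup_is_group[OF normal_graded])

lemma comm_group_graded_quotient:
  assumes "1 \<le> n"
  shows "comm_group (graded_quotient G D n)"
proof (rule group.group_comm_groupI[OF group_graded_quotient])
  fix X Y assume "X \<in> carrier (graded_quotient G D n)" "Y \<in> carrier (graded_quotient G D n)"
  then obtain x y where X: "X = D (Suc n) #> x" "x \<in> D n" and Y: "Y = D (Suc n) #> y" "y \<in> D n"
    by (auto simp: carrier_graded_quotient)
  have c: "x \<in> carrier G" "y \<in> carrier G" using X Y mem_carrier by auto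
  have "gcomm G x y \<in> D (Suc n)" using mem_mono[OF gcomm_mem[OF X(2) Y(2)], of "Suc n"] assms by simp
  then have "D (Suc n) #> (x \<otimes> y) = D (Suc n) #> (y \<otimes> x)"
    using c by (intro term_coset_eqI) (simp_all add: gcomm_def free_reduce)
  then show "X \<otimes>\<^bsub>graded_quotient G D n\<^esub> Y = Y \<otimes>\<^bsub>graded_quotient G D n\<^esub> X"
    using X Y c by (simp add: mult_graded_quotient)
qed

lemma graded_quotient_exponent:
  assumes n: "1 \<le> n" and X: "X \<in> carrier (graded_quotient G D n)"
  shows "X [^]\<^bsub>graded_quotient G D n\<^esub> p = \<one>\<^bsub>graded_quotient G D n\<^esub>"
proof -
  interpret Q: group "graded_quotient G D n" by (rule group_graded_quotient)
  obtain x where x: "X = D (Suc n) #> x" "x \<in> D n" using X by (auto simp: carrier_graded_quotient)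
  have c: "x \<in> carrier G" using x mem_carrier by auto
  have "X [^]\<^bsub>graded_quotient G D n\<^esub> m = D (Suc n) #> (x [^] m)" for m :: nat
  proof (induction m)
    case 0
    show ?case using subgroup.subset[OF subgroup_term] by (simp add: one_graded_quotient coset_mult_one)
  next
    case (Suc m)
    then show ?case using c x by (simp add: mult_graded_quotient)
  qed
  moreover have "D (Suc n) #> (x [^] p) = D (Suc n)"
    using c pow_mem_Suc[OF n x(2)] by (intro coset_join2 subgroup_term) auto
  ultimately show ?thesis by (simp add: one_graded_quotient)
qed

text \<open>
  The displacement of \<open>x y\<close> is that of \<open>x\<close> times the conjugate by \<open>x\<close> of that of \<open>y\<close>, and
  \<open>D n\<close> is central modulo \<open>D (Suc n)\<close>.
\<close>

lemma displacement_hom: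
  assumes f: "f \<in> hom G G" and J: "\<And>x. x \<in> carrier G \<Longrightarrow> f x \<otimes> inv x \<in> D n"
  shows "(\<lambda>x. D (Suc n) #> (f x \<otimes> inv x)) \<in> hom G (graded_quotient G D n)"
proof (rule homI)
  interpret f: group_hom G G f using f by unfold_locales
  fix x y assume x: "x \<in> carrier G" and y: "y \<in> carrier G"
  show "D (Suc n) #> (f x \<otimes> inv x) \<in> carrier (graded_quotient G D n)"
    using J[OF x] by (simp add: carrier_graded_quotient)
  define d where "d = f y \<otimes> inv y"
  have d: "d \<in> D n" "d \<in> carrier G" using J[OF y] y by (simp_all add: d_def)
  have "x \<in> D (Suc 0)" using x by (simp add: Suc_0)
  from gcomm_mem[OF this d(1)] have "gcomm G x d \<in> D (Suc n)" by simp
  then have 1: "(f x \<otimes> inv x) \<otimes> gcomm G x d \<otimes> inv (f x \<otimes> inv x) \<in> D (Suc n)"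
    using x by (intro conj_mem) auto
  have "f (x \<otimes> y) \<otimes> inv (x \<otimes> y) = f x \<otimes> d \<otimes> inv x"
    using x y by (simp add: d_def free_reduce)
  then have "D (Suc n) #> (f (x \<otimes> y) \<otimes> inv (x \<otimes> y)) = D (Suc n) #> ((f x \<otimes> inv x) \<otimes> d)"
    using x d(2) 1 by (intro term_coset_eqI) (simp_all add: gcomm_def free_reduce)
  also have "\<dots> = (D (Suc n) #> (f x \<otimes> inv x)) \<otimes>\<^bsub>graded_quotient G D n\<^esub> (D (Suc n) #> (f y \<otimes> inv y))"
    using x y d(2) by (simp add: mult_graded_quotient d_def)
  finally show "D (Suc n) #> (f (x \<otimes> y) \<otimes> inv (x \<otimes> y)) =
    (D (Suc n) #> (f x \<otimes> inv x)) \<otimes>\<^bsub>graded_quotient G D n\<^esub> (D (Suc n) #> (f y \<otimes> inv y))" .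
qed

text \<open>
  With \<open>d\<close> and \<open>e\<close> the displacements of \<open>x\<close> under \<open>g\<close> and \<open>f\<close>, the displacement
  under the composition is \<open>f d\<close> times \<open>e\<close>.  As \<open>2 \<le> n\<close>, \<open>f\<close> acts trivially on \<open>G / D 2\<close>,
  hence on \<open>D n / D (Suc n)\<close>, and so \<open>f d\<close> may be replaced by \<open>d\<close>.
\<close>

lemma
  assumes f: "f \<in> hom G G" and Jf: "\<And>x. x \<in> carrier G \<Longrightarrow> f x \<otimes> inv x \<in> D n"
    and g: "g \<in> hom G G" and Jg: "\<And>x. x \<in> carrier G \<Longrightarrow> g x \<otimes> inv x \<in> D n"
    and n: "2 \<le> n" and x: "x \<in> carrier G"
  shows displacement_comp_mem: "f (g x) \<otimes> inv x \<in> D n"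
    and displacement_comp_coset:
      "D (Suc n) #> (f (g x) \<otimes> inv x) = D (Suc n) #> ((f x \<otimes> inv x) \<otimes> (g x \<otimes> inv x))"
proof -
  interpret f: group_hom G G f using f by unfold_locales
  interpret g: group_hom G G g using g by unfold_locales
  define d where "d = g x \<otimes> inv x"
  define e where "e = f x \<otimes> inv x"
  define c where "c = f d \<otimes> inv d"
  have d: "d \<in> D n" "d \<in> carrier G" using Jg[OF x] x by (simp_all add: d_def)
  have e: "e \<in> D n" "e \<in> carrier G" using Jf[OF x] x by (simp_all add: e_def)
  have "f y \<otimes> inv y \<in> D 2" if "y \<in> carrier G" for y using mem_mono[OF Jf[OF that] n] .
  from displacement_mem[OF f this _ d(1)] n have c: "c \<in> D (Suc n)" by (simp add: c_def)
  have cc: "c \<in> carrier G" using c by (rule mem_carrier)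
  have eq: "f (g x) \<otimes> inv x = c \<otimes> d \<otimes> e"
    using x by (simp add: c_def d_def e_def free_reduce)
  show "f (g x) \<otimes> inv x \<in> D n"
    unfolding eq by (intro mult_mem d e mem_mono[OF c]) simp
  have "gcomm G d e \<in> D (Suc n)" using mem_mono[OF gcomm_mem[OF d(1) e(1)], of "Suc n"] n by simp
  with c have "c \<otimes> gcomm G d e \<in> D (Suc n)" by (rule mult_mem)
  then have "D (Suc n) #> (c \<otimes> d \<otimes> e) = D (Suc n) #> (e \<otimes> d)"
    using cc d(2) e(2) by (intro term_coset_eqI) (simp_all add: gcomm_def free_reduce)
  then show "D (Suc n) #> (f (g x) \<otimes> inv x) = D (Suc n) #> ((f x \<otimes> inv x) \<otimes> (g x \<otimes> inv x))"
    unfolding eq by (simp add: d_def e_def)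
qed

text \<open>
  As \<open>h\<close> undoes \<open>f\<close> at \<open>x\<close>, the displacement of \<open>x\<close> under \<open>h\<close> is the image under \<open>h\<close>
  of the inverse of its displacement under \<open>f\<close>.
\<close>

lemma displacement_inverse_mem:
  assumes f: "f \<in> hom G G" and Jf: "\<And>x. x \<in> carrier G \<Longrightarrow> f x \<otimes> inv x \<in> D n"
    and h: "h \<in> hom G G" and hf: "h (f x) = x" and x: "x \<in> carrier G"
  shows "h x \<otimes> inv x \<in> D n"
proof -
  interpret f: group_hom G G f using f by unfold_locales
  interpret h: group_hom G G h using h by unfold_locales
  have "h (inv (f x \<otimes> inv x)) \<in> D n" by (rule endo_mem[OF h inv_mem[OF Jf[OF x]]])
  then show ?thesis using x hf by (simp add: inv_mult_group)
qed

end

theorem proposition3p11: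
  fixes S :: "'a::topological_space set" and b :: 'a and g p k :: nat
    and D :: "nat \<Rightarrow> (real \<Rightarrow> 'a) set set"
  assumes "surface_one_boundary g S"
    and "b \<in> surface_boundary S"
    and "prime p" and "odd p"
    and "1 \<le> k"
    and "D = stallings_series p (fundamental_group S b) \<or>
         D = zassenhaus_series p (fundamental_group S b)"
  shows "(\<forall>\<phi>\<in>johnson_subgroup S b D k. \<forall>x\<in>carrier (fundamental_group S b).
            homology_class p S x \<in> carrier (modp_homology_group p 1 (top_of_set S)) \<and>
            johnson_map p S b D k \<phi> (homology_class p S x) =
              D (k + 2) #>\<^bsub>fundamental_group S b\<^esub> displacement S b \<phi> x) \<and>
         subgroup (johnson_subgroup S b D k) (mapping_class_group S) \<and>
         group_hom ((mapping_class_group S)\<lparr>carrier := johnson_subgroup S b D k\<rparr>)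
           (Hom_group (modp_homology_group p 1 (top_of_set S))
              (graded_quotient (fundamental_group S b) D (k + 1)))
           (johnson_map p S b D k)"
proof -
  define G where "G = fundamental_group S b"
  define M where "M = mapping_class_group S"
  define J where "J = johnson_subgroup S b D k"
  define H1 where "H1 = modp_homology_group p 1 (top_of_set S)"
  define Q where "Q = graded_quotient G D (k + 1)"
  define \<tau> where "\<tau> = johnson_map p S b D k"
  note b = \<open>b \<in> surface_boundary S\<close>
  have bS: "b \<in> S" using b surface_boundary_subset by blast
  have "path_connected S"
    using assms(1) by (intro path_connected_connected_surface) (auto simp: surface_one_boundary_def)
  then have "\<forall>v\<in>S. \<exists>q. path q \<and> path_image q \<subseteq> S \<and> pathstart q = b \<and> pathfinish q = v"
    using bS by (simp add: path_connected_def)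
  then obtain L where L: "\<forall>v\<in>S. path (L v) \<and> path_image (L v) \<subseteq> S \<and> pathstart (L v) = b \<and> pathfinish (L v) = v"
    by (rule bchoice[THEN exE])
  interpret conn: connected_by_paths S b L using bS L by unfold_locales auto
  interpret G: group G unfolding G_def by (rule conn.pi.is_group)
  interpret M: group M unfolding M_def by (rule group_mapping_class_group)
  interpret H1: group H1 unfolding H1_def by (rule group_modp_homology_group)
  have "johnson_series G D p"
    using assms(6) G.johnson_series_stallings[of p] G.johnson_series_zassenhaus[OF assms(3)]
    unfolding G_def by auto
  then interpret D: johnson_series G D p .
  interpret Q: comm_group Q unfolding Q_def by (rule D.comm_group_graded_quotient) simp

  have hom: "mcg_action S \<phi> \<in> hom G G" if "\<phi> \<in> carrier M" for \<phi>
    using mcg_action_hom[OF b] that by (simp add: G_def M_def)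
  have disp: "displacement S b \<phi> x = mcg_action S \<phi> x \<otimes>\<^bsub>G\<^esub> inv\<^bsub>G\<^esub> x" for \<phi> x
    by (simp add: displacement_def G_def)
  have J_iff: "\<phi> \<in> J \<longleftrightarrow> \<phi> \<in> carrier M \<and> (\<forall>x\<in>carrier G. mcg_action S \<phi> x \<otimes>\<^bsub>G\<^esub> inv\<^bsub>G\<^esub> x \<in> D (k + 1))" for \<phi>
    by (simp add: J_def johnson_subgroup_def M_def disp) (simp add: G_def)
  have J_M: "\<phi> \<in> carrier M" if "\<phi> \<in> J" for \<phi> using that J_iff by blast
  have J_mem: "mcg_action S \<phi> x \<otimes>\<^bsub>G\<^esub> inv\<^bsub>G\<^esub> x \<in> D (k + 1)" if "\<phi> \<in> J" "x \<in> carrier G" for \<phi> x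
    using that J_iff by blast
  have mult: "mcg_action S (\<phi> \<otimes>\<^bsub>M\<^esub> \<psi>) x = mcg_action S \<phi> (mcg_action S \<psi> x)"
    if "\<phi> \<in> carrier M" "\<psi> \<in> carrier M" "x \<in> carrier G" for \<phi> \<psi> x
    using mcg_action_mult[OF b] that by (simp add: G_def M_def)
  have one: "mcg_action S \<one>\<^bsub>M\<^esub> x = x" if "x \<in> carrier G" for x
    using mcg_action_one[OF b] that by (simp add: G_def M_def)
  have k2: "2 \<le> k + 1" using assms(5) by simp
  have Sk: "Suc (k + 1) = k + 2" by simp

  have sub: "subgroup J M"
  proof (rule M.subgroupI)
    show "J \<subseteq> carrier M" using J_M by blast
    have "\<one>\<^bsub>M\<^esub> \<in> J" using D.one_mem by (simp add: J_iff one)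
    then show "J \<noteq> {}" by blast
    fix \<phi> assume \<phi>: "\<phi> \<in> J"
    note \<phi>M = J_M[OF \<phi>]
    have "mcg_action S (inv\<^bsub>M\<^esub> \<phi>) x \<otimes>\<^bsub>G\<^esub> inv\<^bsub>G\<^esub> x \<in> D (k + 1)" if x: "x \<in> carrier G" for x
    proof (rule D.displacement_inverse_mem[OF hom[OF \<phi>M] J_mem[OF \<phi>] hom _ x])
      show "inv\<^bsub>M\<^esub> \<phi> \<in> carrier M" using \<phi>M by simp
      show "mcg_action S (inv\<^bsub>M\<^esub> \<phi>) (mcg_action S \<phi> x) = x"
        using mult[of "inv\<^bsub>M\<^esub> \<phi>" \<phi> x] one[OF x] \<phi>M x by simp
    qed
    then show "inv\<^bsub>M\<^esub> \<phi> \<in> J" using \<phi>M by (simp add: J_iff)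
    fix \<psi> assume \<psi>: "\<psi> \<in> J"
    note \<psi>M = J_M[OF \<psi>]
    have "mcg_action S \<phi> (mcg_action S \<psi> x) \<otimes>\<^bsub>G\<^esub> inv\<^bsub>G\<^esub> x \<in> D (k + 1)" if "x \<in> carrier G" for x
      by (rule D.displacement_comp_mem[OF hom[OF \<phi>M] J_mem[OF \<phi>] hom[OF \<psi>M] J_mem[OF \<psi>] k2 that])
    then show "\<phi> \<otimes>\<^bsub>M\<^esub> \<psi> \<in> J" using \<phi>M \<psi>M by (simp add: J_iff mult)
  qed

  have t_hom: "(\<lambda>x. D (k + 2) #>\<^bsub>G\<^esub> displacement S b \<phi> x) \<in> hom G Q" if \<phi>: "\<phi> \<in> J" for \<phi>
    using D.displacement_hom[OF hom[OF J_M[OF \<phi>]] J_mem[OF \<phi>]] by (simp add: Q_def disp)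
  have hc: "homology_class p S x \<in> carrier H1" if "x \<in> carrier G" for x
    using homology_class_carrier that by (simp add: G_def H1_def)
  have tau_value: "\<tau> \<phi> (homology_class p S x) = D (k + 2) #>\<^bsub>G\<^esub> displacement S b \<phi> x"
    if \<phi>: "\<phi> \<in> J" and x: "x \<in> carrier G" for \<phi> x
  proof -
    have exp: "a [^]\<^bsub>Q\<^esub> p = \<one>\<^bsub>Q\<^esub>" if "a \<in> carrier Q" for a
      using D.graded_quotient_exponent[of "k + 1" a] that by (simp add: Q_def)
    have uniq: "D (k + 2) #>\<^bsub>G\<^esub> displacement S b \<phi> y = D (k + 2) #>\<^bsub>G\<^esub> displacement S b \<phi> x"
      if "y \<in> carrier G" "homology_class p S y = homology_class p S x" for y
      using conn.hom_eq_of_homology_class_eq[OF Q.comm_group_axioms exp t_hom[OF \<phi>, unfolded G_def], of y x]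
        that x by (simp add: G_def)
    have "\<tau> \<phi> (homology_class p S x) = (THE y. \<exists>z\<in>carrier G. homology_class p S z = homology_class p S x \<and>
        y = D (k + 2) #>\<^bsub>G\<^esub> displacement S b \<phi> z)"
      using hc[OF x] by (simp add: \<tau>_def johnson_map_def H1_def G_def)
    also have "\<dots> = D (k + 2) #>\<^bsub>G\<^esub> displacement S b \<phi> x"
      using uniq x by (intro the_equality) blast+
    finally show ?thesis .
  qed
  have surj: "\<exists>x\<in>carrier G. homology_class p S x = c" if "c \<in> carrier H1" for c
    using that conn.homology_class_surj[of c p] unfolding G_def H1_def by blast
  have ext: "\<tau> \<phi> \<in> extensional (carrier H1)" for \<phi>
    by (simp add: \<tau>_def johnson_map_def H1_def)
  have \<tau>_carrier: "\<tau> \<phi> \<in> carrier (Hom_group H1 Q)" if \<phi>: "\<phi> \<in> J" for \<phi>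
  proof -
    have "\<tau> \<phi> \<in> hom H1 Q"
    proof (rule homI)
      fix c c' assume "c \<in> carrier H1" "c' \<in> carrier H1"
      then obtain x y where x: "x \<in> carrier G" "c = homology_class p S x"
        and y: "y \<in> carrier G" "c' = homology_class p S y" using surj by metis
      show "\<tau> \<phi> c \<in> carrier Q"
        using hom_in_carrier[OF t_hom[OF \<phi>] x(1)] by (simp add: x(2) tau_value[OF \<phi> x(1)])
      have "c \<otimes>\<^bsub>H1\<^esub> c' = homology_class p S (x \<otimes>\<^bsub>G\<^esub> y)"
        using homology_class_mult[of x S b y p] x y by (simp add: G_def H1_def)
      then show "\<tau> \<phi> (c \<otimes>\<^bsub>H1\<^esub> c') = \<tau> \<phi> c \<otimes>\<^bsub>Q\<^esub> \<tau> \<phi> c'"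
        using hom_mult[OF t_hom[OF \<phi>] x(1) y(1)] x y by (simp add: tau_value[OF \<phi>])
    qed
    with ext show ?thesis by (simp add: Hom_group_def)
  qed
  have "group_hom (M\<lparr>carrier := J\<rparr>) (Hom_group H1 Q) \<tau>"
  proof (rule group_hom.intro[OF _ _ group_hom_axioms.intro])
    show "group (M\<lparr>carrier := J\<rparr>)" by (rule subgroup.subgroup_is_group[OF sub M.is_group])
    show "group (Hom_group H1 Q)" by (rule group_Hom_group[OF H1.is_group Q.comm_group_axioms])
    show "\<tau> \<in> hom (M\<lparr>carrier := J\<rparr>) (Hom_group H1 Q)"
    proof (rule homI)
      fix \<phi> \<psi> assume "\<phi> \<in> carrier (M\<lparr>carrier := J\<rparr>)" "\<psi> \<in> carrier (M\<lparr>carrier := J\<rparr>)"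
      then have \<phi>: "\<phi> \<in> J" and \<psi>: "\<psi> \<in> J" by auto
      show "\<tau> \<phi> \<in> carrier (Hom_group H1 Q)" by (rule \<tau>_carrier[OF \<phi>])
      have \<phi>\<psi>: "\<phi> \<otimes>\<^bsub>M\<^esub> \<psi> \<in> J" by (rule subgroup.m_closed[OF sub \<phi> \<psi>])
      have "\<tau> (\<phi> \<otimes>\<^bsub>M\<^esub> \<psi>) c = \<tau> \<phi> c \<otimes>\<^bsub>Q\<^esub> \<tau> \<psi> c" if c: "c \<in> carrier H1" for c
      proof -
        obtain x where x: "x \<in> carrier G" "c = homology_class p S x" using surj[OF c] by blast
        have "D (k + 2) #>\<^bsub>G\<^esub> displacement S b (\<phi> \<otimes>\<^bsub>M\<^esub> \<psi>) x =
            D (k + 2) #>\<^bsub>G\<^esub> (displacement S b \<phi> x \<otimes>\<^bsub>G\<^esub> displacement S b \<psi> x)"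
          using D.displacement_comp_coset[OF hom[OF J_M[OF \<phi>]] J_mem[OF \<phi>] hom[OF J_M[OF \<psi>]] J_mem[OF \<psi>] k2 x(1)]
          by (simp add: disp mult[OF J_M[OF \<phi>] J_M[OF \<psi>] x(1)])
        also have "\<dots> = (D (k + 2) #>\<^bsub>G\<^esub> displacement S b \<phi> x) \<otimes>\<^bsub>Q\<^esub> (D (k + 2) #>\<^bsub>G\<^esub> displacement S b \<psi> x)"
          using D.mult_graded_quotient[of "displacement S b \<phi> x" "displacement S b \<psi> x" "k + 1"]
            D.mem_carrier[OF J_mem[OF \<phi> x(1)]] D.mem_carrier[OF J_mem[OF \<psi> x(1)]]
          by (simp add: Q_def disp)
        finally show ?thesis by (simp add: x(2) tau_value[OF _ x(1)] \<phi> \<psi> \<phi>\<psi>)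
      qed
      then have "\<tau> (\<phi> \<otimes>\<^bsub>M\<^esub> \<psi>) = (\<lambda>c\<in>carrier H1. \<tau> \<phi> c \<otimes>\<^bsub>Q\<^esub> \<tau> \<psi> c)"
        by (intro extensionalityI[OF ext restrict_extensional]) simp
      then show "\<tau> (\<phi> \<otimes>\<^bsub>M\<lparr>carrier := J\<rparr>\<^esub> \<psi>) = \<tau> \<phi> \<otimes>\<^bsub>Hom_group H1 Q\<^esub> \<tau> \<psi>"
        by (simp add: Hom_group_def)
    qed
  qed
  with sub tau_value hc show ?thesis
    unfolding G_def M_def J_def H1_def Q_def \<tau>_def by blast
qed

end
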